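(* Let $d\ge 2$ and $1\le k\le l\le d-1$ be integers. Let $K\subset\mathbb{R}^d$ be a $C^2_+$ convex body with $0\in\operatorname{int}K$. Let $\mathcal{L}_{l+1}$ be a family of linear $(l+1)$-subspaces of $\mathbb{R}^d$ whose union is $\mathbb{R}^d$. Let $(K^t)_{t\in[0,1]}$ be an admissible deformation of $K$, i.e. for each $t\in[0,1]$, $K^t\subset\mathbb{R}^d$ is a convex body with radial function $\varrho^t:S^{d-1}\to(0,\infty)$, $K^t\supset K^0=K$, and $[0,1]\times S^{d-1}\ni(t,u)\mapsto\varrho^t(u)\in(0,\infty)$ is a $C^2$ function. Then: (1) For each tangent affine $l$-plane $Y$ of $K$, the limit $$\lambda(Y):=\lim_{\varepsilon\to 0^+}\frac{V_k(K^{\varepsilon}\cap Y)}{\varepsilon^{k/2}}$$ exists and is finite and non-negative. (2) The function $Y\mapsto\lambda(Y)$, taken only for those tangent affine $l$-planes $Y$ of $K$ that lie in some member of $\mathcal{L}_{l+1}$ (equivalently, $\operatorname{lin}Y\in\mathcal{L}_{l+1}$), uniquely determines $(\partial\varrho^t(u)/\partial t)|_{t=0}$ for each $u\in S^{d-1}$. That is, if $(K^t)_{t\in[0,1]}$ and $(\widetilde K^t)_{t\in[0,1]}$ are two admissible deformations of the same $K$, with radial functions $\varrho^t$ and $\widetilde\varrho^{\,t}$ and limits $\lambda$ and $\widetilde\lambda$ respectively, and $\lambda(Y)=\widetilde\lambda(Y)$ for every tangent affine $l$-plane $Y$ of $K$ with $\operatorname{lin}Y\in\mathcal{L}_{l+1}$,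 then $(\partial\varrho^t(u)/\partial t)|_{t=0}=(\partial\widetilde\varrho^{\,t}(u)/\partial t)|_{t=0}$ for all $u\in S^{d-1}$.
   Context: A convex body in $\mathbb{R}^d$ is a compact convex set with non-empty interior. It is $C^2_+$ if its boundary is a $C^2$ submanifold of $\mathbb{R}^d$ with everywhere positive Gauss curvature. The radial function of a convex body $K$ with $0\in\operatorname{int}K$ is $\varrho(u)=\max\{r\ge 0: ru\in K\}$, $u\in S^{d-1}$. Derivatives at $t=0$ are one-sided (from $t\geq 0$). An affine $l$-plane is an $l$-dimensional affine subspace of $\mathbb{R}^d$; it is tangent to (supports) $K$ if it intersects $K$ but not $\operatorname{int}K$. $\operatorname{lin}Y$ is the linear hull of $Y$; since $0\in\operatorname{int}K$, for $Y$ a tangent affine $l$-plane of $K$ it is a linear $(l+1)$-subspace. $V_k$ denotes the $k$-th intrinsic volume: for a non-empty compact convex set $C\subset\mathbb{R}^d$, the numbers $V_0(C),\dots,V_d(C)$ are defined by $V(C+rB^d)=\sum_{k=0}^d\kappa_{d-k}V_k(C)r^{d-k}$ for all $r\ge 0$, where $V$ is $d$-dimensional volume, $B^d$ is the closed unit ball and $\kappa_j$ is the volume of the unit ball of $\mathbb{R}^j$. (Intrinsic volumes do not depend on the dimension of the ambient Euclidean space; for $C$ contained in an affine $l$-plane, $V_l(C)$ is the $l$-volume of $C$.) *)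

theory Defs
  imports "HOL-Analysis.Analysis"
begin

definition C2_open :: "'a::real_normed_vector set \<Rightarrow> ('a \<Rightarrow> 'b::real_normed_vector) \<Rightarrow> bool" where
  "C2_open U f \<longleftrightarrow> open U \<and>
     (\<exists>(f' :: 'a \<Rightarrow> 'a \<Rightarrow>\<^sub>L 'b) (f'' :: 'a \<Rightarrow> 'a \<Rightarrow>\<^sub>L 'a \<Rightarrow>\<^sub>L 'b).
        (\<forall>x\<in>U. (f has_derivative blinfun_apply (f' x)) (at x)) \<and>
        (\<forall>x\<in>U. (f' has_derivative blinfun_apply (f'' x)) (at x)) \<and>
        continuous_on U f'')"

text \<open>On a set that need not be open (such as \<open>{0..1} \<times> sphere 0 1\<close>, a manifold with boundary),
  \<open>C\<^sup>2\<close> means: locally the restriction of a \<open>C\<^sup>2\<close> function on an open set of the ambient space.\<close>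

definition C2_on :: "'a::real_normed_vector set \<Rightarrow> ('a \<Rightarrow> 'b::real_normed_vector) \<Rightarrow> bool" where
  "C2_on S f \<longleftrightarrow> (\<forall>x\<in>S. \<exists>U g. x \<in> U \<and> C2_open U g \<and> (\<forall>y\<in>S \<inter> U. g y = f y))"

definition convex_body :: "'a::euclidean_space set \<Rightarrow> bool" where
  "convex_body K \<longleftrightarrow> compact K \<and> convex K \<and> interior K \<noteq> {}"

text \<open>A \<open>C\<^sup>2\<close> submanifold of codimension one, the only codimension possible for the boundary of a
  convex body: locally a regular level set of a \<open>C\<^sup>2\<close> function.\<close>

definition C2_hypersurface :: "'a::euclidean_space set \<Rightarrow> bool" where
  "C2_hypersurface M \<longleftrightarrow>
     (\<forall>x\<in>M. \<exists>U (g :: 'a \<Rightarrow> real). x \<in> U \<and> C2_open U g \<and>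
        (\<forall>y\<in>U. frechet_derivative g (at y) \<noteq> (\<lambda>v. 0)) \<and>
        M \<inter> U = {y\<in>U. g y = 0})"

text \<open>The Gauss map. The supporting unit normal is unique if the boundary of \<open>K\<close> is differentiable.\<close>

definition outer_unit_normal :: "'a::euclidean_space set \<Rightarrow> 'a \<Rightarrow> 'a" where
  "outer_unit_normal K x = (THE u. norm u = 1 \<and> (\<forall>y\<in>K. u \<bullet> (y - x) \<le> 0))"

definition orthonormal_basis_of :: "'a::euclidean_space set \<Rightarrow> 'a set \<Rightarrow> bool" where
  "orthonormal_basis_of B T \<longleftrightarrow>
     pairwise orthogonal B \<and> (\<forall>b\<in>B. norm b = 1) \<and> span B = T"

text \<open>The determinant, by the Leibniz formula, of the matrix \<open>(b \<bullet> W c)\<close>, \<open>b, c \<in> B\<close>. If \<open>B\<close> is an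
  orthonormal basis of a subspace \<open>T\<close> and the linear map \<open>W\<close> maps \<open>T\<close> into itself, this is the
  determinant of the restriction of \<open>W\<close> to \<open>T\<close>.\<close>

definition det_wrt :: "'a::euclidean_space set \<Rightarrow> ('a \<Rightarrow> 'a) \<Rightarrow> real" where
  "det_wrt B W = (\<Sum>p | p permutes B. of_int (sign p) * (\<Prod>b\<in>B. b \<bullet> W (p b)))"

text \<open>The Gauss curvature at \<open>x\<close> is the determinant of the Weingarten map, i.e. of the differential
  of the Gauss map on the tangent space at \<open>x\<close>. The derivative is taken within the boundary, so
  \<open>W\<close> is determined on the tangent space only, which is all that \<open>det_wrt\<close> uses; hence \<open>c\<close> is
  unique. With the outer normal the unit ball has curvature \<open>1\<close>.\<close>

definition has_gauss_curvature :: "'a::euclidean_space set \<Rightarrow> 'a \<Rightarrow> real \<Rightarrow> bool" where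
  "has_gauss_curvature K x c \<longleftrightarrow>
     (\<exists>W B. (outer_unit_normal K has_derivative W) (at x within frontier K) \<and>
        orthonormal_basis_of B {v. outer_unit_normal K x \<bullet> v = 0} \<and>
        c = det_wrt B W)"

definition C2_plus :: "'a::euclidean_space set \<Rightarrow> bool" where
  "C2_plus K \<longleftrightarrow> C2_hypersurface (frontier K) \<and>
     (\<forall>x\<in>frontier K. \<exists>c>0. has_gauss_curvature K x c)"

text \<open>The supremum is a maximum for compact \<open>K\<close> containing \<open>0\<close> and \<open>u \<noteq> 0\<close>.\<close>

definition radial_function :: "'a::euclidean_space set \<Rightarrow> 'a \<Rightarrow> real" where
  "radial_function K u = Sup {r. 0 \<le> r \<and> r *\<^sub>R u \<in> K}"

definition admissible_deformation :: "'a::euclidean_space set \<Rightarrow> (real \<Rightarrow> 'a set) \<Rightarrow> bool" where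
  "admissible_deformation K Kt \<longleftrightarrow>
     (\<forall>t\<in>{0..1}. convex_body (Kt t) \<and> K \<subseteq> Kt t) \<and> Kt 0 = K \<and>
     C2_on ({0..1} \<times> sphere 0 1) (\<lambda>(t, u). radial_function (Kt t) u)"

definition tangent_plane :: "nat \<Rightarrow> 'a::euclidean_space set \<Rightarrow> 'a set \<Rightarrow> bool" where
  "tangent_plane l K Y \<longleftrightarrow>
     affine Y \<and> aff_dim Y = int l \<and> Y \<inter> K \<noteq> {} \<and> Y \<inter> interior K = {}"

text \<open>The coefficients in the Steiner formula; the requirement for \<open>j > DIM('a)\<close> only serves to make
  the sequence unique.\<close>

definition intrinsic_volumes :: "'a::euclidean_space set \<Rightarrow> nat \<Rightarrow> real" where
  "intrinsic_volumes C = (THE V.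
     (\<forall>r\<ge>0. measure lborel {x + y | x y. x \<in> C \<and> y \<in> cball 0 r} =
        (\<Sum>j\<le>DIM('a). unit_ball_vol (real (DIM('a) - j)) * V j * r ^ (DIM('a) - j))) \<and>
     (\<forall>j>DIM('a). V j = 0))"

definition section_ratio :: "nat \<Rightarrow> (real \<Rightarrow> 'a::euclidean_space set) \<Rightarrow> 'a set \<Rightarrow> real \<Rightarrow> real" where
  "section_ratio k Kt Y \<epsilon> = intrinsic_volumes (Kt \<epsilon> \<inter> Y) k / \<epsilon> powr (real k / 2)"

definition section_limit :: "nat \<Rightarrow> (real \<Rightarrow> 'a::euclidean_space set) \<Rightarrow> 'a set \<Rightarrow> real" where
  "section_limit k Kt Y = Lim (at_right 0) (section_ratio k Kt Y)"

end

theory Submission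
  imports Defs "HOL-Computational_Algebra.Polynomial"
begin

text \<open>The section of \<open>K\<^sup>\<epsilon>\<close> by a tangent plane \<open>Y = x\<^sub>0 + T\<close>, rescaled by \<open>1 / sqrt \<epsilon>\<close> about the point of
  tangency, converges to the ellipsoid \<open>{v \<in> T. H v \<bullet> v / 2 \<le> h}\<close>, where \<open>h\<close> is the time
  derivative of the radial function in the direction of \<open>x\<^sub>0\<close> and \<open>H\<close> is the Hessian at \<open>x\<^sub>0\<close> of
  \<open>norm x - \<rho> (x / norm x)\<close>, the function whose sublevel set is \<open>K\<close>. Positive curvature makes
  \<open>H\<close> positive definite on \<open>T\<close>, and \<open>H\<close> depends on \<open>K\<close> only. By homogeneity and monotonicity of \<open>V\<^sub>k\<close>, the limit is \<open>h powr (k / 2)\<close> times the positive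
  \<open>V\<^sub>k\<close> of a fixed ellipsoid, which determines \<open>h\<close>.

  The Steiner formula comes from zonotopes: the volume of \<open>C + \<Sum>i. t\<^sub>i S\<^sub>i\<close>, with segments \<open>S\<^sub>i\<close>, is affine
  in every \<open>t\<^sub>i\<close>, and its coefficients increase with \<open>C\<close>. The ball is a limit of zonotopes, and on
  polynomials of bounded degree pointwise convergence is convergence of coefficients. In particular
  intrinsic volumes are monotone.\<close>

subsection \<open>Functionals affine along segments\<close>

text \<open>The scale \<open>sqrt \<epsilon>\<close> is where two effects balance: in tangential
  directions the gap of \<open>K\<close> grows quadratically, while the deformation lowers it
  linearly in \<open>\<epsilon>\<close>. No continuity theorem for intrinsic volumes is used. The
  rescaled sections are squeezed between members of one homothetic family of ellipsoids, on which
  \<open>V\<^sub>k\<close> is an explicit power. The expansions control the section on bounded sets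
  only; convexity excludes far points, because pulling one back towards the point of tangency would
  give a point of the section that the expansions forbid. Positive curvature only makes a
  determinant positive. Semidefiniteness of \<open>H\<close> comes from convexity, and the two
  together give definiteness. As \<open>intrinsic_volumes\<close> is a definite description, nothing
  is known about it before a Steiner polynomial has been shown to exist and to be unique. For a
  direction \<open>u\<close>, the covering family supplies a member \<open>L\<close> through the
  boundary point above \<open>u\<close>. The plane used is the intersection of \<open>L\<close> with
  the supporting hyperplane there; that hyperplane misses the origin, so the plane has dimension
  \<open>l\<close> and spans \<open>L\<close>.\<close>

definition compact_convex :: "'a::euclidean_space set \<Rightarrow> bool" where
  "compact_convex C \<longleftrightarrow> compact C \<and> convex C \<and> C \<noteq> {}"

lemma compact_set_plus: "compact A \<Longrightarrow> compact B \<Longrightarrow> compact (A + B)" for A B :: "'a::real_normed_vector set"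
proof -
  assume "compact A" "compact B"
  moreover have "A + B = {x + y |x y. x \<in> A \<and> y \<in> B}" by (auto simp: set_plus_def)
  ultimately show ?thesis by (simp add: compact_sums)
qed

lemma compact_convex_plus:
  assumes "compact_convex A" "compact_convex B" shows "compact_convex (A + B)"
proof -
  have "A + B \<noteq> {}" using assms by (auto simp: compact_convex_def set_plus_def)
  then show ?thesis using assms by (simp add: compact_convex_def compact_set_plus convex_set_plus)
qed

lemma compact_convex_segment: "compact_convex (closed_segment a b)"
  by (simp add: compact_convex_def)

lemma compact_convex_cball: "0 \<le> r \<Longrightarrow> compact_convex (cball a r)"
  by (simp add: compact_convex_def)

lemma compact_convex_sum:
  "(\<And>i. i \<in> I \<Longrightarrow> compact_convex (S i)) \<Longrightarrow> compact_convex (sum S I)"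
proof (induction I rule: infinite_finite_induct)
  case (insert x F)
  then show ?case by (simp add: compact_convex_plus)
qed (auto simp: compact_convex_def set_zero)

lemma compact_convex_scaleR: "compact_convex C \<Longrightarrow> compact_convex ((*\<^sub>R) r ` C)"
  by (auto simp: compact_convex_def compact_scaling convex_scaling)

lemma compact_convex_translation: "compact_convex C \<Longrightarrow> compact_convex ((+) a ` C)"
  by (auto simp: compact_convex_def compact_translation convex_translation)

lemma compact_convex_lmeasurable: "compact_convex C \<Longrightarrow> C \<in> lmeasurable"
  by (simp add: compact_convex_def lmeasurable_compact)

lemma set_plus_segment_iff:
  assumes "0 \<le> t"
  shows "x \<in> C + closed_segment 0 (t *\<^sub>R v) \<longleftrightarrow> (\<exists>c\<in>C. \<exists>s. 0 \<le> s \<and> s \<le> t \<and> x = c + s *\<^sub>R v)"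
proof
  assume "x \<in> C + closed_segment 0 (t *\<^sub>R v)"
  then obtain c u where "c \<in> C" "0 \<le> u" "u \<le> 1" "x = c + u *\<^sub>R (t *\<^sub>R v)"
    by (auto simp: set_plus_def closed_segment_def)
  then show "\<exists>c\<in>C. \<exists>s. 0 \<le> s \<and> s \<le> t \<and> x = c + s *\<^sub>R v"
    using assms by (intro bexI[of _ c] exI[of _ "u * t"]) (auto simp: mult_left_le_one_le)
next
  assume "\<exists>c\<in>C. \<exists>s. 0 \<le> s \<and> s \<le> t \<and> x = c + s *\<^sub>R v"
  then obtain c s where cs: "c \<in> C" "0 \<le> s" "s \<le> t" "x = c + s *\<^sub>R v" by auto
  have "s *\<^sub>R v \<in> closed_segment 0 (t *\<^sub>R v)"
  proof (cases "t = 0")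
    case False
    then show ?thesis using cs assms unfolding closed_segment_def
      by (intro CollectI exI[of _ "s / t"]) (auto simp: field_simps)
  qed (use cs in auto)
  then show "x \<in> C + closed_segment 0 (t *\<^sub>R v)" using cs by auto
qed

text \<open>On a line parallel to \<open>v\<close> the set \<open>C\<close> is an interval, and
  adding a segment only prolongs it at its far end. What a further piece
  \<open>h *\<^sub>R v\<close> contributes is therefore the same as at the start, moved by
  \<open>t *\<^sub>R v\<close>. Convexity is used for the inclusion from right to left.\<close>

lemma set_plus_segment_diff:
  fixes C :: "'a::euclidean_space set"
  assumes "convex C" "0 \<le> t" "0 \<le> h"
  shows "(C + closed_segment 0 ((t + h) *\<^sub>R v)) - (C + closed_segment 0 (t *\<^sub>R v))
    = (+) (t *\<^sub>R v) ` ((C + closed_segment 0 (h *\<^sub>R v)) - C)" (is "?L = ?R")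
proof (intro equalityI subsetI)
  fix y assume y: "y \<in> ?L"
  then obtain c s where cs: "c \<in> C" "0 \<le> s" "s \<le> t + h" "y = c + s *\<^sub>R v"
    using set_plus_segment_iff[of "t + h" y C v] assms by auto
  have no: "\<not> (\<exists>c\<in>C. \<exists>s. 0 \<le> s \<and> s \<le> t \<and> y = c + s *\<^sub>R v)"
    using y set_plus_segment_iff[of t y C v] assms by auto
  have "s > t" using no cs by (metis not_le)
  have "y - t *\<^sub>R v \<notin> C" using no assms by (metis diff_add_cancel order_refl)
  moreover have "y - t *\<^sub>R v \<in> C + closed_segment 0 (h *\<^sub>R v)"
    using cs \<open>s > t\<close> assms by (subst set_plus_segment_iff) (auto simp: algebra_simps intro!: bexI[of _ c] exI[of _ "s - t"])
  ultimately show "y \<in> ?R" by (intro image_eqI[of _ _ "y - t *\<^sub>R v"]) auto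
next
  fix y assume "y \<in> ?R"
  then obtain x where x: "y = t *\<^sub>R v + x" "x \<in> C + closed_segment 0 (h *\<^sub>R v)" "x \<notin> C" by auto
  then obtain c s where cs: "c \<in> C" "0 \<le> s" "s \<le> h" "x = c + s *\<^sub>R v"
    using set_plus_segment_iff[of h x C v] assms by auto
  have "y \<in> C + closed_segment 0 ((t + h) *\<^sub>R v)"
    using cs x assms by (subst set_plus_segment_iff) (auto simp: algebra_simps intro!: bexI[of _ c] exI[of _ "s + t"])
  moreover have "y \<notin> C + closed_segment 0 (t *\<^sub>R v)"
  proof
    assume "y \<in> C + closed_segment 0 (t *\<^sub>R v)"
    then obtain c' s' where cs': "c' \<in> C" "0 \<le> s'" "s' \<le> t" "y = c' + s' *\<^sub>R v"
      using set_plus_segment_iff[of t y C v] assms by auto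
    \<comment> \<open>The point \<open>x\<close> lies between \<open>c = x - s *\<^sub>R v\<close>
      and \<open>c' = x + a *\<^sub>R v\<close>, both in \<open>C\<close>, so it would have to
      belong to \<open>C\<close>.\<close>
    define a where "a = t - s'"
    have a: "a \<ge> 0" "x = c' - a *\<^sub>R v" using cs' x by (auto simp: a_def algebra_simps)
    show False
    proof (cases "a + s = 0")
      case True
      then have "s = 0" using a cs by auto
      then show False using cs x by auto
    next
      case False
      then have p: "a + s > 0" using a cs by auto
      have "x = (a / (a+s)) *\<^sub>R c + (s / (a+s)) *\<^sub>R c'"
      proof -
        have 1: "(a + s) *\<^sub>R x = a *\<^sub>R c + s *\<^sub>R c'"
        proof -
          have c: "c = x - s *\<^sub>R v" using cs by simp
          have c': "c' = x + a *\<^sub>R v" using a by simp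
          show ?thesis unfolding c c' by (simp add: algebra_simps)
        qed
        have "x = (1 / (a + s)) *\<^sub>R ((a + s) *\<^sub>R x)" using p by simp
        then show ?thesis unfolding 1 by (simp add: algebra_simps)
      qed
      moreover have "a / (a+s) + s / (a+s) = 1" using p by (simp add: add_divide_distrib[symmetric])
      ultimately have "x \<in> C" using convexD[OF assms(1) cs(1) cs'(1), of "a/(a+s)" "s/(a+s)"] a cs p by auto
      then show False using x by auto
    qed
  qed
  ultimately show "y \<in> ?L" by auto
qed

text \<open>Cauchy's functional equation on the half-line: additivity settles the multiples of
  \<open>1 / n\<close>, and monotonicity squeezes \<open>t\<close> between two neighbouring ones,
  with an error of at most \<open>g 1 / n\<close>.\<close>

lemma mono_additive_imp_linear:
  fixes g :: "real \<Rightarrow> real"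
  assumes add: "\<And>s t. 0 \<le> s \<Longrightarrow> 0 \<le> t \<Longrightarrow> g (s + t) = g s + g t"
    and mono: "\<And>s t. 0 \<le> s \<Longrightarrow> s \<le> t \<Longrightarrow> g s \<le> g t"
    and t: "0 \<le> t"
  shows "g t = t * g 1"
proof -
  have g0: "g 0 = 0" using add[of 0 0] by simp
  have nat: "g (real m * s) = real m * g s" if "0 \<le> s" for m s
    by (induction m) (use that in \<open>auto simp: g0 add algebra_simps\<close>)
  have g1: "g 1 \<ge> 0" using mono[of 0 1] g0 by simp
  have "\<bar>g t - t * g 1\<bar> \<le> g 1 / real n" if "n > 0" for n :: nat
  proof -
    define m where "m = nat \<lfloor>real n * t\<rfloor>"
    have m: "real m \<le> real n * t" "real n * t \<le> real m + 1"
      using t unfolding m_def by (auto simp: of_nat_nat)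
    have gq: "g (real j / real n) = real j / real n * g 1" for j
    proof -
      have "g 1 = real n * g (1 / real n)" using nat[of "1 / real n" n] that by simp
      then show ?thesis using nat[of "1 / real n" j] that by simp
    qed
    have "g (real m / real n) \<le> g t" using m that by (intro mono) (auto simp: field_simps)
    moreover have "g t \<le> g (real (m+1) / real n)" using m that t by (intro mono) (auto simp: field_simps)
    ultimately have 1: "real m / real n * g 1 \<le> g t" "g t \<le> (real m + 1) / real n * g 1"
      using gq[of m] gq[of "m+1"] by (auto simp: add.commute)
    have "real m / real n \<le> t" "t \<le> (real m + 1) / real n"
      using m that by (auto simp: field_simps)
    then have 2: "real m / real n * g 1 \<le> t * g 1" "t * g 1 \<le> (real m + 1) / real n * g 1"
      using g1 by (auto intro!: mult_right_mono simp del: times_divide_eq_left)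
    have "(real m + 1) / real n * g 1 = real m / real n * g 1 + g 1 / real n"
      by (simp add: add_divide_distrib algebra_simps)
    then show ?thesis using 1 2 by linarith
  qed
  then have "\<forall>\<^sub>F n in sequentially. \<bar>g t - t * g 1\<bar> \<le> g 1 / real n"
    by (intro eventually_sequentiallyI[of 1]) auto
  moreover have "(\<lambda>n. g 1 / real n) \<longlonglongrightarrow> 0" by (rule lim_const_over_n)
  ultimately have "\<bar>g t - t * g 1\<bar> \<le> 0"
    by (intro tendsto_le[OF trivial_limit_sequentially _ tendsto_const]) auto
  then show ?thesis by simp
qed

lemma subset_set_plus: "0 \<in> B \<Longrightarrow> A \<subseteq> A + B" for A :: "'a::comm_monoid_add set"
  by (metis add.commute set_zero_plus2)

text \<open>The gained volume is additive in \<open>t\<close> by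
  \<open>set_plus_segment_diff\<close> and translation invariance, and it is monotone, so it is
  linear. This replaces an integration over the lines parallel to \<open>v\<close>.\<close>

lemma measure_plus_segment:
  fixes C :: "'a::euclidean_space set"
  assumes C: "compact_convex C" and t: "0 \<le> t"
  shows "measure lebesgue (C + closed_segment 0 (t *\<^sub>R v)) =
    measure lebesgue C + t * (measure lebesgue (C + closed_segment 0 v) - measure lebesgue C)"
proof -
  define S where "S t = C + closed_segment 0 (t *\<^sub>R v)" for t
  have S: "compact_convex (S t)" for t
    unfolding S_def by (intro compact_convex_plus C compact_convex_segment)
  have L: "S t \<in> lmeasurable" "C \<in> lmeasurable" for t
    using S C by (auto intro: compact_convex_lmeasurable)
  have CS: "C \<subseteq> S t" for t unfolding S_def by (intro subset_set_plus) auto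
  have mono: "S s \<subseteq> S t" if "0 \<le> s" "s \<le> t" for s t
    unfolding S_def using that set_plus_segment_iff[of s _ C v] set_plus_segment_iff[of t _ C v] by force
  define g where "g t = measure lebesgue (S t) - measure lebesgue C" for t
  have "g t = t * g 1"
  proof (rule mono_additive_imp_linear[OF _ _ t])
    fix s t :: real assume st: "0 \<le> s" "0 \<le> t"
    have "measure lebesgue (S (s + t)) - measure lebesgue (S s) = measure lebesgue (S (s+t) - S s)"
      using L mono[of s "s+t"] st by (subst measurable_measure_Diff) auto
    also have "\<dots> = measure lebesgue (S t - C)"
      using set_plus_segment_diff[of C s t v] C st unfolding S_def compact_convex_def
      by (simp add: measure_translation)
    also have "\<dots> = measure lebesgue (S t) - measure lebesgue C"
      using L CS by (subst measurable_measure_Diff) auto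
    finally show "g (s + t) = g s + g t" by (simp add: g_def)
  next
    fix s t :: real assume st: "0 \<le> s" "s \<le> t"
    show "g s \<le> g t" unfolding g_def using measure_mono_fmeasurable[OF mono[OF st]] L by (auto simp: fmeasurableD)
  qed
  then show ?thesis by (simp add: g_def S_def)
qed

text \<open>The functionals whose iterated differences along segments behave like mixed volumes.\<close>

definition segment_affine :: "('a::euclidean_space set \<Rightarrow> real) \<Rightarrow> bool" where
  "segment_affine \<phi> \<longleftrightarrow>
     (\<forall>C. compact_convex C \<longrightarrow> 0 \<le> \<phi> C) \<and>
     (\<forall>C D. compact_convex C \<longrightarrow> compact_convex D \<longrightarrow> C \<subseteq> D \<longrightarrow> \<phi> C \<le> \<phi> D) \<and>
     (\<forall>C v t. compact_convex C \<longrightarrow> 0 \<le> t \<longrightarrow>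
        \<phi> (C + closed_segment 0 (t *\<^sub>R v)) = \<phi> C + t * (\<phi> (C + closed_segment 0 v) - \<phi> C))"

lemma segment_affine_measure: "segment_affine (measure lebesgue)"
  unfolding segment_affine_def
  by (auto simp: measure_plus_segment compact_convex_lmeasurable fmeasurableD intro!: measure_mono_fmeasurable)

text \<open>Monotonicity of the difference is the point: for \<open>C \<subseteq> D\<close> the
  affine function of \<open>t\<close> belonging to \<open>C\<close> stays below the one belonging to
  \<open>D\<close> on the whole half-line, which forces the same order on the slopes. So differences
  can be iterated, and all of them are nonnegative and monotone.\<close>

lemma segment_affine_diff:
  fixes \<phi> :: "'a::euclidean_space set \<Rightarrow> real"
  assumes "segment_affine \<phi>"
  shows "segment_affine (\<lambda>C. \<phi> (C + closed_segment 0 v) - \<phi> C)"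
proof -
  have mono: "\<phi> C \<le> \<phi> D" if "compact_convex C" "compact_convex D" "C \<subseteq> D" for C D
    using assms that by (auto simp: segment_affine_def)
  have aff: "\<phi> (C + closed_segment 0 (t *\<^sub>R w)) = \<phi> C + t * (\<phi> (C + closed_segment 0 w) - \<phi> C)"
    if "compact_convex C" "0 \<le> t" for C t w
    using assms that by (auto simp: segment_affine_def)
  have cc: "compact_convex (C + closed_segment 0 w)" if "compact_convex C" for C :: "'a set" and w
    using that by (intro compact_convex_plus compact_convex_segment)
  show ?thesis unfolding segment_affine_def
  proof (intro conjI allI impI)
    fix C :: "'a set" assume C: "compact_convex C"
    have "\<phi> C \<le> \<phi> (C + closed_segment 0 v)" by (intro mono C cc subset_set_plus) auto
    then show "0 \<le> \<phi> (C + closed_segment 0 v) - \<phi> C" by simp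
  next
    fix C D :: "'a set" assume CD: "compact_convex C" "compact_convex D" "C \<subseteq> D"
    define a where "a = \<phi> (C + closed_segment 0 v) - \<phi> C"
    define b where "b = \<phi> (D + closed_segment 0 v) - \<phi> D"
    have le: "\<phi> C + t * a \<le> \<phi> D + t * b" if "t \<ge> 0" for t
      unfolding a_def b_def aff[OF CD(1) that, symmetric] aff[OF CD(2) that, symmetric]
      using CD by (intro mono cc set_plus_mono2) auto
    have "a \<le> b"
    proof (rule ccontr)
      assume "\<not> a \<le> b"
      then have ab: "a - b > 0" by simp
      \<comment> \<open>At this \<open>t\<close> the steeper slope \<open>a\<close> has overtaken
        the initial advantage of \<open>D\<close> by exactly 1.\<close>
      define t where "t = (\<phi> D - \<phi> C + 1) / (a - b)"
      have "t \<ge> 0" unfolding t_def using ab mono[OF CD] by (intro divide_nonneg_pos) auto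
      moreover have "t * (a - b) = \<phi> D - \<phi> C + 1" using ab by (simp add: t_def)
      ultimately show False using le[of t] by (simp add: algebra_simps)
    qed
    then show "\<phi> (C + closed_segment 0 v) - \<phi> C \<le> \<phi> (D + closed_segment 0 v) - \<phi> D"
      by (simp add: a_def b_def)
  next
    fix C :: "'a set" and w and t :: real assume C: "compact_convex C" and t: "0 \<le> t"
    have 1: "C + closed_segment 0 s + closed_segment 0 v = C + closed_segment 0 v + closed_segment 0 s" for s
      by (simp add: add.assoc add.commute[of "closed_segment 0 v"])
    show "\<phi> (C + closed_segment 0 (t *\<^sub>R w) + closed_segment 0 v) - \<phi> (C + closed_segment 0 (t *\<^sub>R w)) =
        \<phi> (C + closed_segment 0 v) - \<phi> C + t * (\<phi> (C + closed_segment 0 w + closed_segment 0 v)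
         - \<phi> (C + closed_segment 0 w) - (\<phi> (C + closed_segment 0 v) - \<phi> C))"
      unfolding 1 aff[OF C t] aff[OF cc[OF C] t] by (simp add: algebra_simps)
  qed
qed

text \<open>The functional is generalized in the induction because splitting off one segment turns
  \<open>\<phi>\<close> into \<open>\<phi> + r * \<psi>\<close>, where \<open>\<psi>\<close> is its
  difference along that segment. The degree is bounded here only by the number of segments; the
  bound by the dimension comes later, from growth.\<close>

lemma segment_affine_zonotope_poly:
  fixes \<phi> :: "'a::euclidean_space set \<Rightarrow> real" and v :: "'i \<Rightarrow> 'a"
  assumes "finite I" "segment_affine \<phi>"
  shows "\<exists>p :: 'a set \<Rightarrow> real poly.
    (\<forall>C r. compact_convex C \<longrightarrow> 0 \<le> r \<longrightarrow> \<phi> (C + (\<Sum>i\<in>I. closed_segment 0 (r *\<^sub>R v i))) = poly (p C) r) \<and>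
    (\<forall>C j. compact_convex C \<longrightarrow> 0 \<le> coeff (p C) j) \<and>
    (\<forall>C D j. compact_convex C \<longrightarrow> compact_convex D \<longrightarrow> C \<subseteq> D \<longrightarrow> coeff (p C) j \<le> coeff (p D) j)"
  using assms
proof (induction I arbitrary: \<phi> rule: finite_induct)
  case empty
  then show ?case
    by (intro exI[of _ "\<lambda>C. [:\<phi> C:]"]) (auto simp: segment_affine_def coeff_pCons split: nat.split)
next
  case (insert i I)
  define \<psi> where "\<psi> C = \<phi> (C + closed_segment 0 (v i)) - \<phi> C" for C
  have \<psi>: "segment_affine \<psi>" unfolding \<psi>_def using segment_affine_diff[OF insert.prems] .
  obtain p where p: "\<And>C r. compact_convex C \<Longrightarrow> 0 \<le> r \<Longrightarrow> \<phi> (C + (\<Sum>i\<in>I. closed_segment 0 (r *\<^sub>R v i))) = poly (p C) r"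
    "\<And>C j. compact_convex C \<Longrightarrow> 0 \<le> coeff (p C) j"
    "\<And>C D j. compact_convex C \<Longrightarrow> compact_convex D \<Longrightarrow> C \<subseteq> D \<Longrightarrow> coeff (p C) j \<le> coeff (p D) j"
    using insert.IH[OF insert.prems] by metis
  obtain q where q: "\<And>C r. compact_convex C \<Longrightarrow> 0 \<le> r \<Longrightarrow> \<psi> (C + (\<Sum>i\<in>I. closed_segment 0 (r *\<^sub>R v i))) = poly (q C) r"
    "\<And>C j. compact_convex C \<Longrightarrow> 0 \<le> coeff (q C) j"
    "\<And>C D j. compact_convex C \<Longrightarrow> compact_convex D \<Longrightarrow> C \<subseteq> D \<Longrightarrow> coeff (q C) j \<le> coeff (q D) j"
    using insert.IH[OF \<psi>] by metis
  define P where "P C = p C + pCons 0 (q C)" for C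
  have "\<phi> (C + (\<Sum>i\<in>insert i I. closed_segment 0 (r *\<^sub>R v i))) = poly (P C) r"
    if C: "compact_convex C" and r: "0 \<le> r" for C r
  proof -
    define Z where "Z = (\<Sum>i\<in>I. closed_segment 0 (r *\<^sub>R v i))"
    have Z: "compact_convex (C + Z)" unfolding Z_def
      by (intro compact_convex_plus C compact_convex_sum compact_convex_segment)
    have "\<phi> (C + (\<Sum>i\<in>insert i I. closed_segment 0 (r *\<^sub>R v i))) = \<phi> ((C + Z) + closed_segment 0 (r *\<^sub>R v i))"
      using insert.hyps by (simp add: Z_def add_ac)
    also have "\<dots> = \<phi> (C + Z) + r * \<psi> (C + Z)"
      using insert.prems Z r unfolding segment_affine_def \<psi>_def by auto
    finally show ?thesis using p(1)[OF C r] q(1)[OF C r] by (simp add: Z_def P_def)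
  qed
  moreover have "0 \<le> coeff (P C) j" if "compact_convex C" for C j
    using p(2) q(2) that by (auto simp: P_def coeff_pCons split: nat.split)
  moreover have "coeff (P C) j \<le> coeff (P D) j" if "compact_convex C" "compact_convex D" "C \<subseteq> D" for C D j
    using p(3) q(3) that by (auto simp: P_def coeff_pCons add_mono split: nat.split)
  ultimately show ?case by (intro exI[of _ P]) blast
qed

subsection \<open>Approximation of the ball by zonotopes\<close>

lemma nn_integral_lborel_translation:
  fixes c :: "'a::euclidean_space"
  assumes [measurable]: "g \<in> borel_measurable borel"
  shows "(\<integral>\<^sup>+x. g (x + c) \<partial>lborel) = (\<integral>\<^sup>+x. g x \<partial>lborel)"
proof -
  have "(\<integral>\<^sup>+x. g x \<partial>lborel) = (\<integral>\<^sup>+x. g x \<partial>distr lborel borel ((+) c))" by (simp add: lborel_distr_plus)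
  also have "\<dots> = (\<integral>\<^sup>+x. g (c + x) \<partial>lborel)" by (subst nn_integral_distr) auto
  finally show ?thesis by (simp add: add.commute)
qed

text \<open>Uniqueness of translation invariant measures, applied to the image of Lebesgue measure under
  an isometry; the constant factor is found by testing on the unit ball.\<close>

lemma lborel_distr_involutive_isometry:
  fixes f :: "'a::euclidean_space \<Rightarrow> 'a"
  assumes lin: "linear f" and norm: "\<And>x. norm (f x) = norm x" and inv: "\<And>x. f (f x) = x"
  shows "distr lborel borel f = lborel"
proof (rule measure_eqI)
  fix A assume "A \<in> sets (distr lborel borel f)"
  then have A[measurable]: "A \<in> sets borel" by simp
  have [measurable]: "f \<in> borel_measurable borel"
    using lin by (intro borel_measurable_continuous_onI linear_continuous_on) (simp add: linear_conv_bounded_linear)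
  define B where "B = cball (0::'a) 1"
  have B[measurable]: "B \<in> sets borel" by (simp add: B_def)
  let ?I = "\<lambda>S x. indicator S x :: ennreal"
  have "emeasure (distr lborel borel f) A * emeasure lborel B
      = (\<integral>\<^sup>+x. ?I A (f x) \<partial>lborel) * emeasure lborel B"
    by (subst nn_integral_distr[symmetric, of _ _ borel]) auto
  \<comment> \<open>The volume of the ball becomes an integral, and Fubini with translations moves
    \<open>f\<close> from the indicator of \<open>A\<close> to that of \<open>B\<close>. There it
    disappears, since applying the isometry to \<open>y - f x\<close> shows that
    \<open>y - f x\<close> and \<open>x - f y\<close> have equal norm.\<close>
  also have "\<dots> = (\<integral>\<^sup>+y. ?I B y * (\<integral>\<^sup>+x. ?I A (f x) \<partial>lborel) \<partial>lborel)"
    by (subst nn_integral_multc) (auto simp: mult.commute)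
  also have "\<dots> = (\<integral>\<^sup>+y. ?I B y * (\<integral>\<^sup>+x. ?I A (f x + y) \<partial>lborel) \<partial>lborel)"
  proof (rule nn_integral_cong, rule arg_cong2[where f="(*)", OF refl])
    fix y
    have "f (x + f y) = f x + y" for x using lin inv by (simp add: linear_add)
    then show "(\<integral>\<^sup>+x. ?I A (f x) \<partial>lborel) = (\<integral>\<^sup>+x. ?I A (f x + y) \<partial>lborel)"
      using nn_integral_lborel_translation[of "\<lambda>x. ?I A (f x)" "f y"] by simp
  qed
  also have "\<dots> = (\<integral>\<^sup>+y. (\<integral>\<^sup>+x. ?I B y * ?I A (f x + y) \<partial>lborel) \<partial>lborel)"
    by (rule nn_integral_cong, rule nn_integral_cmult[symmetric]) auto
  also have "\<dots> = (\<integral>\<^sup>+x. (\<integral>\<^sup>+y. ?I B y * ?I A (f x + y) \<partial>lborel) \<partial>lborel)"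
    by (rule lborel_pair.Fubini') auto
  also have "\<dots> = (\<integral>\<^sup>+x. (\<integral>\<^sup>+y. ?I B (y - f x) * ?I A y \<partial>lborel) \<partial>lborel)"
  proof (rule nn_integral_cong)
    fix x
    show "(\<integral>\<^sup>+y. ?I B y * ?I A (f x + y) \<partial>lborel) = (\<integral>\<^sup>+y. ?I B (y - f x) * ?I A y \<partial>lborel)"
      using nn_integral_lborel_translation[of "\<lambda>y. ?I B (y - f x) * ?I A y" "f x"]
      by (simp add: add.commute)
  qed
  also have "\<dots> = (\<integral>\<^sup>+y. (\<integral>\<^sup>+x. ?I B (y - f x) * ?I A y \<partial>lborel) \<partial>lborel)"
    by (rule lborel_pair.Fubini') auto
  also have "\<dots> = (\<integral>\<^sup>+y. (\<integral>\<^sup>+x. ?I B (x - f y) \<partial>lborel) * ?I A y \<partial>lborel)"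
  proof (rule nn_integral_cong)
    fix y
    have "norm (y - f x) = norm (x - f y)" for x
      using norm[of "y - f x"] lin inv by (simp add: linear_diff norm_minus_commute)
    then have "?I B (y - f x) = ?I B (x - f y)" for x by (simp add: B_def indicator_def)
    then show "(\<integral>\<^sup>+x. ?I B (y - f x) * ?I A y \<partial>lborel) = (\<integral>\<^sup>+x. ?I B (x - f y) \<partial>lborel) * ?I A y"
      by (simp add: nn_integral_multc)
  qed
  also have "\<dots> = (\<integral>\<^sup>+y. emeasure lborel B * ?I A y \<partial>lborel)"
  proof (rule nn_integral_cong, rule arg_cong2[where f="(*)", OF _ refl])
    fix y
    show "(\<integral>\<^sup>+x. ?I B (x - f y) \<partial>lborel) = emeasure lborel B"
      using nn_integral_lborel_translation[of "?I B" "- f y"] by simp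
  qed
  also have "\<dots> = emeasure lborel A * emeasure lborel B"
    by (subst nn_integral_cmult) (auto simp: mult.commute)
  finally show "emeasure (distr lborel borel f) A = emeasure lborel A"
    using ennreal_mult_cancel_left[of "emeasure lborel B" "emeasure (distr lborel borel f) A" "emeasure lborel A"]
      emeasure_cball[of 1 "0::'a"] unit_ball_vol_pos[of "real DIM('a)"]
    by (auto simp: mult.commute B_def simp del: unit_ball_vol_pos)
qed simp

text \<open>For \<open>u \<noteq> v\<close> this is the reflection in the hyperplane orthogonal to
  \<open>u - v\<close>. Being its own inverse, it fits the hypotheses of
  \<open>lborel_distr_involutive_isometry\<close>.\<close>

lemma exists_involutive_isometry:
  fixes u v :: "'a::euclidean_space"
  assumes "norm u = norm v"
  obtains f where "linear f" "\<And>x. norm (f x) = norm x" "\<And>x. f (f x) = x" "f u = v"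
proof (cases "u = v")
  case True
  then show ?thesis by (intro that[of "\<lambda>x. x"]) (auto simp: linear_id[unfolded id_def])
next
  case False
  define w where "w = u - v"
  have w: "w \<bullet> w \<noteq> 0" using False by (simp add: w_def)
  define f where "f x = x - (2 * (x \<bullet> w) / (w \<bullet> w)) *\<^sub>R w" for x
  have uv: "u \<bullet> u = v \<bullet> v" using assms by (simp add: norm_eq)
  have "2 * (u \<bullet> w) = w \<bullet> w"
    using uv by (simp add: w_def inner_diff_left inner_diff_right inner_commute)
  then have "f u = v" using w by (simp add: f_def w_def)
  have "linear f"
    by (rule linearI) (auto simp: f_def inner_add_left algebra_simps add_divide_distrib)
  have "norm (f x) = norm x" for x
  proof -
    have "f x \<bullet> f x = x \<bullet> x" using w
      by (simp add: f_def inner_diff_left inner_diff_right inner_commute[of w x] field_simps)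
    then show ?thesis by (simp add: norm_eq)
  qed
  have "f (f x) = x" for x
  proof -
    have "f x \<bullet> w = - (x \<bullet> w)" using w by (simp add: f_def inner_diff_left)
    then have "f (f x) = f x + (2 * (x \<bullet> w) / (w \<bullet> w)) *\<^sub>R w" by (simp add: f_def[of "f x"])
    then show ?thesis by (simp add: f_def)
  qed
  show ?thesis by (rule that) fact+
qed

lemma set_integrable_bounded_pos_inner:
  fixes u :: "'a::euclidean_space"
  assumes "A \<in> sets borel" "bounded A"
  shows "set_integrable lborel A (\<lambda>v. max 0 (u \<bullet> v))"
proof -
  obtain r where "\<forall>x\<in>A. norm x \<le> r" using assms(2) by (auto simp: bounded_iff)
  then have r: "A \<subseteq> cball 0 r" by auto
  have "set_integrable lborel (cball 0 r) (\<lambda>v. max 0 (u \<bullet> v))"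
    unfolding set_integrable_def by (intro borel_integrable_compact) (auto intro!: continuous_intros)
  then show ?thesis by (rule set_integrable_subset) (use assms r in auto)
qed

text \<open>A Riemann sum for the support function of a zonoid: \<open>A\<close> is cut into pieces,
  one inside each ball, and \<open>w i\<close> is the volume of the piece of \<open>i\<close>. The
  integrand is 1-Lipschitz in \<open>v\<close> for every unit vector \<open>u\<close>, so one choice
  of weights serves all \<open>u\<close> at once.\<close>

lemma zonotope_approx_integral:
  fixes I :: "'a::euclidean_space set"
  assumes "finite I" "A \<in> sets borel" "bounded A" "A \<subseteq> (\<Union>x\<in>I. ball x d)"
  shows "\<exists>w. (\<forall>i. 0 \<le> w i) \<and> (\<forall>u. norm u = 1 \<longrightarrow>
     \<bar>(\<Sum>i\<in>I. w i * max 0 (u \<bullet> i)) - (LINT v:A|lborel. max 0 (u \<bullet> v))\<bar> \<le> d * measure lborel A)"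
  using assms
proof (induction I arbitrary: A rule: finite_induct)
  case empty
  then show ?case by (intro exI[of _ "\<lambda>_. 0"]) (auto simp: set_lebesgue_integral_def)
next
  case (insert x I)
  define P where "P = A \<inter> ball x d"
  define Q where "Q = A - ball x d"
  have PQ: "P \<in> sets borel" "Q \<in> sets borel" "bounded P" "bounded Q" "P \<inter> Q = {}" "A = P \<union> Q" "Q \<subseteq> (\<Union>x\<in>I. ball x d)"
    using insert.prems by (auto simp: P_def Q_def intro: bounded_subset)
  have fm: "S \<in> fmeasurable lborel" if "S \<in> sets borel" "bounded S" for S :: "'a set"
    using emeasure_bounded_finite[OF that(2)] that by (auto simp: fmeasurable_def)
  obtain w where w: "\<And>i. 0 \<le> w i" "\<And>u. norm u = 1 \<Longrightarrow>
     \<bar>(\<Sum>i\<in>I. w i * max 0 (u \<bullet> i)) - (LINT v:Q|lborel. max 0 (u \<bullet> v))\<bar> \<le> d * measure lborel Q"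
    using insert.IH[OF PQ(2,4,7)] by auto
  have ms: "measure lborel A = measure lborel P + measure lborel Q"
  proof -
    have "Q - P = Q" using PQ(5) by blast
    then show ?thesis using measure_Un2[OF fm[OF PQ(1,3)] fm[OF PQ(2,4)]] PQ(6) by simp
  qed
  define w' where "w' = w(x := measure lborel P)"
  have "\<bar>(\<Sum>i\<in>insert x I. w' i * max 0 (u \<bullet> i)) - (LINT v:A|lborel. max 0 (u \<bullet> v))\<bar> \<le> d * measure lborel A"
    if u: "norm u = 1" for u
  proof -
    have s: "(\<Sum>i\<in>insert x I. w' i * max 0 (u \<bullet> i)) = measure lborel P * max 0 (u \<bullet> x) + (\<Sum>i\<in>I. w i * max 0 (u \<bullet> i))"
    proof -
      have "(\<Sum>i\<in>I. w' i * max 0 (u \<bullet> i)) = (\<Sum>i\<in>I. w i * max 0 (u \<bullet> i))"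
        using insert.hyps by (intro sum.cong) (auto simp: w'_def)
      then show ?thesis using insert.hyps by (simp add: w'_def)
    qed
    have i: "(LINT v:A|lborel. max 0 (u \<bullet> v)) = (LINT v:P|lborel. max 0 (u \<bullet> v)) + (LINT v:Q|lborel. max 0 (u \<bullet> v))"
      unfolding PQ(6) using PQ by (intro set_integral_Un set_integrable_bounded_pos_inner) auto
    have c: "set_integrable lborel P (\<lambda>v. a)" for a :: real
      using fm[of P] PQ unfolding set_integrable_def
      by (intro integrable_scaleR_left) (auto simp: fmeasurable_def)
    have ci: "(LINT v:P|lborel. a) = measure lborel P * a" for a :: real
      using fm[of P] PQ by (simp add: fmeasurable_def set_lebesgue_integral_def)
    have bd: "\<bar>max 0 (u \<bullet> x) - max 0 (u \<bullet> v)\<bar> \<le> d" if "v \<in> P" for v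
    proof -
      have "\<bar>u \<bullet> x - u \<bullet> v\<bar> \<le> norm u * norm (x - v)"
        using Cauchy_Schwarz_ineq2[of u "x - v"] by (simp add: inner_diff_right)
      also have "\<dots> \<le> d" using that u by (auto simp: P_def dist_norm)
      finally show ?thesis by (auto simp: max_def)
    qed
    have bi: "set_integrable lborel P (\<lambda>v. max 0 (u \<bullet> v))"
      using PQ by (intro set_integrable_bounded_pos_inner)
    have "(LINT v:P|lborel. max 0 (u \<bullet> x) - d) \<le> (LINT v:P|lborel. max 0 (u \<bullet> v))"
      using bd by (intro set_integral_mono c bi) (metis abs_le_D1 diff_le_eq add.commute)
    moreover have "(LINT v:P|lborel. max 0 (u \<bullet> v)) \<le> (LINT v:P|lborel. max 0 (u \<bullet> x) + d)"
      using bd by (intro set_integral_mono c bi) (metis abs_le_D2 minus_diff_eq diff_le_eq add.commute)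
    ultimately have "\<bar>measure lborel P * max 0 (u \<bullet> x) - (LINT v:P|lborel. max 0 (u \<bullet> v))\<bar> \<le> d * measure lborel P"
      unfolding ci by (auto simp: algebra_simps)
    then show ?thesis using w(2)[OF u] unfolding s i ms by (simp add: algebra_simps)
  qed
  then show ?case using w(1) by (intro exI[of _ w']) (auto simp: w'_def)
qed

text \<open>The number \<open>c\<close> is the integral of \<open>max 0 (u \<bullet> v)\<close> over
  the unit ball. It does not depend on the unit vector \<open>u\<close>, because Lebesgue measure is
  invariant under reflections. Hence the Riemann sums, which are support functions of zonotopes, are
  nearly constant on the sphere.\<close>

lemma zonotope_support_approx:
  obtains c :: real where "0 < c"
    "\<And>d. 0 < d \<Longrightarrow> \<exists>I w. finite (I::'a::euclidean_space set) \<and> (\<forall>i. 0 \<le> w i) \<and>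
      (\<forall>u. norm u = 1 \<longrightarrow> \<bar>(\<Sum>i\<in>I. w i * max 0 (u \<bullet> i)) - c\<bar> \<le> d)"
proof -
  let ?B = "cball (0::'a) 1"
  define h where "h u = (LINT v:?B|lborel. max 0 (u \<bullet> v))" for u :: 'a
  have rot: "h u = h u'" if uu': "norm u = norm u'" for u u'
  proof -
    obtain f where f: "linear f" "\<And>x. norm (f x) = norm x" "\<And>x. f (f x) = x" "f u = u'"
      using exists_involutive_isometry[OF uu'] by blast
    have [measurable]: "f \<in> borel_measurable borel"
      using f(1) by (intro borel_measurable_continuous_onI linear_continuous_on) (simp add: linear_conv_bounded_linear)
    have inn: "u \<bullet> f v = u' \<bullet> v" for v
    proof -
      have *: "2 * (x \<bullet> y) = (norm (x + y))\<^sup>2 - (norm x)\<^sup>2 - (norm y)\<^sup>2" for x y :: 'a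
        by (simp add: power2_norm_eq_inner inner_add_left inner_add_right inner_commute)
      have "norm (u + f v) = norm (u' + v)"
        using f(2)[of "u + f v"] f(1,3,4) by (simp add: linear_add)
      then show ?thesis using f(2)[of v] uu' *[of u "f v"] *[of u' v] by simp
    qed
    have "h u = (LINT v|distr lborel borel f. indicator ?B v *\<^sub>R max 0 (u \<bullet> v))"
      by (simp add: h_def set_lebesgue_integral_def lborel_distr_involutive_isometry[OF f(1-3)])
    also have "\<dots> = (LINT v|lborel. indicator ?B (f v) *\<^sub>R max 0 (u \<bullet> f v))"
      by (subst integral_distr) (auto intro!: borel_measurable_times borel_measurable_max borel_measurable_indicator borel_measurable_inner)
    also have "\<dots> = h u'" using f(2) unfolding h_def set_lebesgue_integral_def inn
      by (intro Bochner_Integration.integral_cong) (auto simp: indicator_def)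
    finally show ?thesis .
  qed
  obtain e :: 'a where e: "norm e = 1" using vector_choose_size[of 1] by auto
  have "h e > 0"
  proof -
    \<comment> \<open>On this ball \<open>e \<bullet> v\<close> is at least
      \<open>1/2 - 1/4\<close>, which bounds the integral away from 0.\<close>
    let ?D = "cball (e /\<^sub>R 2) (1/4)"
    have sub: "?D \<subseteq> ?B"
    proof
      fix v assume "v \<in> ?D"
      then have "norm (v - e /\<^sub>R 2) \<le> 1/4" by (simp add: dist_norm norm_minus_commute)
      moreover have "norm v \<le> norm (v - e /\<^sub>R 2) + norm (e /\<^sub>R 2)" by (metis diff_add_cancel norm_triangle_ineq)
      ultimately show "v \<in> ?B" using e by simp
    qed
    have "0 < measure lborel ?D * (1/4)"
      using content_cball[of "1/4" "e /\<^sub>R 2"] by simp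
    also have "\<dots> = (LINT v:?D|lborel. 1/4)"
      unfolding set_lebesgue_integral_def
      by (subst integral_scaleR_left) (auto intro!: integrable_real_indicator emeasure_lborel_cball_finite)
    also have "\<dots> \<le> (LINT v:?D|lborel. max 0 (e \<bullet> v))"
    proof (intro set_integral_mono set_integrable_bounded_pos_inner)
      show "set_integrable lborel ?D (\<lambda>v. 1/4 :: real)" unfolding set_integrable_def
        by (intro integrable_scaleR_left integrable_real_indicator emeasure_lborel_cball_finite) auto
      fix v assume "v \<in> ?D"
      then have "norm (e /\<^sub>R 2 - v) \<le> 1/4" by (simp add: dist_norm)
      then have "e \<bullet> (e /\<^sub>R 2 - v) \<le> 1/4" using Cauchy_Schwarz_ineq2[of e "e /\<^sub>R 2 - v"] e by simp
      moreover have "e \<bullet> e = 1" using e by (simp add: norm_eq_1)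
      ultimately show "1/4 \<le> max 0 (e \<bullet> v)" by (simp add: inner_diff_right)
    qed auto
    also have "\<dots> \<le> h e" unfolding h_def set_lebesgue_integral_def
      using set_integrable_bounded_pos_inner[of ?D e] set_integrable_bounded_pos_inner[of ?B e] sub
      by (intro integral_mono) (auto simp: set_integrable_def indicator_def)
    finally show ?thesis .
  qed
  moreover have "\<exists>I w. finite (I::'a set) \<and> (\<forall>i. 0 \<le> w i) \<and>
      (\<forall>u. norm u = 1 \<longrightarrow> \<bar>(\<Sum>i\<in>I. w i * max 0 (u \<bullet> i)) - h e\<bar> \<le> d)" if d: "0 < d" for d
  proof -
    define m where "m = measure lborel ?B"
    have m: "m > 0" using content_cball[of 1 "0::'a"] by (simp add: m_def)
    \<comment> \<open>The mesh \<open>d / m\<close> compensates the factor \<open>m\<close>, the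
      volume of the ball, in the error of the Riemann sum.\<close>
    have "d / m > 0" using d m by simp
    then obtain I where I: "finite I" "?B \<subseteq> (\<Union>x\<in>I. ball x (d / m))"
      using compact_eq_totally_bounded[of ?B] compact_cball[of "0::'a" 1] by metis
    obtain w where "\<forall>i. 0 \<le> w i" "\<forall>u. norm u = 1 \<longrightarrow>
     \<bar>(\<Sum>i\<in>I. w i * max 0 (u \<bullet> i)) - h u\<bar> \<le> d / m * measure lborel ?B"
      using zonotope_approx_integral[OF I(1) _ _ I(2)] unfolding h_def by auto
    moreover have "d / m * measure lborel ?B = d" using m by (simp add: m_def)
    moreover have "h u = h e" if "norm u = 1" for u using rot that e by metis
    ultimately show ?thesis using I(1) by (intro exI[of _ I] exI[of _ w]) (simp del: max.bounded_iff)
  qed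
  ultimately show ?thesis by (rule that)
qed

text \<open>Inclusions of convex bodies are inequalities between support functions. After division
  by \<open>c - d\<close> the support function of the zonotope lies between 1 and
  \<open>1 + \<eta>\<close> on the sphere. The outer inclusion tests a point in its own direction,
  the inner one separates a missing point from the zonotope.\<close>

lemma zonotope_approx_ball:
  assumes \<eta>: "0 < \<eta>"
  obtains I :: "'a::euclidean_space set" and v :: "'a \<Rightarrow> 'a" where "finite I"
    "cball 0 1 \<subseteq> (\<Sum>i\<in>I. closed_segment 0 (v i))" "(\<Sum>i\<in>I. closed_segment 0 (v i)) \<subseteq> cball 0 (1 + \<eta>)"
proof -
  obtain c :: real where c: "0 < c"
    "\<And>d. 0 < d \<Longrightarrow> \<exists>I w. finite (I::'a set) \<and> (\<forall>i. 0 \<le> w i) \<and>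
      (\<forall>u. norm u = 1 \<longrightarrow> \<bar>(\<Sum>i\<in>I. w i * max 0 (u \<bullet> i)) - c\<bar> \<le> d)"
    using zonotope_support_approx by blast
  \<comment> \<open>Solves \<open>(c + d) / (c - d) = 1 + \<eta>\<close>.\<close>
  define d where "d = c * \<eta> / (2 + \<eta>)"
  have d: "0 < d" "d < c" using c(1) \<eta> by (auto simp: d_def field_simps)
  have d2: "(c + d) / (c - d) = 1 + \<eta>"
  proof -
    have "d * (2 + \<eta>) = c * \<eta>" using \<eta> by (simp add: d_def)
    then have "c + d = (1 + \<eta>) * (c - d)" by (simp add: algebra_simps)
    then show ?thesis using d by (simp add: field_simps)
  qed
  obtain I w where I: "finite (I::'a set)" "\<And>i. 0 \<le> w i"
    "\<And>u. norm u = 1 \<Longrightarrow> \<bar>(\<Sum>i\<in>I. w i * max 0 (u \<bullet> i)) - c\<bar> \<le> d"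
    using c(2)[OF d(1)] by metis
  define v where "v i = (w i / (c - d)) *\<^sub>R i" for i
  define Z where "Z = (\<Sum>i\<in>I. closed_segment 0 (v i))"
  have Zalt: "Z = {sum s I |s. \<forall>i\<in>I. s i \<in> closed_segment 0 (v i)}"
    unfolding Z_def by (rule set_sum_alt[OF I(1)])
  have Zc: "compact_convex Z" unfolding Z_def by (intro compact_convex_sum compact_convex_segment)
  have vm: "max 0 (u \<bullet> v i) = w i * max 0 (u \<bullet> i) / (c - d)" for u i
    using I(2)[of i] d by (auto simp: v_def max_def divide_le_0_iff mult_le_0_iff zero_le_mult_iff zero_le_divide_iff)
  have h: "1 \<le> (\<Sum>i\<in>I. max 0 (u \<bullet> v i))" "(\<Sum>i\<in>I. max 0 (u \<bullet> v i)) \<le> 1 + \<eta>" if "norm u = 1" for u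
  proof -
    have "c - d \<le> (\<Sum>i\<in>I. w i * max 0 (u \<bullet> i))" "(\<Sum>i\<in>I. w i * max 0 (u \<bullet> i)) \<le> c + d"
      using I(3)[OF that] by auto
    then show "1 \<le> (\<Sum>i\<in>I. max 0 (u \<bullet> v i))" "(\<Sum>i\<in>I. max 0 (u \<bullet> v i)) \<le> 1 + \<eta>"
      unfolding vm sum_divide_distrib[symmetric] d2[symmetric] using d by (auto simp: divide_simps)
  qed
  have "Z \<subseteq> cball 0 (1 + \<eta>)"
  proof
    fix z assume "z \<in> Z"
    then obtain s where s: "z = sum s I" "\<And>i. i \<in> I \<Longrightarrow> s i \<in> closed_segment 0 (v i)" by (auto simp: Zalt)
    show "z \<in> cball 0 (1 + \<eta>)"
    proof (cases "z = 0")
      case False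
      define u where "u = z /\<^sub>R norm z"
      have u: "norm u = 1" using False by (simp add: u_def)
      have "norm z = u \<bullet> z" using False by (simp add: u_def dot_square_norm power2_eq_square)
      also have "\<dots> = (\<Sum>i\<in>I. u \<bullet> s i)" by (simp add: s inner_sum_right)
      also have "\<dots> \<le> (\<Sum>i\<in>I. max 0 (u \<bullet> v i))"
      proof (rule sum_mono)
        fix i assume "i \<in> I"
        then obtain t where t: "0 \<le> t" "t \<le> 1" "s i = t *\<^sub>R v i" using s(2) by (auto simp: closed_segment_def)
        show "u \<bullet> s i \<le> max 0 (u \<bullet> v i)"
          using t by (auto simp: max_def mult_le_0_iff mult_left_le_one_le)
      qed
      also have "\<dots> \<le> 1 + \<eta>" using h(2)[OF u] .
      finally show ?thesis by simp
    qed (use \<eta> in auto)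
  qed
  moreover have "cball 0 1 \<subseteq> Z"
  proof
    fix p :: 'a assume p: "p \<in> cball 0 1"
    show "p \<in> Z"
    proof (rule ccontr)
      assume "p \<notin> Z"
      then obtain a b where ab: "a \<bullet> p < b" "\<And>x. x \<in> Z \<Longrightarrow> a \<bullet> x > b"
        using separating_hyperplane_closed_point[of Z p] Zc by (auto simp: compact_convex_def compact_imp_closed)
      have a: "a \<noteq> 0" using ab Zc unfolding compact_convex_def by fastforce
      define u where "u = - a /\<^sub>R norm a"
      have u: "norm u = 1" using a by (simp add: u_def)
      \<comment> \<open>A point of the zonotope that is extreme in direction \<open>u\<close>: it
        takes the far end of exactly those segments that do not point away from \<open>u\<close>, so
        \<open>u \<bullet> z\<close> is the support function.\<close>
      define z where "z = (\<Sum>i\<in>I. if u \<bullet> v i \<ge> 0 then v i else 0)"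
      have "z \<in> Z" unfolding Zalt z_def by (intro CollectI exI[of _ "\<lambda>i. if u \<bullet> v i \<ge> 0 then v i else 0"]) auto
      have "u \<bullet> z = (\<Sum>i\<in>I. max 0 (u \<bullet> v i))"
        unfolding z_def inner_sum_right by (intro sum.cong) (auto simp: max_def)
      then have "1 \<le> u \<bullet> z" using h(1)[OF u] by simp
      moreover have "u \<bullet> p \<le> 1" using Cauchy_Schwarz_ineq2[of u p] u p by auto
      moreover have "u \<bullet> z < u \<bullet> p" using ab(1) ab(2)[OF \<open>z \<in> Z\<close>] a
        by (auto simp: u_def divide_simps)
      ultimately show False by simp
    qed
  qed
  ultimately show ?thesis using I(1) by (intro that[of I v]) (auto simp: Z_def)
qed

subsection \<open>Intrinsic volumes\<close>

lemma scaleR_set_plus: "(*\<^sub>R) r ` (A + B) = (*\<^sub>R) r ` A + (*\<^sub>R) r ` B" for A B :: "'a::real_vector set"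
  by (force simp: set_plus_def scaleR_add_right)

lemma scaleR_set_sum:
  fixes S :: "'i \<Rightarrow> 'a::real_vector set"
  assumes "finite I" shows "(*\<^sub>R) r ` (\<Sum>i\<in>I. S i) = (\<Sum>i\<in>I. (*\<^sub>R) r ` S i)"
  using assms by (induction I rule: finite_induct) (auto simp: scaleR_set_plus set_zero)

lemma scaleR_closed_segment: "(*\<^sub>R) r ` closed_segment 0 v = closed_segment 0 (r *\<^sub>R v)"
  using closed_segment_linear_image[of "(*\<^sub>R) r" 0 v] by (simp add: linear_scaleR)

lemma scaleR_cball_0:
  fixes s :: real
  assumes "0 < r" shows "(*\<^sub>R) r ` cball (0::'a::euclidean_space) s = cball 0 (r * s)"
proof (intro equalityI subsetI)
  fix x :: 'a assume "x \<in> cball 0 (r * s)"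
  then show "x \<in> (*\<^sub>R) r ` cball 0 s"
    using assms by (intro image_eqI[of _ _ "x /\<^sub>R r"]) (auto simp: field_simps)
qed (use assms in auto)

section \<open>Volumes of parallel bodies and the Steiner polynomial\<close>

lemma measure_scaleR_image:
  "measure lebesgue ((*\<^sub>R) m ` S) = \<bar>m\<bar> ^ DIM('a) * measure lebesgue S" for S :: "'a::euclidean_space set"
  using measure_lebesgue_affine[of m 0 S] by simp

lemma measure_mono_compact_convex:
  "compact_convex C \<Longrightarrow> compact_convex D \<Longrightarrow> C \<subseteq> D \<Longrightarrow> measure lebesgue C \<le> measure lebesgue D"
  by (intro measure_mono_fmeasurable) (auto simp: compact_convex_lmeasurable fmeasurableD)

text \<open>The homothety with centre \<open>c \<in> C\<close> and ratio \<open>1 + \<eta>\<close>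
  enlarges both the ball and the convex set \<open>C\<close>, so the image of
  \<open>C + cball 0 r\<close> contains the larger parallel body.\<close>

lemma measure_plus_cball_enlarge:
  fixes C :: "'a::euclidean_space set"
  assumes C: "compact_convex C" and "0 \<le> r" "0 \<le> \<eta>"
  shows "measure lebesgue (C + cball 0 (r * (1 + \<eta>))) \<le> (1 + \<eta>) ^ DIM('a) * measure lebesgue (C + cball 0 r)"
proof -
  obtain c where c: "c \<in> C" using C by (auto simp: compact_convex_def)
  let ?D = "(+) (- (\<eta> *\<^sub>R c)) ` ((*\<^sub>R) (1 + \<eta>) ` (C + cball 0 r))"
  have "C + cball 0 (r * (1 + \<eta>)) \<subseteq> ?D"
  proof
    fix x assume "x \<in> C + cball 0 (r * (1 + \<eta>))"
    then obtain y b where yb: "y \<in> C" "norm b \<le> r * (1 + \<eta>)" "x = y + b"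
      by (auto simp: set_plus_def)
    define y' where "y' = (1 / (1 + \<eta>)) *\<^sub>R y + (\<eta> / (1 + \<eta>)) *\<^sub>R c"
    have "1 / (1 + \<eta>) + \<eta> / (1 + \<eta>) = 1" using assms by (simp add: add_divide_distrib[symmetric])
    then have "y' \<in> C" unfolding y'_def using C assms yb c
      by (intro convexD) (auto simp: compact_convex_def)
    moreover have "(1 / (1 + \<eta>)) *\<^sub>R b \<in> cball 0 r" using yb assms by (simp add: divide_simps)
    ultimately have "y' + (1 / (1 + \<eta>)) *\<^sub>R b \<in> C + cball 0 r" by auto
    moreover have "x = - (\<eta> *\<^sub>R c) + (1 + \<eta>) *\<^sub>R (y' + (1 / (1 + \<eta>)) *\<^sub>R b)"
      using assms yb by (simp add: y'_def scaleR_add_right)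
    ultimately show "x \<in> ?D" by blast
  qed
  then have "measure lebesgue (C + cball 0 (r * (1 + \<eta>))) \<le> measure lebesgue ?D"
    using assms by (intro measure_mono_compact_convex compact_convex_plus compact_convex_translation
        compact_convex_scaleR compact_convex_cball) auto
  then show ?thesis using assms unfolding measure_translation measure_scaleR_image by simp
qed

text \<open>Lagrange interpolation at the nodes \<open>0, ..., d\<close>. What matters is that the
  weights \<open>L\<close> do not depend on \<open>p\<close>: coefficients then converge whenever
  the values at these finitely many nodes do.\<close>

lemma coeff_lagrange:
  "\<exists>L. \<forall>p :: real poly. degree p \<le> d \<longrightarrow> coeff p i = (\<Sum>j\<le>d. L j * poly p (real j))"
proof -
  define l :: "nat \<Rightarrow> real poly" where
    "l j = (\<Prod>m\<in>{..d} - {j}. smult (1 / (real j - real m)) [:- real m, 1:])" for j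
  have l: "poly (l j) (real m) = (if m = j then 1 else 0)" if "m \<le> d" for j m
    using that by (auto simp: l_def poly_prod diff_divide_distrib[symmetric] intro!: prod.neutral prod_zero)
  have deg: "degree (l j) \<le> d" if "j \<le> d" for j
  proof -
    have "degree (l j) \<le> (\<Sum>m\<in>{..d} - {j}. degree (smult (1 / (real j - real m)) [:- real m, 1:]))"
      unfolding l_def by (rule degree_prod_sum_le[unfolded o_def]) auto
    also have "\<dots> \<le> (\<Sum>m\<in>{..d} - {j}. 1)" by (intro sum_mono) (simp add: degree_smult_le[THEN order_trans])
    also have "\<dots> = d" using that by simp
    finally show ?thesis .
  qed
  have "coeff p i = (\<Sum>j\<le>d. coeff (l j) i * poly p (real j))" if p: "degree p \<le> d" for p :: "real poly"
  proof -
    have "p = (\<Sum>j\<le>d. smult (poly p (real j)) (l j))"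
    proof (rule poly_eqI_degree[where A = "real ` {..d}"])
      fix x assume "x \<in> real ` {..d}"
      then show "poly p x = poly (\<Sum>j\<le>d. smult (poly p (real j)) (l j)) x"
        by (auto simp: poly_sum l if_distrib[of "(*) _"] cong: if_cong)
    next
      have "degree (\<Sum>j\<le>d. smult (poly p (real j)) (l j)) \<le> d"
        using deg by (intro degree_sum_le) (auto intro: degree_smult_le[THEN order_trans])
      then show "degree (\<Sum>j\<le>d. smult (poly p (real j)) (l j)) < card (real ` {..d})"
        by (simp add: card_image)
      show "degree p < card (real ` {..d})" using p by (simp add: card_image)
    qed
    then have "coeff p i = coeff (\<Sum>j\<le>d. smult (poly p (real j)) (l j)) i" by simp
    then show ?thesis by (simp add: coeff_sum mult.commute)
  qed
  then show ?thesis by (intro exI[of _ "\<lambda>j. coeff (l j) i"]) simp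
qed

text \<open>With nonnegative coefficients every single monomial is at most the whole polynomial on
  the half-line, so a positive coefficient beyond \<open>d\<close> would break the growth
  bound.\<close>

lemma poly_degree_bound_growth:
  fixes p :: "real poly"
  assumes nn: "\<And>j. 0 \<le> coeff p j" and b: "\<And>r. 0 \<le> r \<Longrightarrow> poly p r \<le> K * (R + r) ^ d" and "0 \<le> R"
  shows "degree p \<le> d"
proof (rule degree_le, intro allI impI)
  fix j assume j: "d < j"
  show "coeff p j = 0"
  proof (rule ccontr)
    assume "coeff p j \<noteq> 0"
    then have pos: "coeff p j > 0" using nn[of j] by simp
    \<comment> \<open>\<open>r \<ge> R\<close> gives \<open>R + r \<le> 2 * r\<close>, whence the
      factor \<open>2 ^ d\<close>; the last entry makes \<open>coeff p j * r\<close> exceed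
      \<open>\<bar>K\<bar> * 2 ^ d\<close>.\<close>
    define r where "r = max (max 1 R) (\<bar>K\<bar> * 2 ^ d / coeff p j + 1)"
    have r: "1 \<le> r" "R \<le> r" "r > \<bar>K\<bar> * 2 ^ d / coeff p j" unfolding r_def by auto
    have "coeff p j * r ^ j \<le> poly p r"
    proof (cases "j \<le> degree p")
      case True
      then show ?thesis unfolding poly_altdef using nn r
        by (intro member_le_sum[of j "{..degree p}" "\<lambda>i. coeff p i * r ^ i"]) auto
    qed (use \<open>coeff p j \<noteq> 0\<close> in \<open>simp add: coeff_eq_0\<close>)
    also have "\<dots> \<le> K * (R + r) ^ d" using b r by simp
    also have "\<dots> \<le> \<bar>K\<bar> * (2 * r) ^ d"
      using r assms by (intro mult_mono power_mono) auto
    finally have 1: "coeff p j * r ^ j \<le> \<bar>K\<bar> * 2 ^ d * r ^ d" by (simp add: power_mult_distrib)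
    have "r ^ (d + 1) \<le> r ^ j" using r j by (intro power_increasing) auto
    then have "coeff p j * (r * r ^ d) \<le> coeff p j * r ^ j" using pos by simp
    with 1 have "(coeff p j * r) * r ^ d \<le> (\<bar>K\<bar> * 2 ^ d) * r ^ d" by (simp add: mult_ac)
    then have "coeff p j * r \<le> \<bar>K\<bar> * 2 ^ d" using r by (subst (asm) mult_le_cancel_right) auto
    moreover have "coeff p j * r > \<bar>K\<bar> * 2 ^ d" using r(3) pos by (simp add: field_simps)
    ultimately show False by simp
  qed
qed

text \<open>Better approximation of the ball takes more segments, so the a priori degrees of the
  zonotope polynomials need not stay bounded. Their coefficients are nonnegative and their values
  are bounded by the volume of a ball of radius \<open>R + r\<close>, which brings every degree down
  to \<open>DIM('a)\<close>. Only then does interpolation apply, and the limit coefficients inherit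
  sign and monotonicity.\<close>

lemma steiner_formula:
  obtains a :: "nat \<Rightarrow> 'a::euclidean_space set \<Rightarrow> real" where
    "\<And>C r. compact_convex C \<Longrightarrow> 0 \<le> r \<Longrightarrow> measure lebesgue (C + cball 0 r) = (\<Sum>j\<le>DIM('a). a j C * r ^ j)"
    "\<And>C j. compact_convex C \<Longrightarrow> 0 \<le> a j C"
    "\<And>C D j. compact_convex C \<Longrightarrow> compact_convex D \<Longrightarrow> C \<subseteq> D \<Longrightarrow> a j C \<le> a j D"
proof -
  let ?d = "DIM('a)"
  define \<eta> where "\<eta> n = 1 / (real n + 1)" for n
  have \<eta>: "0 < \<eta> n" "\<eta> n \<le> 1" for n by (auto simp: \<eta>_def)
  have "\<exists>Z. compact_convex Z \<and> cball 0 1 \<subseteq> Z \<and> Z \<subseteq> cball 0 (1 + \<eta> n) \<and>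
    (\<exists>p :: 'a set \<Rightarrow> real poly.
    (\<forall>C r. compact_convex C \<longrightarrow> 0 \<le> r \<longrightarrow> measure lebesgue (C + (*\<^sub>R) r ` Z) = poly (p C) r) \<and>
    (\<forall>C j. compact_convex C \<longrightarrow> 0 \<le> coeff (p C) j) \<and>
    (\<forall>C D j. compact_convex C \<longrightarrow> compact_convex D \<longrightarrow> C \<subseteq> D \<longrightarrow> coeff (p C) j \<le> coeff (p D) j))" for n
  proof -
    obtain I :: "'a set" and v :: "'a \<Rightarrow> 'a" where I: "finite I"
    "cball 0 1 \<subseteq> (\<Sum>i\<in>I. closed_segment 0 (v i))" "(\<Sum>i\<in>I. closed_segment 0 (v i)) \<subseteq> cball 0 (1 + \<eta> n)"
      using zonotope_approx_ball[OF \<eta>(1)] by blast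
    show ?thesis using segment_affine_zonotope_poly[OF I(1) segment_affine_measure, of v] I(2,3)
      by (intro exI[of _ "\<Sum>i\<in>I. closed_segment 0 (v i)"])
         (auto simp: scaleR_set_sum[OF I(1)] scaleR_closed_segment intro!: compact_convex_sum compact_convex_segment)
  qed
  then obtain Z p where Z: "\<And>n. compact_convex (Z n)" "\<And>n. cball 0 1 \<subseteq> Z n" "\<And>n. Z n \<subseteq> cball 0 (1 + \<eta> n)"
    and p: "\<And>n C r. compact_convex C \<Longrightarrow> 0 \<le> r \<Longrightarrow> measure lebesgue (C + (*\<^sub>R) r ` Z n) = poly (p n C) r"
      "\<And>n C j. compact_convex (C::'a set) \<Longrightarrow> 0 \<le> coeff (p n C :: real poly) j"
      "\<And>n C D j. compact_convex C \<Longrightarrow> compact_convex D \<Longrightarrow> C \<subseteq> D \<Longrightarrow> coeff (p n C) j \<le> coeff (p n D) j"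
    by metis
  have bnd: "measure lebesgue (C + cball 0 r) \<le> poly (p n C) r"
      "poly (p n C) r \<le> (1 + \<eta> n) ^ ?d * measure lebesgue (C + cball 0 r)"
    if C: "compact_convex C" and r: "0 \<le> r" for C r n
  proof -
    have cb: "(*\<^sub>R) r ` cball (0::'a) s = cball 0 (r * s)" if "s \<ge> 0" for s
      using r that by (cases "r = 0") (auto simp: scaleR_cball_0 image_constant_conv)
    have "cball 0 r \<subseteq> (*\<^sub>R) r ` Z n" using image_mono[OF Z(2), of "(*\<^sub>R) r" n] cb[of 1] by simp
    then show "measure lebesgue (C + cball 0 r) \<le> poly (p n C) r"
      unfolding p(1)[OF that, symmetric] using C r Z(1)
      by (intro measure_mono_compact_convex compact_convex_plus compact_convex_cball compact_convex_scaleR set_plus_mono2) auto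
    have "(*\<^sub>R) r ` Z n \<subseteq> cball 0 (r * (1 + \<eta> n))"
      using image_mono[OF Z(3), of "(*\<^sub>R) r" n] cb[of "1 + \<eta> n"] \<eta>[of n] by simp
    then have "poly (p n C) r \<le> measure lebesgue (C + cball 0 (r * (1 + \<eta> n)))"
      unfolding p(1)[OF that, symmetric] using C r Z(1) \<eta>(1)[of n]
      by (intro measure_mono_compact_convex compact_convex_plus compact_convex_cball compact_convex_scaleR set_plus_mono2) auto
    also have "\<dots> \<le> (1 + \<eta> n) ^ ?d * measure lebesgue (C + cball 0 r)"
      using measure_plus_cball_enlarge[OF C r, of "\<eta> n"] \<eta>(1)[of n] by simp
    finally show "poly (p n C) r \<le> (1 + \<eta> n) ^ ?d * measure lebesgue (C + cball 0 r)" .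
  qed
  have lim: "(\<lambda>n. poly (p n C) r) \<longlonglongrightarrow> measure lebesgue (C + cball 0 r)"
    if C: "compact_convex C" and r: "0 \<le> r" for C r
  proof (rule tendsto_sandwich[OF _ _ tendsto_const])
    have "\<eta> \<longlonglongrightarrow> 0" unfolding \<eta>_def
      using LIMSEQ_inverse_real_of_nat by (simp add: inverse_eq_divide add.commute)
    then have "(\<lambda>n. (1 + \<eta> n) ^ ?d * measure lebesgue (C + cball 0 r)) \<longlonglongrightarrow> (1 + 0) ^ ?d * measure lebesgue (C + cball 0 r)"
      by (intro tendsto_intros)
    then show "(\<lambda>n. (1 + \<eta> n) ^ ?d * measure lebesgue (C + cball 0 r)) \<longlonglongrightarrow> measure lebesgue (C + cball 0 r)"
      by simp
  qed (use bnd[OF that] in auto)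
  have deg: "degree (p n C) \<le> ?d" if C: "compact_convex C" for n C
  proof -
    obtain R0 where R0: "\<And>x. x \<in> C \<Longrightarrow> norm x \<le> R0" using C compact_imp_bounded[of C] unfolding compact_convex_def bounded_iff by metis
    define R where "R = \<bar>R0\<bar>"
    have R: "0 \<le> R" "\<And>x. x \<in> C \<Longrightarrow> norm x \<le> R" using R0 unfolding R_def by (auto intro: order_trans[OF _ abs_ge_self])
    show ?thesis
    proof (rule poly_degree_bound_growth[OF p(2)[OF C] _ R(1)])
      fix r :: real assume r: "0 \<le> r"
      have sub: "C + cball 0 r \<subseteq> cball 0 (R + r)"
      proof
        fix x assume "x \<in> C + cball 0 r"
        then obtain y b where "x = y + b" "y \<in> C" "norm b \<le> r" by (auto simp: set_plus_def)
        then show "x \<in> cball 0 (R + r)" using R(2)[of y] norm_triangle_ineq[of y b] by simp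
      qed
      have "poly (p n C) r \<le> (1 + \<eta> n) ^ ?d * measure lebesgue (C + cball 0 r)" using bnd(2)[OF C r] .
      also have "\<dots> \<le> 2 ^ ?d * measure lebesgue (cball (0::'a) (R + r))"
        using \<eta>[of n] sub C r R
        by (intro mult_mono power_mono measure_mono_compact_convex compact_convex_plus compact_convex_cball) auto
      also have "measure lebesgue (cball (0::'a) (R + r)) = unit_ball_vol (real ?d) * (R + r) ^ ?d"
        using content_cball[of "R + r" "0::'a"] R r by (simp add: measure_completion)
      finally show "poly (p n C) r \<le> (2 ^ ?d * unit_ball_vol (real ?d)) * (R + r) ^ ?d" by (simp add: mult_ac)
    qed
  qed
  have "\<exists>L. \<forall>i. \<forall>q :: real poly. degree q \<le> ?d \<longrightarrow> coeff q i = (\<Sum>j\<le>?d. L i j * poly q (real j))"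
    using coeff_lagrange[of ?d] by (intro choice allI) auto
  then obtain L where L: "\<And>i q. degree q \<le> ?d \<Longrightarrow> coeff q i = (\<Sum>j\<le>?d. L i j * poly q (real j))" by blast
  \<comment> \<open>The interpolation weights are applied to the true volumes of the parallel
    bodies, so \<open>a i C\<close> is the limit of the \<open>i\<close>-th coefficients.\<close>
  define a where "a i C = (\<Sum>j\<le>?d. L i j * measure lebesgue (C + cball 0 (real j)))" for i and C :: "'a set"
  have clim: "(\<lambda>n. coeff (p n C) i) \<longlonglongrightarrow> a i C" if C: "compact_convex C" for C i
    unfolding L[OF deg[OF C]] a_def by (intro tendsto_intros lim C) auto
  show ?thesis
  proof (rule that)
    fix C :: "'a set" and r :: real assume C: "compact_convex C" "0 \<le> r"
    have e: "poly (p n C) r = (\<Sum>j\<le>?d. coeff (p n C) j * r ^ j)" for n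
      using deg[OF C(1)] by (auto simp: poly_altdef intro!: sum.mono_neutral_left coeff_eq_0)
    have "(\<lambda>n. poly (p n C) r) \<longlonglongrightarrow> (\<Sum>j\<le>?d. a j C * r ^ j)"
      unfolding e by (intro tendsto_intros clim C)
    then show "measure lebesgue (C + cball 0 r) = (\<Sum>j\<le>?d. a j C * r ^ j)"
      using lim[OF C] LIMSEQ_unique by blast
  next
    fix C :: "'a set" and j assume "compact_convex C"
    then show "0 \<le> a j C" using p(2) by (intro LIMSEQ_le_const[OF clim]) auto
  next
    fix C D :: "'a set" and j assume "compact_convex C" "compact_convex D" "C \<subseteq> D"
    then show "a j C \<le> a j D" using p(3) by (intro LIMSEQ_le[OF clim clim]) auto
  qed
qed


section \<open>Existence, uniqueness and basic properties of intrinsic volumes\<close>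

lemma unit_ball_vol_of_nat_neq_0: "unit_ball_vol (real n) \<noteq> 0"
  by (metis less_irrefl of_nat_0_le_iff unit_ball_vol_pos)

lemma measure_lborel_plus_cball:
  assumes "compact_convex C" "0 \<le> r"
  shows "measure lborel {x + y | x y. x \<in> C \<and> y \<in> cball 0 r} = measure lebesgue (C + cball 0 r)"
proof -
  have "compact_convex (C + cball 0 r)" using assms by (intro compact_convex_plus compact_convex_cball)
  then have "C + cball 0 r \<in> sets lborel" by (auto simp: compact_convex_def intro: borel_compact)
  moreover have "{x + y | x y. x \<in> C \<and> y \<in> cball 0 r} = C + cball 0 r" unfolding set_plus_def by blast
  ultimately show ?thesis by (simp add: measure_completion)
qed

lemma sum_power_reflect:
  fixes f :: "nat \<Rightarrow> real"
  shows "(\<Sum>j\<le>d. f (d - j) * r ^ (d - j)) = (\<Sum>j\<le>d. f j * r ^ j)"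
  by (rule sum.reindex_bij_witness[of _ "\<lambda>j. d - j" "\<lambda>j. d - j"]) auto

text \<open>Two polynomials that agree on a half-line have equal coefficients, and the unit ball
  volumes that multiply the unknowns are nonzero; so the definite description has at most one
  solution.\<close>

lemma intrinsic_volumes_eqI:
  fixes C :: "'a::euclidean_space set"
  assumes C: "compact_convex C" and W: "\<And>r. 0 \<le> r \<Longrightarrow> measure lebesgue (C + cball 0 r) =
      (\<Sum>j\<le>DIM('a). unit_ball_vol (real (DIM('a) - j)) * W j * r ^ (DIM('a) - j))"
    and z: "\<And>j. j > DIM('a) \<Longrightarrow> W j = 0"
  shows "intrinsic_volumes C = W"
  unfolding intrinsic_volumes_def
proof (rule the_equality)
  show "(\<forall>r\<ge>0. measure lborel {x + y | x y. x \<in> C \<and> y \<in> cball 0 r} =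
        (\<Sum>j\<le>DIM('a). unit_ball_vol (real (DIM('a) - j)) * W j * r ^ (DIM('a) - j))) \<and>
     (\<forall>j>DIM('a). W j = 0)"
    using W z measure_lborel_plus_cball[OF C] by simp
next
  let ?d = "DIM('a)"
  fix V :: "nat \<Rightarrow> real"
  assume V: "(\<forall>r\<ge>0. measure lborel {x + y | x y. x \<in> C \<and> y \<in> cball 0 r} =
        (\<Sum>j\<le>?d. unit_ball_vol (real (?d - j)) * V j * r ^ (?d - j))) \<and> (\<forall>j>?d. V j = 0)"
  show "V = W"
  proof
    fix j
    show "V j = W j"
    proof (cases "j \<le> ?d")
      case True
      define pol where "pol U = (\<Sum>i\<le>?d. monom (unit_ball_vol (real (?d - i)) * U i) (?d - i))" for U :: "nat \<Rightarrow> real"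
      have ev: "poly (pol U) r = (\<Sum>i\<le>?d. unit_ball_vol (real (?d - i)) * U i * r ^ (?d - i))" for U r
        by (simp add: pol_def poly_sum poly_monom)
      have co: "coeff (pol U) (?d - j) = unit_ball_vol (real (?d - j)) * U j" for U
      proof -
        have "coeff (pol U) (?d - j) = (\<Sum>i\<le>?d. if i = j then unit_ball_vol (real (?d - i)) * U i else 0)"
          unfolding pol_def coeff_sum using True by (intro sum.cong) auto
        then show ?thesis using True by simp
      qed
      have "pol V = pol W"
      proof (rule ccontr)
        assume "pol V \<noteq> pol W"
        then have "finite {x. poly (pol V - pol W) x = 0}" by (intro poly_roots_finite) simp
        moreover have "{0..} \<subseteq> {x. poly (pol V - pol W) x = 0}"
          using V W measure_lborel_plus_cball[OF C] by (auto simp: ev)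
        ultimately show False using infinite_Ici finite_subset by blast
      qed
      then have "unit_ball_vol (real (?d - j)) * V j = unit_ball_vol (real (?d - j)) * W j"
        using co[of V] co[of W] by metis
      then show ?thesis using unit_ball_vol_of_nat_neq_0 mult_left_cancel by blast
    qed (use V z in auto)
  qed
qed

text \<open>The four facts are stated jointly because all are read off from one family of
  coefficients \<open>a\<close>, which exists only inside the proof. The \<open>j\<close>-th
  intrinsic volume belongs to the power \<open>DIM('a) - j\<close>.\<close>

lemma intrinsic_volumes_steiner_mono:
  "(\<forall>C r. compact_convex (C::'a::euclidean_space set) \<longrightarrow> 0 \<le> r \<longrightarrow> measure lebesgue (C + cball 0 r) =
      (\<Sum>j\<le>DIM('a). unit_ball_vol (real (DIM('a) - j)) * intrinsic_volumes C j * r ^ (DIM('a) - j))) \<and>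
   (\<forall>C j. compact_convex (C::'a set) \<longrightarrow> 0 \<le> intrinsic_volumes C j) \<and>
   (\<forall>C j. compact_convex (C::'a set) \<longrightarrow> DIM('a) < j \<longrightarrow> intrinsic_volumes C j = 0) \<and>
   (\<forall>C D j. compact_convex C \<longrightarrow> compact_convex D \<longrightarrow> (C::'a set) \<subseteq> D \<longrightarrow> intrinsic_volumes C j \<le> intrinsic_volumes D j)"
proof -
  let ?d = "DIM('a)"
  obtain a :: "nat \<Rightarrow> 'a set \<Rightarrow> real" where a:
    "\<And>C r. compact_convex C \<Longrightarrow> 0 \<le> r \<Longrightarrow> measure lebesgue (C + cball 0 r) = (\<Sum>j\<le>DIM('a). a j C * r ^ j)"
    "\<And>C j. compact_convex C \<Longrightarrow> 0 \<le> a j C"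
    "\<And>C D j. compact_convex C \<Longrightarrow> compact_convex D \<Longrightarrow> C \<subseteq> D \<Longrightarrow> a j C \<le> a j D"
    using steiner_formula by blast
  define W where "W C j = (if j \<le> ?d then a (?d - j) C / unit_ball_vol (real (?d - j)) else 0)" for C j
  have st: "measure lebesgue (C + cball 0 r) = (\<Sum>j\<le>?d. unit_ball_vol (real (?d - j)) * W C j * r ^ (?d - j))"
    if "compact_convex C" "0 \<le> r" for C r
  proof -
    show ?thesis unfolding a(1)[OF that] sum_power_reflect[symmetric]
      by (intro sum.cong) (auto simp: W_def unit_ball_vol_of_nat_neq_0 simp del: of_nat_diff)
  qed
  have "intrinsic_volumes C = W C" if "compact_convex C" for C
    by (rule intrinsic_volumes_eqI[OF that st[OF that]]) (auto simp: W_def)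
  then show ?thesis using st a(2,3) by (auto simp: W_def divide_right_mono)
qed

lemmas intrinsic_volumes_steiner = intrinsic_volumes_steiner_mono[THEN conjunct1, rule_format]
lemmas intrinsic_volumes_nonneg = intrinsic_volumes_steiner_mono[THEN conjunct2, THEN conjunct1, rule_format]
lemmas intrinsic_volumes_eq_0 = intrinsic_volumes_steiner_mono[THEN conjunct2, THEN conjunct2, THEN conjunct1, rule_format]
lemmas intrinsic_volumes_mono = intrinsic_volumes_steiner_mono[THEN conjunct2, THEN conjunct2, THEN conjunct2, rule_format]

lemma intrinsic_volumes_translation:
  fixes C :: "'a::euclidean_space set"
  assumes C: "compact_convex C"
  shows "intrinsic_volumes ((+) c ` C) = intrinsic_volumes C"
proof (rule intrinsic_volumes_eqI)
  fix r :: real assume r: "0 \<le> r"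
  have "(+) c ` C + cball 0 r = (+) c ` (C + cball 0 r)"
    by (force simp: set_plus_def add.assoc)
  then show "measure lebesgue ((+) c ` C + cball 0 r) =
      (\<Sum>j\<le>DIM('a). unit_ball_vol (real (DIM('a) - j)) * intrinsic_volumes C j * r ^ (DIM('a) - j))"
    by (simp only: measure_translation intrinsic_volumes_steiner[OF C r])
qed (use C in \<open>auto simp: intrinsic_volumes_eq_0 intro: compact_convex_translation\<close>)

lemma intrinsic_volumes_scaleR:
  fixes C :: "'a::euclidean_space set"
  assumes C: "compact_convex C" and s: "0 < s"
  shows "intrinsic_volumes ((*\<^sub>R) s ` C) j = s ^ j * intrinsic_volumes C j"
proof -
  let ?d = "DIM('a)"
  have "intrinsic_volumes ((*\<^sub>R) s ` C) = (\<lambda>j. s ^ j * intrinsic_volumes C j)"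
  proof (rule intrinsic_volumes_eqI)
    fix r :: real assume r: "0 \<le> r"
    have "(*\<^sub>R) s ` C + cball 0 r = (*\<^sub>R) s ` (C + cball 0 (r / s))"
      using scaleR_cball_0[where 'a='a, OF s, of "r / s"] s by (simp add: scaleR_set_plus)
    then have "measure lebesgue ((*\<^sub>R) s ` C + cball 0 r) = s ^ ?d * measure lebesgue (C + cball 0 (r / s))"
      using s by (simp only: measure_scaleR_image abs_of_pos)
    also have "\<dots> = (\<Sum>j\<le>?d. s ^ ?d * (unit_ball_vol (real (?d - j)) * intrinsic_volumes C j * (r / s) ^ (?d - j)))"
      using r s by (simp add: intrinsic_volumes_steiner[OF C] sum_distrib_left)
    also have "\<dots> = (\<Sum>j\<le>?d. unit_ball_vol (real (?d - j)) * (s ^ j * intrinsic_volumes C j) * r ^ (?d - j))"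
    proof (rule sum.cong[OF refl])
      fix j assume "j \<in> {..?d}"
      then have "s ^ ?d = s ^ j * s ^ (?d - j)" by (simp add: power_add[symmetric])
      then show "s ^ ?d * (unit_ball_vol (real (?d - j)) * intrinsic_volumes C j * (r / s) ^ (?d - j))
        = unit_ball_vol (real (?d - j)) * (s ^ j * intrinsic_volumes C j) * r ^ (?d - j)"
        using s by (simp add: power_divide)
    qed
    finally show "measure lebesgue ((*\<^sub>R) s ` C + cball 0 r) =
      (\<Sum>j\<le>?d. unit_ball_vol (real (?d - j)) * (s ^ j * intrinsic_volumes C j) * r ^ (?d - j))" .
  qed (use C in \<open>auto simp: intrinsic_volumes_eq_0 intro: compact_convex_scaleR\<close>)
  then show ?thesis by simp
qed

section \<open>Strict positivity of intrinsic volumes\<close>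

lemma sum_orthonormal_inner:
  assumes "finite B" "pairwise orthogonal B" "\<And>b. b \<in> B \<Longrightarrow> norm b = 1" "c \<in> B"
  shows "(\<Sum>b\<in>B. f b *\<^sub>R b) \<bullet> c = f c"
proof -
  have "(\<Sum>b\<in>B. f b *\<^sub>R b) \<bullet> c = (\<Sum>b\<in>B. if b = c then f c else 0)"
    unfolding inner_sum_left using assms
    by (intro sum.cong) (auto simp: norm_eq_1 pairwise_def orthogonal_def)
  then show ?thesis using assms by simp
qed

text \<open>The upper bound removes all coefficients beyond \<open>k\<close>. If the
  \<open>k\<close>-th one vanished as well, the rest would be of order \<open>N ^ (k - 1)\<close> at
  most, against the lower bound.\<close>

lemma poly_nonneg_growth_coeff_pos:
  fixes a :: "nat \<Rightarrow> real"
  assumes nn: "\<And>j. 0 \<le> a j" and "0 < c" and k: "k \<le> d"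
    and low: "\<And>N::nat. 0 < N \<Longrightarrow> c * real N ^ k \<le> (\<Sum>j\<le>d. a j * real N ^ j)"
    and up: "\<And>N::nat. 0 < N \<Longrightarrow> (\<Sum>j\<le>d. a j * real N ^ j) \<le> K * real N ^ k"
  shows "0 < a k"
proof (rule ccontr)
  assume "\<not> 0 < a k"
  then have ak: "a k = 0" using nn[of k] by simp
  have big: "a j = 0" if "k < j" "j \<le> d" for j
  proof (rule ccontr)
    assume "a j \<noteq> 0"
    then have pos: "a j > 0" using nn[of j] by simp
    obtain N :: nat where N: "real N > max 1 (K / a j)" using reals_Archimedean2 by blast
    then have N1: "real N > 1" "K < a j * real N" using pos by (auto simp: field_simps)
    have "a j * real N ^ j \<le> (\<Sum>j\<le>d. a j * real N ^ j)"
      using nn that by (intro member_le_sum) auto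
    also have "\<dots> \<le> K * real N ^ k" using up[of N] N1 by simp
    also have "\<dots> < a j * real N * real N ^ k" using N1 by (intro mult_strict_right_mono) auto
    also have "\<dots> = a j * real N ^ Suc k" by simp
    also have "\<dots> \<le> a j * real N ^ j" using that N1 pos by (intro mult_left_mono power_increasing) auto
    finally show False by simp
  qed
  define S where "S = (\<Sum>j\<le>d. a j)"
  have S: "0 \<le> S" unfolding S_def using nn by (intro sum_nonneg) auto
  obtain N :: nat where N: "real N > max 1 (S / c)" using reals_Archimedean2 by blast
  then have N1: "real N > 1" "S < c * real N" using \<open>0 < c\<close> by (auto simp: field_simps)
  have "real N * (\<Sum>j\<le>d. a j * real N ^ j) = (\<Sum>j\<le>d. a j * real N ^ Suc j)"
    by (simp add: sum_distrib_left mult_ac)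
  also have "\<dots> \<le> (\<Sum>j\<le>d. a j * real N ^ k)"
  proof (rule sum_mono)
    fix j assume j: "j \<in> {..d}"
    show "a j * real N ^ Suc j \<le> a j * real N ^ k"
    proof (cases "j < k")
      case True
      then show ?thesis using nn[of j] N1 by (intro mult_left_mono power_increasing) auto
    next
      case False
      then have "a j = 0" using ak big[of j] j by (cases "j = k") auto
      then show ?thesis by simp
    qed
  qed
  also have "\<dots> = S * real N ^ k" by (simp add: S_def sum_distrib_right)
  also have "\<dots> < c * real N * real N ^ k" using N1 by (intro mult_strict_right_mono) auto
  also have "\<dots> = real N * (c * real N ^ k)" by simp
  also have "\<dots> \<le> real N * (\<Sum>j\<le>d. a j * real N ^ j)" using low[of N] N1 by (intro mult_left_mono) auto
  finally show False by simp
qed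

lemma measure_Union_balls_le:
  fixes P :: "'a::euclidean_space set"
  assumes "finite P" "0 \<le> s"
  shows "measure lebesgue (\<Union>p\<in>P. cball p s) \<le> real (card P) * measure lebesgue (cball (0::'a) s)"
proof -
  have "measure lebesgue (\<Union>p\<in>P. cball p s) \<le> (\<Sum>p\<in>P. measure lebesgue (cball p s))"
    using assms by (intro measure_UNION_le) auto
  also have "\<dots> = (\<Sum>p\<in>P. measure lebesgue (cball (0::'a) s))"
    using assms by (intro sum.cong) (auto simp: content_cball measure_completion)
  finally show ?thesis by simp
qed

lemma measure_Union_balls_ge:
  fixes P :: "'a::euclidean_space set"
  assumes "finite P" "0 \<le> s" "\<And>p q. p \<in> P \<Longrightarrow> q \<in> P \<Longrightarrow> p \<noteq> q \<Longrightarrow> 2 * s \<le> dist p q"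
  shows "real (card P) * measure lebesgue (ball (0::'a) s) \<le> measure lebesgue (\<Union>p\<in>P. ball p s)"
proof -
  have "disjoint_family_on (\<lambda>p. ball p s) P"
    unfolding disjoint_family_on_def
  proof (intro ballI impI)
    fix p q assume pq: "p \<in> P" "q \<in> P" "p \<noteq> q"
    show "ball p s \<inter> ball q s = {}" using assms(3)[OF pq] by (auto intro!: disjoint_ballI)
  qed
  then have "measure lebesgue (\<Union>p\<in>P. ball p s) = (\<Sum>p\<in>P. measure lebesgue (ball p s))"
    using assms emeasure_lborel_ball_finite by (intro measure_finite_Union) (auto simp: less_top)
  also have "\<dots> = (\<Sum>p\<in>P. measure lebesgue (ball (0::'a) s))"
    using assms by (intro sum.cong) (auto simp: content_ball measure_completion)
  finally show ?thesis by simp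
qed

text \<open>The \<open>k\<close>-dimensional cube blown up by \<open>N\<close> contains about \<open>N ^ k\<close> points at
  mutual distance at least \<open>1\<close>, and is covered by as many balls of fixed size. So the volume of its
  unit neighbourhood grows exactly like \<open>N ^ k\<close>, which forces the \<open>k\<close>-th coefficient of the Steiner
  polynomial to be positive.\<close>

lemma intrinsic_volumes_cube_pos:
  fixes B :: "'a::euclidean_space set"
  assumes B: "finite B" "pairwise orthogonal B" "\<And>b. b \<in> B \<Longrightarrow> norm b = 1"
  shows "0 < intrinsic_volumes (\<Sum>b\<in>B. closed_segment 0 b) (card B)"
proof -
  let ?d = "DIM('a)" and ?k = "card B"
  define Q where "Q = (\<Sum>b\<in>B. closed_segment 0 b)"
  have cQ: "compact_convex Q" unfolding Q_def by (intro compact_convex_sum compact_convex_segment)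
  have NQ: "(*\<^sub>R) r ` Q = {\<Sum>b\<in>B. f b *\<^sub>R b | f. \<forall>b\<in>B. 0 \<le> f b \<and> f b \<le> r}" (is "?L = ?R") if r: "0 \<le> r" for r
  proof -
    have 1: "?L = {sum s B |s. \<forall>b\<in>B. s b \<in> closed_segment 0 (r *\<^sub>R b)}"
      unfolding Q_def scaleR_set_sum[OF B(1)] scaleR_closed_segment by (rule set_sum_alt[OF B(1)])
    have 2: "y \<in> closed_segment 0 (r *\<^sub>R b) \<longleftrightarrow> (\<exists>t. 0 \<le> t \<and> t \<le> r \<and> y = t *\<^sub>R b)" for y b :: 'a
      using set_plus_segment_iff[OF r, of y "{0}" b] by (simp add: set_zero)
    show ?thesis
    proof (intro equalityI subsetI)
      fix x assume "x \<in> ?L"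
      then obtain s where s: "x = sum s B" "\<forall>b\<in>B. \<exists>t. 0 \<le> t \<and> t \<le> r \<and> s b = t *\<^sub>R b" unfolding 1 2 by blast
      then obtain f where f: "\<forall>b\<in>B. 0 \<le> f b \<and> f b \<le> r \<and> s b = f b *\<^sub>R b" by metis
      then have "x = (\<Sum>b\<in>B. f b *\<^sub>R b)" using s by simp
      then show "x \<in> ?R" using f by blast
    next
      fix x assume "x \<in> ?R"
      then obtain f where "x = (\<Sum>b\<in>B. f b *\<^sub>R b)" "\<forall>b\<in>B. 0 \<le> f b \<and> f b \<le> r" by blast
      then show "x \<in> ?L" unfolding 1 2 by (intro CollectI exI[of _ "\<lambda>b. f b *\<^sub>R b"]) auto
    qed
  qed
  have k: "?k \<le> ?d"
  proof -
    have "0 \<notin> B" using B(3) by force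
    then have "independent B" using B(2) pairwise_orthogonal_independent by blast
    then show ?thesis using independent_card_le by blast
  qed
  define e where "e f = (\<Sum>b\<in>B. real (f b) *\<^sub>R b)" for f :: "'a \<Rightarrow> nat"
  define P where "P N = e ` (PiE B (\<lambda>_. {..<N}))" for N
  have sep: "1 \<le> dist (e f) (e g)" if fg: "f \<in> PiE B (\<lambda>_. {..<N})" "g \<in> PiE B (\<lambda>_. {..<N})" and neq: "f \<noteq> g" for f g N
  proof -
    obtain b where b: "b \<in> B" "f b \<noteq> g b" using PiE_ext[OF fg] neq by blast
    have "1 \<le> \<bar>real (f b) - real (g b)\<bar>" using b(2) by linarith
    also have "real (f b) - real (g b) = (e f - e g) \<bullet> b"
      unfolding inner_diff_left e_def using sum_orthonormal_inner[OF B(1,2,3) b(1)] by simp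
    also have "\<bar>\<dots>\<bar> \<le> norm (e f - e g) * norm b" by (rule Cauchy_Schwarz_ineq2)
    finally show ?thesis using B(3)[OF b(1)] by (simp add: dist_norm)
  qed
  have inj: "inj_on e (PiE B (\<lambda>_. {..<N}))" for N
  proof (rule inj_onI, rule ccontr)
    fix f g assume "f \<in> PiE B (\<lambda>_. {..<N})" "g \<in> PiE B (\<lambda>_. {..<N})" "e f = e g" "f \<noteq> g"
    then show False using sep[of f N g] by simp
  qed
  have P: "finite (P N)" "card (P N) = N ^ ?k" for N
    using B(1) inj[of N] by (auto simp: P_def finite_PiE card_image card_PiE)
  have st: "measure lebesgue ((*\<^sub>R) (real N) ` Q + cball 0 1) =
      (\<Sum>j\<le>?d. (unit_ball_vol (real (?d - j)) * intrinsic_volumes Q j) * real N ^ j)" if "0 < N" for N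
    using that by (simp add: intrinsic_volumes_steiner[OF compact_convex_scaleR[OF cQ]]
        intrinsic_volumes_scaleR[OF cQ] mult_ac)
  have cNQ: "compact_convex ((*\<^sub>R) (real N) ` Q + cball 0 1)" for N
    by (intro compact_convex_plus compact_convex_scaleR cQ compact_convex_cball) simp
  let ?c = "measure lebesgue (ball (0::'a) (1/2))"
  \<comment> \<open>The radius allows for a rounding error of at most 1 in each of the
    \<open>card B\<close> coordinates and for the unit ball that was added.\<close>
  let ?K = "measure lebesgue (cball (0::'a) (1 + real ?k))"
  have low: "?c * real N ^ ?k \<le> measure lebesgue ((*\<^sub>R) (real N) ` Q + cball 0 1)" if "0 < N" for N
  proof -
    have "?c * real N ^ ?k = real (card (P N)) * ?c" by (simp add: P)
    also have "\<dots> \<le> measure lebesgue (\<Union>p\<in>P N. ball p (1/2))"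
    proof (intro measure_Union_balls_ge P)
      fix p q assume "p \<in> P N" "q \<in> P N" "p \<noteq> q"
      then obtain f g where "f \<in> PiE B (\<lambda>_. {..<N})" "g \<in> PiE B (\<lambda>_. {..<N})" "p = e f" "q = e g" "f \<noteq> g"
        unfolding P_def by blast
      then show "2 * (1 / 2) \<le> dist p q" using sep[of f N g] by simp
    qed simp
    also have "\<dots> \<le> measure lebesgue ((*\<^sub>R) (real N) ` Q + cball 0 1)"
    proof (rule measure_mono_fmeasurable)
      have "P N \<subseteq> (*\<^sub>R) (real N) ` Q"
      proof
        fix x assume "x \<in> P N"
        then obtain f where f: "f \<in> PiE B (\<lambda>_. {..<N})" "x = e f" by (auto simp: P_def)
        then show "x \<in> (*\<^sub>R) (real N) ` Q" unfolding NQ[OF of_nat_0_le_iff] e_def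
          by (intro CollectI exI[of _ "\<lambda>b. real (f b)"]) (auto dest: PiE_mem simp: less_imp_le)
      qed
      moreover have "ball p (1/2) \<subseteq> {p} + cball 0 1" for p :: 'a
      proof
        fix x assume "x \<in> ball p (1/2)"
        then have "x - p \<in> cball 0 1" by (simp add: dist_norm norm_minus_commute)
        then have "p + (x - p) \<in> {p} + cball 0 1" by blast
        then show "x \<in> {p} + cball 0 1" by simp
      qed
      ultimately have "ball p (1/2) \<subseteq> (*\<^sub>R) (real N) ` Q + cball 0 1" if "p \<in> P N" for p
        using set_plus_mono2[of "{p}" "(*\<^sub>R) (real N) ` Q" "cball 0 1" "cball 0 1"] that by blast
      then show "(\<Union>p\<in>P N. ball p (1/2)) \<subseteq> (*\<^sub>R) (real N) ` Q + cball 0 1" by blast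
    qed (use cNQ P in \<open>auto simp: compact_convex_lmeasurable\<close>)
    finally show ?thesis .
  qed
  have up: "measure lebesgue ((*\<^sub>R) (real N) ` Q + cball 0 1) \<le> ?K * real N ^ ?k" if N: "0 < N" for N
  proof -
    have "(*\<^sub>R) (real N) ` Q + cball 0 1 \<subseteq> (\<Union>p\<in>P N. cball p (1 + real ?k))"
    proof
      fix x assume "x \<in> (*\<^sub>R) (real N) ` Q + cball 0 1"
      then obtain f z where f: "x = (\<Sum>b\<in>B. f b *\<^sub>R b) + z" "\<forall>b\<in>B. 0 \<le> f b \<and> f b \<le> real N" "norm z \<le> 1"
        unfolding NQ[OF of_nat_0_le_iff] by (auto simp: set_plus_def)
      \<comment> \<open>Rounding down to the grid. The cap at \<open>N - 1\<close> takes care of the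
        coordinate value \<open>N\<close>, whose floor is outside the grid, and keeps the error at
        most 1.\<close>
      define g where "g = restrict (\<lambda>b. min (N - 1) (nat \<lfloor>f b\<rfloor>)) B"
      have g: "g \<in> PiE B (\<lambda>_. {..<N})" using N by (auto simp: g_def)
      have d: "\<bar>f b - real (g b)\<bar> \<le> 1" if "b \<in> B" for b
      proof -
        have fb: "0 \<le> f b" "f b \<le> real N" using f(2) that by auto
        have "real (nat \<lfloor>f b\<rfloor>) \<le> f b" "f b \<le> real (nat \<lfloor>f b\<rfloor>) + 1" using fb by (auto simp: of_nat_nat)
        moreover have "g b = min (N - 1) (nat \<lfloor>f b\<rfloor>)" using that by (simp add: g_def)
        ultimately obtain m where "real m \<le> f b" "f b \<le> real m + 1" "g b = min (N - 1) m" by blast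
        moreover have "real (N - 1) = real N - 1" using N by simp
        moreover have "real (N - 1) \<le> real m" if "N - 1 \<le> m" using that by (rule of_nat_mono)
        ultimately show ?thesis using fb by (cases "N - 1 \<le> m") (simp_all add: min_def abs_le_iff)
      qed
      have "x - e g = (\<Sum>b\<in>B. (f b - real (g b)) *\<^sub>R b) + z"
        by (simp add: f(1) e_def sum_subtractf scaleR_diff_left)
      then have "norm (x - e g) \<le> norm (\<Sum>b\<in>B. (f b - real (g b)) *\<^sub>R b) + norm z"
        by (simp only: norm_triangle_ineq)
      also have "\<dots> \<le> real ?k + 1"
        using d B(3) by (intro add_mono f(3) order_trans[OF norm_sum] sum_bounded_above[where K=1, simplified]) auto
      finally show "x \<in> (\<Union>p\<in>P N. cball p (1 + real ?k))"
        using g by (auto simp: P_def dist_norm norm_minus_commute add.commute intro!: bexI[of _ g])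
    qed
    then have "measure lebesgue ((*\<^sub>R) (real N) ` Q + cball 0 1) \<le> measure lebesgue (\<Union>p\<in>P N. cball p (1 + real ?k))"
      using cNQ P by (intro measure_mono_fmeasurable) (auto simp: compact_convex_lmeasurable fmeasurableD intro!: fmeasurable.finite_UN)
    also have "\<dots> \<le> real (card (P N)) * ?K" by (intro measure_Union_balls_le P) simp
    finally show ?thesis by (simp add: P mult.commute)
  qed
  have "0 < unit_ball_vol (real (?d - ?k)) * intrinsic_volumes Q ?k"
  proof (rule poly_nonneg_growth_coeff_pos[OF _ _ k])
    show "0 < ?c" using content_ball[of "1/2" "0::'a"] by (simp add: measure_completion)
    show "0 \<le> unit_ball_vol (real (?d - j)) * intrinsic_volumes Q j" for j
      using intrinsic_volumes_nonneg[OF cQ] by simp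
  qed (use low up st in auto)
  then show ?thesis using intrinsic_volumes_nonneg[OF cQ, of ?k]
    by (metis Q_def less_eq_real_def mult_zero_right less_irrefl)
qed

text \<open>A set that contains a ball of \<open>T\<close> contains a small
  \<open>k\<close>-dimensional cube, spanned by \<open>k\<close> vectors of an orthonormal basis of
  \<open>T\<close>; monotonicity does the rest.\<close>

lemma intrinsic_volumes_pos:
  fixes T E :: "'a::euclidean_space set"
  assumes T: "subspace T" "k \<le> dim T" and E: "compact_convex E" and \<rho>: "0 < \<rho>" "T \<inter> cball 0 \<rho> \<subseteq> E"
  shows "0 < intrinsic_volumes E k"
proof -
  obtain B0 where B0: "B0 \<subseteq> T" "pairwise orthogonal B0" "\<And>x. x \<in> B0 \<Longrightarrow> norm x = 1" "independent B0" "card B0 = dim T"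
    using orthonormal_basis_subspace[OF T(1)] by metis
  then obtain B where B: "B \<subseteq> B0" "card B = k" "finite B"
    using T(2) obtain_subset_with_card_n[of k B0] by metis
  define Q where "Q = (\<Sum>b\<in>B. closed_segment 0 b)"
  have Q: "compact_convex Q" unfolding Q_def by (intro compact_convex_sum compact_convex_segment)
  have QT: "Q \<subseteq> T \<inter> cball 0 (real k)"
  proof
    fix x assume "x \<in> Q"
    then obtain s where s: "x = sum s B" "\<And>b. b \<in> B \<Longrightarrow> s b \<in> closed_segment 0 b"
      unfolding Q_def set_sum_alt[OF B(3)] by auto
    have sb: "s b \<in> T \<and> norm (s b) \<le> 1" if b: "b \<in> B" for b
    proof -
      obtain t where "0 \<le> t" "t \<le> 1" "s b = t *\<^sub>R b" using s(2)[OF b] by (auto simp: closed_segment_def)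
      then show ?thesis using B0 B b T by (auto intro!: subspace_scale)
    qed
    have "norm x \<le> real k" unfolding s(1) B(2)[symmetric]
      using sb by (intro order_trans[OF norm_sum] sum_bounded_above[where K=1, simplified]) auto
    moreover have "x \<in> T" unfolding s(1) using sb T by (intro subspace_sum) auto
    ultimately show "x \<in> T \<inter> cball 0 (real k)" by simp
  qed
  \<comment> \<open>The unit cube lies in the ball of radius \<open>k\<close>; adding 1 keeps the
    quotient meaningful for \<open>k = 0\<close>.\<close>
  define r where "r = \<rho> / (real k + 1)"
  have r: "0 < r" "r * real k \<le> \<rho>" using \<rho> by (auto simp: r_def field_simps)
  have "(*\<^sub>R) r ` Q \<subseteq> E"
  proof
    fix x assume "x \<in> (*\<^sub>R) r ` Q"
    then obtain y where y: "y \<in> Q" "x = r *\<^sub>R y" by auto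
    have "norm x \<le> r * real k" using y QT r by auto
    then have "x \<in> cball 0 \<rho>" using r by simp
    moreover have "x \<in> T" using y QT T by (auto intro!: subspace_scale[of T])
    ultimately show "x \<in> E" using \<rho>(2) by blast
  qed
  then have "intrinsic_volumes ((*\<^sub>R) r ` Q) k \<le> intrinsic_volumes E k"
    by (intro intrinsic_volumes_mono compact_convex_scaleR Q E)
  moreover have "0 < intrinsic_volumes ((*\<^sub>R) r ` Q) k"
  proof -
    have "pairwise orthogonal B" using B0(2) B(1) by (rule pairwise_subset)
    then have "0 < intrinsic_volumes Q k"
      using intrinsic_volumes_cube_pos[OF B(3), folded Q_def] B B0(3) by blast
    then show ?thesis using r by (simp add: intrinsic_volumes_scaleR[OF Q])
  qed
  ultimately show ?thesis by simp
qed

subsection \<open>Radial functions and second-order calculus\<close>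

text \<open>A difference rather than the quotient of the Minkowski gauge: passing from one body to
  another changes it exactly by the difference of the radial functions, so Taylor expansion in space
  and derivative in time simply add up.\<close>

definition radial_gap :: "'a::euclidean_space set \<Rightarrow> 'a \<Rightarrow> real" where
  "radial_gap K x = norm x - radial_function K (sgn x)"

text \<open>Compactness makes the supremum in \<open>radial_function\<close> a maximum, and
  convexity with \<open>0 \<in> K\<close> fills the ray below it.\<close>

lemma mem_iff_radial_gap:
  fixes K :: "'a::euclidean_space set"
  assumes K: "compact K" "convex K" "0 \<in> K" and x: "x \<noteq> 0"
  shows "x \<in> K \<longleftrightarrow> radial_gap K x \<le> 0"
proof -
  define S where "S = {r. 0 \<le> r \<and> r *\<^sub>R sgn x \<in> K}"
  have "S = {0..} \<inter> (\<lambda>r. r *\<^sub>R sgn x) -` K" by (auto simp: S_def)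
  moreover have "closed ({0..} \<inter> (\<lambda>r. r *\<^sub>R sgn x) -` K)"
    by (intro closed_Int closed_vimage K(1)[THEN compact_imp_closed] continuous_intros closed_atLeast)
  ultimately have cl: "closed S" by simp
  obtain R where R: "\<And>y. y \<in> K \<Longrightarrow> norm y \<le> R" using compact_imp_bounded[OF K(1)] unfolding bounded_iff by blast
  have bd: "bdd_above S"
  proof (rule bdd_aboveI)
    fix r assume "r \<in> S"
    then show "r \<le> R" using R[of "r *\<^sub>R sgn x"] x by (auto simp: S_def norm_sgn)
  qed
  have ne: "S \<noteq> {}" using K(3) by (auto simp: S_def intro!: exI[of _ 0])
  have sup: "Sup S \<in> S" using closed_contains_Sup[OF ne bd cl] .
  have xs: "x = norm x *\<^sub>R sgn x" by (simp add: sgn_div_norm x)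
  have "x \<in> K \<longleftrightarrow> norm x \<le> Sup S"
  proof
    assume "x \<in> K"
    then have "norm x \<in> S" using xs by (simp add: S_def)
    then show "norm x \<le> Sup S" using bd by (rule cSup_upper)
  next
    assume le: "norm x \<le> Sup S"
    have pos: "0 < Sup S" using le x by (metis less_le_trans zero_less_norm_iff)
    have "(norm x / Sup S) *\<^sub>R (Sup S *\<^sub>R sgn x) + (1 - norm x / Sup S) *\<^sub>R 0 \<in> K"
      using sup le pos K by (intro convexD) (auto simp: S_def field_simps)
    then show "x \<in> K" using pos xs by simp
  qed
  then show ?thesis by (simp add: radial_gap_def radial_function_def S_def)
qed

lemma radial_gap_scaleR: "0 < r \<Longrightarrow> radial_gap K (r *\<^sub>R x) = r * norm x - radial_function K (sgn x)"
  by (simp add: radial_gap_def sgn_scaleR)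

text \<open>A negative gap persists nearby by continuity. Conversely an interior point can be pushed
  outwards along its ray and stay in \<open>K\<close>, and this raises the gap by
  \<open>s * norm x\<close> while the direction is unchanged.\<close>

lemma frontier_iff_radial_gap:
  fixes K :: "'a::euclidean_space set"
  assumes K: "compact K" "convex K" "0 \<in> interior K" and x: "x \<noteq> 0"
    and cont: "isCont (radial_gap K) x"
  shows "x \<in> interior K \<longleftrightarrow> radial_gap K x < 0" "x \<in> frontier K \<longleftrightarrow> radial_gap K x = 0"
proof -
  have mem: "y \<in> K \<longleftrightarrow> radial_gap K y \<le> 0" if "y \<noteq> 0" for y
    using mem_iff_radial_gap[OF K(1,2) _ that] K(3) interior_subset by blast
  show 1: "x \<in> interior K \<longleftrightarrow> radial_gap K x < 0"
  proof
    assume neg: "radial_gap K x < 0"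
    have "\<forall>\<^sub>F y in at x. radial_gap K y < 0" using cont neg unfolding isCont_def by (rule order_tendstoD)
    then have "\<forall>\<^sub>F y in nhds x. radial_gap K y < 0" using neg by (simp add: eventually_nhds_conv_at)
    moreover have "\<forall>\<^sub>F y in nhds x. y \<noteq> 0" using x by (intro t1_space_nhds)
    ultimately have "\<forall>\<^sub>F y in nhds x. y \<in> K" by eventually_elim (auto simp: mem)
    then show "x \<in> interior K" by (auto simp: eventually_nhds interior_def)
  next
    assume "x \<in> interior K"
    then have "\<forall>\<^sub>F y in nhds x. y \<in> K" using interior_subset[of K] by (auto simp: eventually_nhds intro!: exI[of _ "interior K"])
    moreover have "filterlim (\<lambda>s::real. (1 + s) *\<^sub>R x) (nhds x) (at_right 0)"
      by (rule tendsto_eq_intros refl | simp)+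
    ultimately have "\<forall>\<^sub>F s::real in at_right 0. (1 + s) *\<^sub>R x \<in> K" by (rule eventually_compose_filterlim)
    then obtain s :: real where s: "0 < s" "(1 + s) *\<^sub>R x \<in> K"
      by (auto simp: eventually_at_right[of 0 1]) (metis dense)
    then have "radial_gap K ((1 + s) *\<^sub>R x) \<le> 0" using mem x by simp
    then have "(1 + s) * norm x \<le> radial_function K (sgn x)" using s by (subst (asm) radial_gap_scaleR) auto
    moreover have "s * norm x > 0" using s x by simp
    ultimately show "radial_gap K x < 0" by (simp add: radial_gap_def algebra_simps)
  qed
  have "frontier K = K - interior K" using K(1) by (simp add: frontier_def compact_imp_closed)
  then show "x \<in> frontier K \<longleftrightarrow> radial_gap K x = 0" using 1 mem[OF x] by (metis Diff_iff less_eq_real_def less_irrefl)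
qed

lemma norm_has_gradient:
  fixes x :: "'a::real_inner"
  assumes "x \<noteq> 0" shows "(norm has_derivative (\<lambda>v. sgn x \<bullet> v)) (at x)"
  using has_derivative_norm[OF assms] by (simp only: inner_commute[of "sgn x"])

lemma has_derivative_sgn:
  fixes x :: "'a::real_inner"
  assumes "x \<noteq> 0"
  shows "(sgn has_derivative (\<lambda>v. (v - (sgn x \<bullet> v) *\<^sub>R sgn x) /\<^sub>R norm x)) (at x)"
proof -
  have "((\<lambda>y. inverse (norm y)) has_derivative (\<lambda>v. - (inverse (norm x) * (sgn x \<bullet> v) * inverse (norm x)))) (at x)"
    using Deriv.has_derivative_inverse[OF _ norm_has_gradient[OF assms]] assms by simp
  from has_derivative_scaleR[OF this has_derivative_ident]
  have a: "((\<lambda>y. inverse (norm y) *\<^sub>R y) has_derivative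
    (\<lambda>v. inverse (norm x) *\<^sub>R v + (- (inverse (norm x) * (sgn x \<bullet> v) * inverse (norm x))) *\<^sub>R x)) (at x)" .
  have b: "(\<lambda>v. inverse (norm x) *\<^sub>R v + (- (inverse (norm x) * (sgn x \<bullet> v) * inverse (norm x))) *\<^sub>R x)
     = (\<lambda>v. (v - (sgn x \<bullet> v) *\<^sub>R sgn x) /\<^sub>R norm x)"
    by (auto simp: sgn_div_norm algebra_simps)
  have c: "(\<lambda>y. inverse (norm y) *\<^sub>R y) = sgn" by (auto simp: sgn_div_norm)
  show ?thesis using a unfolding b c .
qed

text \<open>Second-order calculus for a function with gradient \<open>G\<close> near \<open>x\<^sub>0\<close> that is only assumed to be
  differentiable at the point \<open>x\<^sub>0\<close> itself.\<close>

lemma gradient_increment_bound: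
  fixes G :: "'a::euclidean_space \<Rightarrow> 'a"
  assumes H: "(G has_derivative H) (at x0)" and "0 < \<eta>"
  shows "\<exists>d>0. \<forall>w. norm w < d \<longrightarrow> norm (G (x0 + w) - G x0 - H w) \<le> \<eta> * norm w"
proof -
  obtain d where "d > 0" and d: "\<forall>y. norm (y - x0) < d \<longrightarrow> norm (G y - G x0 - H (y - x0)) \<le> \<eta> * norm (y - x0)"
    using H \<open>0 < \<eta>\<close> unfolding has_derivative_at_alt by blast
  have "norm (G (x0 + w) - G x0 - H w) \<le> \<eta> * norm w" if "norm w < d" for w
    using d[rule_format, of "x0 + w"] that by simp
  then show ?thesis using \<open>d > 0\<close> by blast
qed

text \<open>Subtracting the linear and the quadratic term along the segment leaves a function
  \<open>\<phi>\<close> of one variable whose derivative is the first-order error of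
  \<open>G\<close>, paired with \<open>w\<close>. The mean value theorem then gives a remainder of
  Peano type.\<close>

lemma second_order_taylor:
  fixes f :: "'a::euclidean_space \<Rightarrow> real"
  assumes G: "\<And>x. x \<in> ball x0 e \<Longrightarrow> (f has_derivative (\<lambda>v. G x \<bullet> v)) (at x)" and "0 < e"
    and H: "(G has_derivative H) (at x0)" and \<eta>: "0 < \<eta>"
  shows "\<exists>d>0. \<forall>w. norm w < d \<longrightarrow> \<bar>f (x0 + w) - f x0 - G x0 \<bullet> w - (H w \<bullet> w) / 2\<bar> \<le> \<eta> * (norm w)\<^sup>2"
proof -
  have lin: "H (s *\<^sub>R w) = s *\<^sub>R H w" for s w using H by (simp add: has_derivative_linear linear_scale)
  obtain d where d: "d > 0" "\<And>w. norm w < d \<Longrightarrow> norm (G (x0 + w) - G x0 - H w) \<le> \<eta> * norm w"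
    using gradient_increment_bound[OF H \<eta>] by auto
  have "\<bar>f (x0 + w) - f x0 - G x0 \<bullet> w - (H w \<bullet> w) / 2\<bar> \<le> \<eta> * (norm w)\<^sup>2" if w: "norm w < min d e" for w
  proof -
    define \<phi> where "\<phi> s = f (x0 + s *\<^sub>R w) - s * (G x0 \<bullet> w) - s\<^sup>2 / 2 * (H w \<bullet> w)" for s
    have nb: "norm (s *\<^sub>R w) \<le> norm w" if "0 \<le> s" "s \<le> 1" for s using that by (simp add: mult_left_le_one_le)
    have der: "(\<phi> has_real_derivative (G (x0 + s *\<^sub>R w) \<bullet> w - G x0 \<bullet> w - s * (H w \<bullet> w))) (at s)"
      if s: "0 \<le> s" "s \<le> 1" for s
    proof -
      have "x0 + s *\<^sub>R w \<in> ball x0 e" using nb[OF s] w by (simp add: dist_norm)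
      then have "(f has_derivative (\<lambda>v. G (x0 + s *\<^sub>R w) \<bullet> v)) (at (x0 + s *\<^sub>R w))" by (rule G)
      moreover have "((\<lambda>s. x0 + s *\<^sub>R w) has_derivative (\<lambda>t. t *\<^sub>R w)) (at s)"
        by (auto intro!: derivative_eq_intros)
      ultimately have "((\<lambda>s. f (x0 + s *\<^sub>R w)) has_derivative (\<lambda>t. G (x0 + s *\<^sub>R w) \<bullet> (t *\<^sub>R w))) (at s)"
        by (rule has_derivative_compose[rotated])
      moreover have "(\<lambda>t. G (x0 + s *\<^sub>R w) \<bullet> (t *\<^sub>R w)) = (*) (G (x0 + s *\<^sub>R w) \<bullet> w)" by auto
      ultimately have "((\<lambda>s. f (x0 + s *\<^sub>R w)) has_real_derivative G (x0 + s *\<^sub>R w) \<bullet> w) (at s)"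
        by (simp only: has_field_derivative_def)
      then show ?thesis unfolding \<phi>_def by (auto intro!: derivative_eq_intros)
    qed
    obtain s where s: "0 < s" "s < 1" "\<phi> 1 - \<phi> 0 = (1 - 0) * (G (x0 + s *\<^sub>R w) \<bullet> w - G x0 \<bullet> w - s * (H w \<bullet> w))"
      using MVT2[of 0 1 \<phi>, OF _ der] by auto
    have "f (x0 + w) - f x0 - G x0 \<bullet> w - (H w \<bullet> w) / 2 = \<phi> 1 - \<phi> 0" by (simp add: \<phi>_def)
    also have "\<dots> = (G (x0 + s *\<^sub>R w) - G x0 - H (s *\<^sub>R w)) \<bullet> w" using s(3) by (simp add: inner_diff_left lin)
    also have "\<bar>\<dots>\<bar> \<le> norm (G (x0 + s *\<^sub>R w) - G x0 - H (s *\<^sub>R w)) * norm w" by (rule Cauchy_Schwarz_ineq2)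
    also have "\<dots> \<le> (\<eta> * norm (s *\<^sub>R w)) * norm w"
      using nb[of s] s w by (intro mult_right_mono d(2)) auto
    also have "\<dots> \<le> (\<eta> * norm w) * norm w" using nb[of s] s \<eta> by (intro mult_right_mono mult_left_mono) auto
    finally show ?thesis by (simp add: power2_eq_square)
  qed
  then show ?thesis using d(1) \<open>0 < e\<close> by (intro exI[of _ "min d e"]) auto
qed

text \<open>Young's form of the theorem on mixed derivatives: the second difference
  \<open>D s v w\<close> is symmetric in \<open>v\<close> and \<open>w\<close> and equals
  \<open>s\<^sup>2 * (H v \<bullet> w)\<close> up to an error of smaller order, by the mean value
  theorem in direction \<open>w\<close>.\<close>

lemma second_derivative_symmetric:
  fixes f :: "'a::euclidean_space \<Rightarrow> real"
  assumes G: "\<And>x. x \<in> ball x0 e \<Longrightarrow> (f has_derivative (\<lambda>v. G x \<bullet> v)) (at x)" and e: "0 < e"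
    and H: "(G has_derivative H) (at x0)"
  shows "H v \<bullet> w = H w \<bullet> v"
proof -
  have lin: "H (s *\<^sub>R w) = s *\<^sub>R H w" "H (v + w) = H v + H w" for s v w
    using H by (simp_all add: has_derivative_linear linear_scale linear_add)
  define D where "D s v w = f (x0 + s *\<^sub>R v + s *\<^sub>R w) - f (x0 + s *\<^sub>R v) - f (x0 + s *\<^sub>R w) + f x0" for s :: real and v w
  have key: "\<exists>d>0. \<forall>s. 0 < s \<and> s < d \<longrightarrow> \<bar>D s v w - s\<^sup>2 * (H v \<bullet> w)\<bar> \<le> \<eta> * s\<^sup>2" if \<eta>: "0 < \<eta>" for \<eta> v w
  proof -
    define M where "M = norm v + norm w + 1"
    have M: "M \<ge> 1" by (simp add: M_def)
    \<comment> \<open>Two error terms of \<open>G\<close>, at arguments of norm at most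
      \<open>s * M\<close>, are paired with a vector of norm at most \<open>M\<close>; together they
      cost \<open>2 * \<eta>' * M\<^sup>2 * s\<^sup>2\<close>.\<close>
    define \<eta>' where "\<eta>' = \<eta> / (2 * M\<^sup>2)"
    have \<eta>': "0 < \<eta>'" using \<eta> M by (simp add: \<eta>'_def)
    obtain d where d: "d > 0" "\<And>w. norm w < d \<Longrightarrow> norm (G (x0 + w) - G x0 - H w) \<le> \<eta>' * norm w"
      using gradient_increment_bound[OF H \<eta>'] by auto
    have "\<bar>D s v w - s\<^sup>2 * (H v \<bullet> w)\<bar> \<le> \<eta> * s\<^sup>2" if s: "0 < s" "s < min d e / M" for s
    proof -
      have sM: "s * M < min d e" using s M by (simp add: field_simps)
      have n1: "norm (s *\<^sub>R (v + t *\<^sub>R w)) \<le> s * M" "norm (s *\<^sub>R (t *\<^sub>R w)) \<le> s * M" if "0 \<le> t" "t \<le> 1" for t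
      proof -
        have "norm (v + t *\<^sub>R w) \<le> norm v + norm (t *\<^sub>R w)" by (rule norm_triangle_ineq)
        moreover have "norm (t *\<^sub>R w) \<le> norm w" using that by (simp add: mult_left_le_one_le)
        ultimately have "norm (v + t *\<^sub>R w) \<le> M" "norm (t *\<^sub>R w) \<le> M" by (auto simp: M_def intro: order_trans)
        then show "norm (s *\<^sub>R (v + t *\<^sub>R w)) \<le> s * M" "norm (s *\<^sub>R (t *\<^sub>R w)) \<le> s * M" using s by (simp_all only: norm_scaleR abs_of_pos mult_left_mono less_imp_le)
      qed
      define \<phi> where "\<phi> t = f (x0 + s *\<^sub>R (v + t *\<^sub>R w)) - f (x0 + s *\<^sub>R (t *\<^sub>R w))" for t
      have der: "(\<phi> has_real_derivative (s * ((G (x0 + s *\<^sub>R (v + t *\<^sub>R w)) - G (x0 + s *\<^sub>R (t *\<^sub>R w))) \<bullet> w))) (at t)"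
        if t: "0 \<le> t" "t \<le> 1" for t
      proof -
        have *: "((\<lambda>t. f (x0 + s *\<^sub>R (z + t *\<^sub>R w))) has_real_derivative s * (G (x0 + s *\<^sub>R (z + t *\<^sub>R w)) \<bullet> w)) (at t)"
          if z: "norm (s *\<^sub>R (z + t *\<^sub>R w)) \<le> s * M" for z
        proof -
          have "x0 + s *\<^sub>R (z + t *\<^sub>R w) \<in> ball x0 e" using z sM by (simp add: dist_norm)
          then have "(f has_derivative (\<lambda>v. G (x0 + s *\<^sub>R (z + t *\<^sub>R w)) \<bullet> v)) (at (x0 + s *\<^sub>R (z + t *\<^sub>R w)))" by (rule G)
          moreover have "((\<lambda>t. x0 + s *\<^sub>R (z + t *\<^sub>R w)) has_derivative (\<lambda>r. s *\<^sub>R (r *\<^sub>R w))) (at t)"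
            by (auto intro!: derivative_eq_intros)
          ultimately have "((\<lambda>t. f (x0 + s *\<^sub>R (z + t *\<^sub>R w))) has_derivative
              (\<lambda>r. G (x0 + s *\<^sub>R (z + t *\<^sub>R w)) \<bullet> (s *\<^sub>R (r *\<^sub>R w)))) (at t)"
            by (rule has_derivative_compose[rotated])
          moreover have "(\<lambda>r. G (x0 + s *\<^sub>R (z + t *\<^sub>R w)) \<bullet> (s *\<^sub>R (r *\<^sub>R w))) = (*) (s * (G (x0 + s *\<^sub>R (z + t *\<^sub>R w)) \<bullet> w))"
            by (auto simp: mult_ac)
          ultimately show ?thesis by (simp add: has_field_derivative_def)
        qed
        show ?thesis unfolding \<phi>_def
          using DERIV_diff[OF *[of v] *[of 0]] n1[OF t] by (simp add: inner_diff_left right_diff_distrib)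
      qed
      obtain t where t: "0 < t" "t < 1"
        "\<phi> 1 - \<phi> 0 = (1 - 0) * (s * ((G (x0 + s *\<^sub>R (v + t *\<^sub>R w)) - G (x0 + s *\<^sub>R (t *\<^sub>R w))) \<bullet> w))"
        using MVT2[of 0 1 \<phi>, OF _ der] by auto
      let ?a = "s *\<^sub>R (v + t *\<^sub>R w)" and ?b = "s *\<^sub>R (t *\<^sub>R w)"
      let ?A = "G (x0 + ?a) - G x0 - H ?a" and ?B = "G (x0 + ?b) - G x0 - H ?b"
      have "D s v w = \<phi> 1 - \<phi> 0" by (simp add: D_def \<phi>_def scaleR_add_right add.assoc)
      moreover have "H ?a - H ?b = s *\<^sub>R H v" by (simp add: lin algebra_simps)
      ultimately have "D s v w - s\<^sup>2 * (H v \<bullet> w) = s * ((G (x0 + ?a) - G (x0 + ?b)) \<bullet> w - (H ?a - H ?b) \<bullet> w)"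
        using t(3) by (simp add: power2_eq_square algebra_simps)
      also have "\<dots> = s * ((?A - ?B) \<bullet> w)" by (simp add: inner_diff_left)
      also have "\<bar>\<dots>\<bar> \<le> s * (norm (?A - ?B) * norm w)"
        using s Cauchy_Schwarz_ineq2[of "?A - ?B" w] by (simp add: abs_mult)
      also have "\<dots> \<le> s * ((2 * (\<eta>' * (s * M))) * M)"
      proof -
        have "norm ?A \<le> \<eta>' * norm ?a" "norm ?B \<le> \<eta>' * norm ?b"
          using n1[of t] t sM by (auto intro!: d(2) simp del: norm_scaleR)
        moreover have "\<eta>' * norm ?a \<le> \<eta>' * (s * M)" "\<eta>' * norm ?b \<le> \<eta>' * (s * M)"
          using n1[of t] t \<eta>' by (auto intro!: mult_left_mono simp del: norm_scaleR)
        ultimately have "norm (?A - ?B) \<le> 2 * (\<eta>' * (s * M))"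
          using norm_triangle_ineq4[of ?A ?B] by linarith
        moreover have "norm w \<le> M" by (simp add: M_def)
        moreover have "0 \<le> 2 * (\<eta>' * (s * M))" using s \<eta>' M by simp
        ultimately show ?thesis using s by (intro mult_left_mono mult_mono) auto
      qed
      also have "\<dots> = \<eta> * s\<^sup>2" using M by (simp add: \<eta>'_def power2_eq_square)
      finally show ?thesis .
    qed
    then show ?thesis using d(1) e M by (intro exI[of _ "min d e / M"]) auto
  qed
  have sym: "D s v w = D s w v" for s by (simp add: D_def add_ac)
  have small: "\<bar>H v \<bullet> w - H w \<bullet> v\<bar> \<le> 0 + \<eta>" if \<eta>: "0 < \<eta>" for \<eta>
  proof -
    have "0 < \<eta> / 2" using \<eta> by simp
    obtain d1 where d1: "d1 > 0" "\<And>s. 0 < s \<and> s < d1 \<Longrightarrow> \<bar>D s v w - s\<^sup>2 * (H v \<bullet> w)\<bar> \<le> \<eta> / 2 * s\<^sup>2"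
      using key[OF \<open>0 < \<eta> / 2\<close>, of v w] by blast
    obtain d2 where d2: "d2 > 0" "\<And>s. 0 < s \<and> s < d2 \<Longrightarrow> \<bar>D s w v - s\<^sup>2 * (H w \<bullet> v)\<bar> \<le> \<eta> / 2 * s\<^sup>2"
      using key[OF \<open>0 < \<eta> / 2\<close>, of w v] by blast
    define s where "s = min d1 d2 / 2"
    have s: "0 < s \<and> s < d1" "0 < s \<and> s < d2" using d1(1) d2(1) by (auto simp: s_def min_def)
    have "\<bar>s\<^sup>2 * (H v \<bullet> w) - s\<^sup>2 * (H w \<bullet> v)\<bar> \<le> \<eta> * s\<^sup>2"
    proof -
      have "\<eta> / 2 * s\<^sup>2 + \<eta> / 2 * s\<^sup>2 = \<eta> * s\<^sup>2" by simp
      then show ?thesis using d1(2)[OF s(1)] d2(2)[OF s(2)] sym[of s] by linarith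
    qed
    then have "s\<^sup>2 * \<bar>H v \<bullet> w - H w \<bullet> v\<bar> \<le> s\<^sup>2 * \<eta>"
      unfolding right_diff_distrib[symmetric] abs_mult by (simp add: mult.commute)
    moreover have "0 < s\<^sup>2" using s(1) by (simp add: zero_less_power2)
    ultimately show ?thesis by (simp only: mult_le_cancel_left_pos add_0)
  qed
  have "\<bar>H v \<bullet> w - H w \<bullet> v\<bar> \<le> 0" using small by (rule field_le_epsilon)
  then show ?thesis by simp
qed

section \<open>Supporting normals and degenerate determinants\<close>

lemma has_derivative_neg_direction:
  fixes f :: "'a::euclidean_space \<Rightarrow> real"
  assumes "(f has_derivative (\<lambda>v. g \<bullet> v)) (at x)" "g \<bullet> w < 0"
  shows "\<forall>\<^sub>F s in at_right 0. f (x + s *\<^sub>R w) < f x"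
proof -
  have "((\<lambda>s. x + s *\<^sub>R w) has_derivative (\<lambda>t. t *\<^sub>R w)) (at 0)"
    by (auto intro!: derivative_eq_intros)
  then have "((\<lambda>s. f (x + s *\<^sub>R w)) has_derivative (\<lambda>t. g \<bullet> (t *\<^sub>R w))) (at 0)"
    by (rule has_derivative_compose) (simp add: assms(1))
  moreover have "(\<lambda>t. g \<bullet> (t *\<^sub>R w)) = (*) (g \<bullet> w)" by auto
  ultimately have "((\<lambda>s. f (x + s *\<^sub>R w)) has_real_derivative (g \<bullet> w)) (at 0)"
    by (simp only: has_field_derivative_def)
  then obtain d where "d > 0" "\<And>h. 0 < h \<Longrightarrow> h < d \<Longrightarrow> f (x + (0 + h) *\<^sub>R w) < f (x + 0 *\<^sub>R w)"
    using DERIV_neg_dec_right[OF _ assms(2)] by metis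
  then show ?thesis by (auto simp: eventually_at_right[of 0 1])
qed

text \<open>If \<open>g\<close> did not support \<open>K\<close> at \<open>x\<close>, then
  \<open>f\<close> would increase along a segment that stays in \<open>K\<close>. Conversely a
  supporting vector \<open>u\<close> is nonpositive on all directions with
  \<open>g \<bullet> w < 0\<close>, since these lead into \<open>K\<close>, and this leaves only the
  ray spanned by \<open>g\<close>.\<close>

lemma supporting_normal_sublevel:
  fixes K :: "'a::euclidean_space set"
  assumes K: "convex K" and x: "x \<in> K" "f x = 0" and f: "(f has_derivative (\<lambda>v. g \<bullet> v)) (at x)"
    and loc: "\<forall>\<^sub>F y in nhds x. y \<in> K \<longleftrightarrow> f y \<le> 0" and g: "g \<noteq> 0"
  shows "\<And>y. y \<in> K \<Longrightarrow> g \<bullet> (y - x) \<le> 0" "outer_unit_normal K x = sgn g"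
proof -
  have lim: "filterlim (\<lambda>s. x + s *\<^sub>R w) (nhds x) (at_right 0)" for w
    by (rule tendsto_eq_intros refl | simp)+
  show supp: "g \<bullet> (y - x) \<le> 0" if y: "y \<in> K" for y
  proof (rule ccontr)
    assume "\<not> g \<bullet> (y - x) \<le> 0"
    then have "(- g) \<bullet> (y - x) < 0" by simp
    moreover have "((\<lambda>y. - f y) has_derivative (\<lambda>v. (- g) \<bullet> v)) (at x)"
      using has_derivative_minus[OF f] by simp
    ultimately have "\<forall>\<^sub>F s in at_right 0. - f (x + s *\<^sub>R (y - x)) < - f x"
      by (intro has_derivative_neg_direction)
    moreover have "\<forall>\<^sub>F s in at_right 0. x + s *\<^sub>R (y - x) \<in> K \<longleftrightarrow> f (x + s *\<^sub>R (y - x)) \<le> 0"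
      using loc lim[of "y - x"] by (rule eventually_compose_filterlim)
    moreover have "\<forall>\<^sub>F s::real in at_right 0. 0 < s \<and> s < 1" by (auto simp: eventually_at_right[of 0 1] intro: exI[of _ 1])
    ultimately have "\<forall>\<^sub>F s::real in at_right 0. False"
    proof eventually_elim
      case (elim s)
      have "(1 - s) *\<^sub>R x + s *\<^sub>R y \<in> K" using elim K x y by (intro convexD) auto
      then have "x + s *\<^sub>R (y - x) \<in> K" by (simp add: algebra_simps)
      then show False using elim x by auto
    qed
    then show False by simp
  qed
  show "outer_unit_normal K x = sgn g" unfolding outer_unit_normal_def
  proof (rule the_equality)
    show "norm (sgn g) = 1 \<and> (\<forall>y\<in>K. sgn g \<bullet> (y - x) \<le> 0)"
      using supp g by (auto simp: norm_sgn sgn_div_norm mult_nonneg_nonpos)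
  next
    fix u assume u: "norm u = 1 \<and> (\<forall>y\<in>K. u \<bullet> (y - x) \<le> 0)"
    have half: "u \<bullet> w \<le> 0" if "g \<bullet> w < 0" for w
    proof -
      have "\<forall>\<^sub>F s in at_right 0. f (x + s *\<^sub>R w) < f x" using f that by (rule has_derivative_neg_direction)
      moreover have "\<forall>\<^sub>F s in at_right 0. x + s *\<^sub>R w \<in> K \<longleftrightarrow> f (x + s *\<^sub>R w) \<le> 0"
        using loc lim[of w] by (rule eventually_compose_filterlim)
      moreover have "\<forall>\<^sub>F s::real in at_right 0. 0 < s" by (simp add: eventually_at_right_less)
      ultimately have "\<forall>\<^sub>F s::real in at_right 0. u \<bullet> w \<le> 0"
      proof eventually_elim
        case (elim s)
        then have "u \<bullet> (x + s *\<^sub>R w - x) \<le> 0" using u x by auto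
        then show ?case using elim by (simp add: mult_le_0_iff)
      qed
      then show ?thesis by simp
    qed
    \<comment> \<open>\<open>p\<close> is the component of \<open>u\<close> orthogonal to
      \<open>g\<close>. It lies on the boundary of the half-space covered by \<open>half\<close>, so
      \<open>half\<close> is applied to \<open>p - t *\<^sub>R g\<close> with small
      \<open>t\<close>, which gives \<open>p \<bullet> p \<le> \<delta>\<close>.\<close>
    define a where "a = (u \<bullet> g) / (g \<bullet> g)"
    define p where "p = u - a *\<^sub>R g"
    have gg: "g \<bullet> g > 0" using g by simp
    have pg: "p \<bullet> g = 0" using gg by (simp add: p_def a_def inner_diff_left)
    have small: "p \<bullet> p \<le> 0 + \<delta>" if "\<delta> > 0" for \<delta>
    proof -
      define t where "t = \<delta> / (\<bar>u \<bullet> g\<bar> + 1)"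
      have t: "0 < t" "t * \<bar>u \<bullet> g\<bar> \<le> \<delta>" using that by (auto simp: t_def field_simps)
      have "g \<bullet> (p - t *\<^sub>R g) < 0" using t gg pg by (simp add: inner_diff_right inner_commute)
      then have "u \<bullet> (p - t *\<^sub>R g) \<le> 0" by (rule half)
      moreover have "u \<bullet> p = p \<bullet> p"
      proof -
        have "u = p + a *\<^sub>R g" by (simp add: p_def)
        then have "u \<bullet> p = p \<bullet> p + a * (p \<bullet> g)" by (metis inner_add_left inner_commute inner_scaleR_left)
        then show ?thesis using pg by simp
      qed
      moreover have "t * (u \<bullet> g) \<le> t * \<bar>u \<bullet> g\<bar>" using t by (intro mult_left_mono) auto
      moreover have "u \<bullet> (p - t *\<^sub>R g) = u \<bullet> p - t * (u \<bullet> g)" by (simp add: inner_diff_right)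
      ultimately show ?thesis using t by linarith
    qed
    have "p \<bullet> p \<le> 0" using small by (rule field_le_epsilon)
    then have "p = 0" by (metis inner_gt_zero_iff not_le)
    then have ua: "u = a *\<^sub>R g" by (simp add: p_def)
    have "u \<bullet> (- g) \<le> 0" using gg by (intro half) simp
    then have "a \<ge> 0" using gg by (simp add: a_def zero_le_divide_iff)
    then have "a > 0" using ua u by (cases "a = 0") auto
    then have "sgn u = sgn g" using ua by (simp add: sgn_scaleR)
    then show "u = sgn g" using u by (simp add: sgn_div_norm)
  qed
qed

text \<open>The matrix annihilates the vector \<open>x\<close>, so its columns are dependent. As in
  Cramer's rule, \<open>x c0\<close> times the determinant is the determinant with column
  \<open>c0\<close> replaced by the combination of columns that vanishes.\<close>

lemma det_wrt_eq_0:
  fixes B :: "'a::euclidean_space set"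
  assumes B: "finite B" and c0: "c0 \<in> B" "x c0 \<noteq> 0" and ker: "\<And>b. b \<in> B \<Longrightarrow> (\<Sum>c\<in>B. x c * (b \<bullet> W c)) = 0"
  shows "det_wrt B W = 0"
proof -
  define M where "M b c = b \<bullet> W c" for b c
  let ?P = "{p. p permutes B}"
  \<comment> \<open>The determinant with column \<open>c0\<close> replaced by column
    \<open>c\<close>. For \<open>c \<noteq> c0\<close> column \<open>c\<close> occurs twice, and
    composing with the transposition flips the sign without changing the products.\<close>
  define col where "col c = (\<Sum>p\<in>?P. real_of_int (sign p) * (\<Prod>b\<in>B. M b (if p b = c0 then c else p b)))" for c
  have two: "col c = 0" if c: "c \<in> B" "c \<noteq> c0" for c
  proof -
    let ?\<tau> = "Transposition.transpose c c0"
    have \<tau>: "?\<tau> permutes B" using c c0 by (simp add: permutes_swap_id)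
    let ?f = "\<lambda>p. real_of_int (sign p) * (\<Prod>b\<in>B. M b (if p b = c0 then c else p b))"
    have "col c = (\<Sum>p\<in>?P. ?f (?\<tau> \<circ> p))"
      unfolding col_def by (rule setum_permutations_compose_left[OF \<tau>])
    also have "\<dots> = (\<Sum>p\<in>?P. - ?f p)"
    proof (rule sum.cong[OF refl])
      fix p assume p: "p \<in> ?P"
      have pp: "permutation p" using p B by (auto simp: permutation_permutes)
      have "sign (?\<tau> \<circ> p) = - sign p"
        using c(2) pp by (simp add: sign_compose permutation_swap_id sign_swap_id)
      moreover have "(if (?\<tau> \<circ> p) b = c0 then c else (?\<tau> \<circ> p) b) = (if p b = c0 then c else p b)" for b
        using c(2) by (auto simp: Transposition.transpose_def)
      ultimately show "?f (?\<tau> \<circ> p) = - ?f p" by simp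
    qed
    also have "\<dots> = - col c" by (simp add: col_def sum_negf)
    finally show ?thesis by simp
  qed
  have "(\<Sum>c\<in>B. x c * col c) = 0"
  proof -
    have expand: "(\<Prod>b\<in>B. M b (if p b = c0 then c else p b)) = M (inv p c0) c * (\<Prod>b\<in>B - {inv p c0}. M b (p b))"
      if p: "p permutes B" for p c
    proof -
      have b0: "inv p c0 \<in> B" "p (inv p c0) = c0"
        using p c0 by (auto simp: permutes_inverses permutes_in_image permutes_inv)
      have "(\<Prod>b\<in>B. M b (if p b = c0 then c else p b)) = M (inv p c0) c *
          (\<Prod>b\<in>B - {inv p c0}. M b (if p b = c0 then c else p b))"
        using prod.remove[OF B b0(1), of "\<lambda>b. M b (if p b = c0 then c else p b)"] b0(2) by simp
      also have "(\<Prod>b\<in>B - {inv p c0}. M b (if p b = c0 then c else p b)) = (\<Prod>b\<in>B - {inv p c0}. M b (p b))"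
        using p by (intro prod.cong) (auto simp: permutes_inverses)
      finally show ?thesis .
    qed
    have "(\<Sum>c\<in>B. x c * col c) = (\<Sum>c\<in>B. \<Sum>p\<in>?P. of_int (sign p) * (\<Prod>b\<in>B - {inv p c0}. M b (p b)) * (x c * M (inv p c0) c))"
      unfolding col_def sum_distrib_left by (intro sum.cong refl) (simp add: expand mult_ac)
    also have "\<dots> = (\<Sum>p\<in>?P. of_int (sign p) * (\<Prod>b\<in>B - {inv p c0}. M b (p b)) * (\<Sum>c\<in>B. x c * M (inv p c0) c))"
      by (subst sum.swap) (simp add: sum_distrib_left)
    also have "\<dots> = 0"
    proof (rule sum.neutral, rule ballI)
      fix p assume "p \<in> ?P"
      then have "inv p c0 \<in> B" using c0 by (metis mem_Collect_eq permutes_in_image permutes_inv)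
      then show "of_int (sign p) * (\<Prod>b\<in>B - {inv p c0}. M b (p b)) * (\<Sum>c\<in>B. x c * M (inv p c0) c) = 0"
        using ker by (simp add: M_def)
    qed
    finally show ?thesis .
  qed
  moreover have "(\<Sum>c\<in>B. x c * col c) = x c0 * col c0"
    using B c0 two by (subst sum.remove[OF B c0(1)]) auto
  moreover have "col c0 = det_wrt B W" unfolding col_def det_wrt_def M_def
    by (intro sum.cong prod.cong arg_cong2[where f="(*)"] refl) auto
  ultimately show ?thesis using c0 by simp
qed

subsection \<open>Boundary geometry and the deformation speed\<close>

text \<open>Near \<open>x0\<close> the gap is \<open>norm x - g (0, sgn x)\<close>, and the chain
  rule applies because \<open>g\<close> is differentiable in the ambient space, not merely along the
  sphere. The radial function is constant along rays, whence
  \<open>G x \<bullet> x = norm x\<close>; in particular the gradient does not vanish.\<close>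

lemma radial_gap_gradient:
  fixes K :: "'a::euclidean_space set" and g :: "real \<times> 'a \<Rightarrow> real"
  assumes g: "C2_open U g" and U: "(0, sgn x0) \<in> U" and x0: "x0 \<noteq> 0"
    and eq: "\<And>u. norm u = 1 \<Longrightarrow> (0, u) \<in> U \<Longrightarrow> g (0, u) = radial_function K u"
  obtains e G H where "0 < e" "0 \<notin> ball x0 e"
    "\<And>x. x \<in> ball x0 e \<Longrightarrow> (radial_gap K has_derivative (\<lambda>v. G x \<bullet> v)) (at x)"
    "(G has_derivative H) (at x0)" "\<And>x. x \<in> ball x0 e \<Longrightarrow> G x \<bullet> x = norm x"
proof -
  obtain g' g'' where oU: "open U"
    and g': "\<And>p. p \<in> U \<Longrightarrow> (g has_derivative blinfun_apply (g' p)) (at p)"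
    and g'': "\<And>p. p \<in> U \<Longrightarrow> (g' has_derivative blinfun_apply (g'' p)) (at p)"
    using g unfolding C2_open_def by blast
  define V where "V = {x. x \<noteq> 0 \<and> (0::real, sgn x) \<in> U}"
  have "open V"
  proof (subst open_subopen, intro ballI)
    fix x assume x: "x \<in> V"
    have "isCont (\<lambda>x::'a. (0::real, sgn x)) x" using x by (intro continuous_intros) (auto simp: V_def)
    then have "((\<lambda>x::'a. (0::real, sgn x)) \<longlongrightarrow> (0, sgn x)) (nhds x)"
      using tendsto_at_iff_tendsto_nhds[of "\<lambda>x::'a. (0::real, sgn x)" x] by (simp add: isCont_def)
    then have "\<forall>\<^sub>F y in nhds x. (0::real, sgn y) \<in> U"
      by (rule topological_tendstoD) (use oU x in \<open>auto simp: V_def\<close>)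
    moreover have "\<forall>\<^sub>F y in nhds x. y \<noteq> 0" using x by (intro t1_space_nhds) (auto simp: V_def)
    ultimately have "\<forall>\<^sub>F y in nhds x. y \<in> V" by eventually_elim (simp add: V_def)
    then show "\<exists>T. open T \<and> x \<in> T \<and> T \<subseteq> V" by (auto simp: eventually_nhds)
  qed
  moreover have "x0 \<in> V" using x0 U by (simp add: V_def)
  ultimately obtain e where e: "e > 0" "ball x0 e \<subseteq> V" by (auto simp: open_contains_ball)
  \<comment> \<open>The gradient of \<open>g\<close> in the space variable at
    \<open>(0, sgn x)\<close>, written in the standard basis so that differentiability at
    \<open>x0\<close> follows componentwise from that of \<open>g'\<close>.\<close>
  define q where "q x = (\<Sum>b\<in>Basis. (g' (0, sgn x) (0, b)) *\<^sub>R b)" for x :: 'a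
  have q: "q x \<bullet> w = g' (0, sgn x) (0, w)" for x w
  proof -
    have lin: "linear (\<lambda>w. g' (0, sgn x) (0, w))"
    proof (rule linearI)
      fix r :: real and b :: 'a
      have "(0::real, r *\<^sub>R b) = r *\<^sub>R (0, b)" by simp
      then show "g' (0, sgn x) (0, r *\<^sub>R b) = r *\<^sub>R g' (0, sgn x) (0, b)" by (simp only: blinfun.scaleR_right)
    qed (simp add: blinfun.add_right[symmetric])
    have "g' (0, sgn x) (0, w) = g' (0, sgn x) (0, \<Sum>b\<in>Basis. (w \<bullet> b) *\<^sub>R b)" by (simp add: euclidean_representation)
    also have "\<dots> = (\<Sum>b\<in>Basis. (w \<bullet> b) * g' (0, sgn x) (0, b))"
      using linear_sum[OF lin, of "\<lambda>b. (w \<bullet> b) *\<^sub>R b" Basis] linear_scale[OF lin] by simp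
    also have "\<dots> = q x \<bullet> w" by (simp add: q_def inner_sum_left inner_commute[of w] mult.commute)
    finally show ?thesis by simp
  qed
  \<comment> \<open>Differentiating through \<open>sgn\<close> projects \<open>q x\<close> to the
    orthogonal complement of \<open>x\<close> and divides by \<open>norm x\<close>.\<close>
  define G where "G x = sgn x - (1 / norm x) *\<^sub>R (q x - (q x \<bullet> sgn x) *\<^sub>R sgn x)" for x
  have dsgn: "((\<lambda>x. (0::real, sgn x)) has_derivative (\<lambda>v. (0, (v - (sgn x \<bullet> v) *\<^sub>R sgn x) /\<^sub>R norm x))) (at x)"
    if "x \<noteq> 0" for x :: 'a
    by (intro has_derivative_Pair has_derivative_const has_derivative_sgn that)
  have der: "(radial_gap K has_derivative (\<lambda>v. G x \<bullet> v)) (at x)" if x: "x \<in> ball x0 e" for x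
  proof -
    have xV: "x \<noteq> 0" "(0, sgn x) \<in> U" using subsetD[OF e(2) x] by (auto simp: V_def)
    have "((\<lambda>x. g (0, sgn x)) has_derivative (\<lambda>v. g' (0, sgn x) (0, (v - (sgn x \<bullet> v) *\<^sub>R sgn x) /\<^sub>R norm x))) (at x)"
      by (rule has_derivative_compose[OF dsgn[OF xV(1)] g'[OF xV(2)]])
    then have "((\<lambda>x. norm x - g (0, sgn x)) has_derivative
        (\<lambda>v. sgn x \<bullet> v - g' (0, sgn x) (0, (v - (sgn x \<bullet> v) *\<^sub>R sgn x) /\<^sub>R norm x))) (at x)"
      by (intro has_derivative_diff norm_has_gradient xV(1))
    moreover have "sgn x \<bullet> v - g' (0, sgn x) (0, (v - (sgn x \<bullet> v) *\<^sub>R sgn x) /\<^sub>R norm x) = G x \<bullet> v" for v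
      unfolding q[symmetric] by (simp add: G_def inner_diff_left inner_diff_right divide_inverse mult.commute)
    ultimately have "((\<lambda>x. norm x - g (0, sgn x)) has_derivative (\<lambda>v. G x \<bullet> v)) (at x)" by simp
    then show ?thesis
    proof (rule has_derivative_transform_within_open[OF _ open_ball x])
      fix y assume "y \<in> ball x0 e"
      then have "y \<in> V" using e(2) by blast
      then have "y \<noteq> 0" "(0, sgn y) \<in> U" by (auto simp: V_def)
      then show "norm y - g (0, sgn y) = radial_gap K y" using eq by (simp add: radial_gap_def norm_sgn)
    qed
  qed
  have sd: "sgn differentiable (at x0)" using has_derivative_sgn[OF x0] by (rule differentiableI)
  have gd: "(\<lambda>x. blinfun_apply (g' (0, sgn x)) z) differentiable (at x0)" for z
  proof -
    have "((\<lambda>x. g' (0, sgn x)) has_derivative (\<lambda>v. g'' (0, sgn x0) (0, (v - (sgn x0 \<bullet> v) *\<^sub>R sgn x0) /\<^sub>R norm x0))) (at x0)"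
      by (rule has_derivative_compose[OF dsgn[OF x0] g''[OF U]])
    from bounded_linear.has_derivative[OF blinfun.bounded_linear_left this, of z]
    show ?thesis by (rule differentiableI)
  qed
  have qd: "q differentiable (at x0)"
    unfolding q_def by (intro differentiable_sum finite_Basis differentiable_scaleR gd differentiable_const ballI)
  have nd: "(\<lambda>x::'a. inverse (norm x)) differentiable (at x0)"
    using Deriv.has_derivative_inverse[OF _ norm_has_gradient[OF x0]] x0 by (auto intro: differentiableI)
  have id: "(\<lambda>x. q x \<bullet> sgn x) differentiable (at x0)"
    using qd sd unfolding differentiable_def by (metis has_derivative_inner)
  have "G differentiable (at x0)"
    unfolding G_def inverse_eq_divide[symmetric]
    by (intro differentiable_diff differentiable_scaleR sd qd nd id)
  then obtain H where H: "(G has_derivative H) (at x0)" unfolding differentiable_def by blast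
  have Gx: "G x \<bullet> x = norm x" if x: "x \<in> ball x0 e" for x
  proof -
    have xn: "x \<noteq> 0" using subsetD[OF e(2) x] by (auto simp: V_def)
    have "sgn x \<bullet> x = norm x" using xn by (simp add: sgn_div_norm dot_square_norm power2_eq_square)
    moreover have "q x \<bullet> x = norm x * (q x \<bullet> sgn x)" using xn by (simp add: sgn_div_norm)
    ultimately show ?thesis by (simp add: G_def inner_diff_left)
  qed
  show ?thesis
  proof (rule that[OF e(1) _ der H Gx])
    have "0 \<notin> V" by (simp add: V_def)
    then show "0 \<notin> ball x0 e" using e(2) by blast
  qed
qed

text \<open>The estimate must be uniform in \<open>u\<close> near \<open>u0\<close>: the points of
  the section lie in directions that only tend to \<open>u0\<close>. It follows from the mean value
  theorem in \<open>t\<close> and continuity of the time derivative at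
  \<open>(0, u0)\<close>.\<close>

lemma radial_time_derivative:
  fixes g :: "real \<times> 'a::euclidean_space \<Rightarrow> real"
  assumes g: "C2_open U g" and U: "(0, u0) \<in> U"
    and eq: "\<And>t u. 0 \<le> t \<Longrightarrow> t \<le> 1 \<Longrightarrow> norm u = 1 \<Longrightarrow> (t, u) \<in> U \<Longrightarrow> g (t, u) = radial_function (Kt t) u"
  obtains h where "\<And>\<eta>. 0 < \<eta> \<Longrightarrow> \<exists>\<tau>>0. \<forall>t u. 0 \<le> t \<and> t < \<tau> \<and> norm u = 1 \<and> norm (u - u0) < \<tau> \<longrightarrow>
     \<bar>radial_function (Kt t) u - radial_function (Kt 0) u - t * h\<bar> \<le> \<eta> * t"
proof -
  obtain g' g'' where oU: "open U"
    and g': "\<And>p. p \<in> U \<Longrightarrow> (g has_derivative blinfun_apply (g' p)) (at p)"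
    and g'': "\<And>p. p \<in> U \<Longrightarrow> (g' has_derivative blinfun_apply (g'' p)) (at p)"
    using g unfolding C2_open_def by blast
  define h where "h = g' (0, u0) (1, 0)"
  have "\<exists>\<tau>>0. \<forall>t u. 0 \<le> t \<and> t < \<tau> \<and> norm u = 1 \<and> norm (u - u0) < \<tau> \<longrightarrow>
     \<bar>radial_function (Kt t) u - radial_function (Kt 0) u - t * h\<bar> \<le> \<eta> * t" if \<eta>: "0 < \<eta>" for \<eta>
  proof -
    have "isCont g' (0, u0)" using g''[OF U] by (rule has_derivative_continuous)
    then have "isCont (\<lambda>p. g' p (1, 0)) (0, u0)" by (intro continuous_intros)
    then obtain r1 where r1: "r1 > 0" "\<And>p. dist p (0, u0) < r1 \<Longrightarrow> dist (g' p (1, 0)) h < \<eta>"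
      using \<eta> unfolding continuous_at_eps_delta h_def by metis
    obtain r2 where r2: "r2 > 0" "ball (0, u0) r2 \<subseteq> U" using oU U by (auto simp: open_contains_ball)
    \<comment> \<open>Halved because the deviations in time and in direction may both come close to
      \<open>\<tau>\<close>; the bound 1 keeps the times in the unit interval.\<close>
    define \<tau> where "\<tau> = min 1 (min r1 r2 / 2)"
    have \<tau>: "0 < \<tau>" "\<tau> \<le> 1" "2 * \<tau> \<le> r1" "2 * \<tau> \<le> r2" using r1(1) r2(1) by (auto simp: \<tau>_def min_def)
    have "\<bar>radial_function (Kt t) u - radial_function (Kt 0) u - t * h\<bar> \<le> \<eta> * t"
      if t: "0 \<le> t" "t < \<tau>" "norm u = 1" "norm (u - u0) < \<tau>" for t u
    proof -
      have near: "dist (s, u) (0, u0) < 2 * \<tau>" if "0 \<le> s" "s \<le> t" for s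
      proof -
        have "dist (s, u) (0, u0) \<le> \<bar>s\<bar> + norm (u - u0)"
          using norm_Pair_le[of "s - 0" "u - u0"] by (simp add: dist_norm)
        then show ?thesis using that t by simp
      qed
      have inU: "(s, u) \<in> U" if "0 \<le> s" "s \<le> t" for s
      proof -
        have "(s, u) \<in> ball (0, u0) r2" using near[OF that] \<tau> by (simp add: dist_commute)
        then show ?thesis using r2(2) by blast
      qed
      have req: "g (s, u) = radial_function (Kt s) u" if "0 \<le> s" "s \<le> t" for s
        using eq[OF that(1) _ t(3) inU[OF that]] that t \<tau> by simp
      show ?thesis
      proof (cases "t = 0")
        case False
        then have tp: "0 < t" using t by simp
        have der: "((\<lambda>s. g (s, u)) has_real_derivative g' (s, u) (1, 0)) (at s)" if s: "0 \<le> s" "s \<le> t" for s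
        proof -
          have "((\<lambda>s. (s, u)) has_derivative (\<lambda>r. (r, 0))) (at s)"
            by (intro has_derivative_Pair has_derivative_const has_derivative_ident)
          from has_derivative_compose[OF this g'[OF inU[OF s]]]
          have "((\<lambda>s. g (s, u)) has_derivative (\<lambda>r. g' (s, u) (r, 0))) (at s)" .
          moreover have "(\<lambda>r. g' (s, u) (r, 0)) = (*) (g' (s, u) (1, 0))"
          proof
            fix r
            have "(r, 0::'a) = r *\<^sub>R (1, 0)" by simp
            then show "g' (s, u) (r, 0) = g' (s, u) (1, 0) * r"
              by (metis blinfun.scaleR_right mult.commute real_scaleR_def)
          qed
          ultimately show ?thesis by (simp only: has_field_derivative_def)
        qed
        obtain s where s: "0 < s" "s < t" "g (t, u) - g (0, u) = (t - 0) * g' (s, u) (1, 0)"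
          using MVT2[OF tp, of "\<lambda>s. g (s, u)", OF der] by auto
        have "dist (g' (s, u) (1, 0)) h < \<eta>" using near[of s] s \<tau> by (intro r1(2)) auto
        then have "\<bar>g' (s, u) (1, 0) - h\<bar> \<le> \<eta>" by (simp add: dist_real_def)
        have "radial_function (Kt t) u - radial_function (Kt 0) u - t * h = t * (g' (s, u) (1, 0) - h)"
          using s(3) req[of t] req[of 0] tp by (simp add: algebra_simps)
        also have "\<bar>\<dots>\<bar> \<le> t * \<eta>" using \<open>\<bar>g' (s, u) (1, 0) - h\<bar> \<le> \<eta>\<close> tp by (simp add: abs_mult)
        finally show ?thesis by (simp add: mult.commute)
      qed simp
    qed
    then show ?thesis using \<tau>(1) by blast
  qed
  then show ?thesis by (rule that)
qed

text \<open>The quadratic has its minimum 0 at \<open>s = 0\<close>, so its derivative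
  \<open>2 * a\<close> there vanishes.\<close>

lemma quadratic_nonneg_imp_linear_0:
  fixes a b :: real
  assumes "\<And>s. 0 \<le> 2 * s * a + s\<^sup>2 * b"
  shows "a = 0"
proof (rule ccontr)
  assume a: "a \<noteq> 0"
  define m where "m = \<bar>b\<bar> + 1"
  have m: "m > 0" "b \<le> m" by (auto simp: m_def)
  have "2 * (- a / m) * a + (- a / m)\<^sup>2 * b = a\<^sup>2 / m * (b / m - 2)"
    using m by (simp add: power2_eq_square field_simps)
  moreover have "b / m - 2 < 0" using m by (simp add: field_simps)
  moreover have "a\<^sup>2 / m > 0" using a m by simp
  ultimately have "2 * (- a / m) * a + (- a / m)\<^sup>2 * b < 0" by (simp only: mult_pos_neg)
  then show False using assms[of "- a / m"] by simp
qed

text \<open>For the definiteness: a negative value of the form at a tangent vector would put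
  interior points on the supporting hyperplane, so convexity makes the form semidefinite. A tangent
  null vector of a symmetric semidefinite form is in its radical, hence in the kernel of the
  Weingarten map, whose determinant would vanish against the positive curvature.\<close>

lemma C2_plus_frontier_geometry:
  fixes K :: "'a::euclidean_space set"
  assumes K: "convex_body K" "C2_plus K" "0 \<in> interior K" and x0: "x0 \<in> frontier K"
    and e: "0 < e" "0 \<notin> ball x0 e"
    and G: "\<And>x. x \<in> ball x0 e \<Longrightarrow> (radial_gap K has_derivative (\<lambda>v. G x \<bullet> v)) (at x)"
    and H: "(G has_derivative H) (at x0)" and Gx: "\<And>x. x \<in> ball x0 e \<Longrightarrow> G x \<bullet> x = norm x"
  shows "\<And>y. y \<in> K \<Longrightarrow> G x0 \<bullet> (y - x0) \<le> 0"
    and "\<And>w. G x0 \<bullet> w < 0 \<Longrightarrow> \<exists>s>0. x0 + s *\<^sub>R w \<in> interior K"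
    and "\<And>v. v \<noteq> 0 \<Longrightarrow> G x0 \<bullet> v = 0 \<Longrightarrow> 0 < H v \<bullet> v"
proof -
  let ?F = "radial_gap K"
  have KK: "compact K" "convex K" using K(1) by (auto simp: convex_body_def)
  have K0: "0 \<in> K" using K(3) interior_subset by blast
  have ball0: "x \<noteq> 0" if "x \<in> ball x0 e" for x using that e(2) by auto
  have x0b: "x0 \<in> ball x0 e" using e by simp
  have Gn: "G x \<noteq> 0" if "x \<in> ball x0 e" for x
  proof
    assume "G x = 0"
    then show False using Gx[OF that] ball0[OF that] by simp
  qed
  have cont: "isCont ?F x" if "x \<in> ball x0 e" for x using G[OF that] by (rule has_derivative_continuous)
  have int: "x \<in> interior K \<longleftrightarrow> ?F x < 0" and fr: "x \<in> frontier K \<longleftrightarrow> ?F x = 0" if "x \<in> ball x0 e" for x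
    using frontier_iff_radial_gap[OF KK K(3) ball0[OF that] cont[OF that]] by auto
  have near: "\<forall>\<^sub>F y in nhds x. y \<in> ball x0 e" if "x \<in> ball x0 e" for x
    using that by (intro eventually_nhds_in_open) auto
  have loc: "\<forall>\<^sub>F y in nhds x. y \<in> K \<longleftrightarrow> ?F y \<le> 0" if "x \<in> ball x0 e" for x
    using near[OF that] by eventually_elim (use mem_iff_radial_gap[OF KK K0] ball0 in blast)
  have supp: "y \<in> K \<Longrightarrow> G x \<bullet> (y - x) \<le> 0" "outer_unit_normal K x = sgn (G x)"
    if x: "x \<in> ball x0 e" "x \<in> frontier K" for x y
  proof -
    have F: "?F x = 0" "x \<in> K" using fr[OF x(1)] x(2) mem_iff_radial_gap[OF KK K0 ball0[OF x(1)]] by auto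
    note supporting_normal_sublevel[OF KK(2) F(2,1) G[OF x(1)] loc[OF x(1)] Gn[OF x(1)]]
    then show "y \<in> K \<Longrightarrow> G x \<bullet> (y - x) \<le> 0" "outer_unit_normal K x = sgn (G x)" by blast+
  qed
  show S: "\<And>y. y \<in> K \<Longrightarrow> G x0 \<bullet> (y - x0) \<le> 0" using supp(1)[OF x0b x0] .
  have F0: "?F x0 = 0" using fr[OF x0b] x0 by simp
  have lim: "filterlim (\<lambda>s. x0 + s *\<^sub>R w) (nhds x0) (at_right 0)" for w
    by (rule tendsto_eq_intros refl | simp)+
  show "\<exists>s>0. x0 + s *\<^sub>R w \<in> interior K" if w: "G x0 \<bullet> w < 0" for w
  proof -
    have "\<forall>\<^sub>F s in at_right 0. ?F (x0 + s *\<^sub>R w) < ?F x0" by (rule has_derivative_neg_direction[OF G[OF x0b] w])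
    moreover have "\<forall>\<^sub>F s in at_right 0. x0 + s *\<^sub>R w \<in> ball x0 e"
      using near[OF x0b] lim by (rule eventually_compose_filterlim)
    moreover have "\<forall>\<^sub>F s::real in at_right 0. 0 < s" by (simp add: eventually_at_right_less)
    ultimately have "\<forall>\<^sub>F s in at_right 0. 0 < s \<and> x0 + s *\<^sub>R w \<in> interior K"
      by eventually_elim (use int F0 in auto)
    then show ?thesis using eventually_happens'[of "at_right (0::real)"] by fastforce
  qed
  have lin: "linear H" using H by (rule has_derivative_linear)
  have psd: "0 \<le> H w \<bullet> w" if w: "G x0 \<bullet> w = 0" for w
  proof (rule ccontr)
    assume neg: "\<not> 0 \<le> H w \<bullet> w"
    then have wn: "w \<noteq> 0" using lin by (auto simp: linear_0)
    \<comment> \<open>With this tolerance the remainder uses up only half of the negative quadratic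
      term.\<close>
    define \<eta> where "\<eta> = - (H w \<bullet> w) / (4 * (norm w)\<^sup>2)"
    have \<eta>: "0 < \<eta>" using neg wn by (simp add: \<eta>_def divide_neg_pos)
    obtain d where d: "d > 0" "\<And>w. norm w < d \<Longrightarrow> \<bar>?F (x0 + w) - ?F x0 - G x0 \<bullet> w - (H w \<bullet> w) / 2\<bar> \<le> \<eta> * (norm w)\<^sup>2"
      using second_order_taylor[OF G e(1) H \<eta>] by blast
    define s where "s = min d e / (2 * norm w)"
    have s: "0 < s" "norm (s *\<^sub>R w) < d" "norm (s *\<^sub>R w) < e"
      using d(1) e(1) wn by (auto simp: s_def)
    have "?F (x0 + s *\<^sub>R w) \<le> (H (s *\<^sub>R w) \<bullet> (s *\<^sub>R w)) / 2 + \<eta> * (norm (s *\<^sub>R w))\<^sup>2"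
      using d(2)[OF s(2)] F0 w by simp
    also have "\<dots> = s\<^sup>2 * ((H w \<bullet> w) / 2 + \<eta> * (norm w)\<^sup>2)"
      by (simp add: linear_scale[OF lin] power2_eq_square algebra_simps)
    also have "\<eta> * (norm w)\<^sup>2 = - (H w \<bullet> w) / 4" using wn by (simp add: \<eta>_def)
    also have "s\<^sup>2 * ((H w \<bullet> w) / 2 + - (H w \<bullet> w) / 4) < 0" using neg s by (intro mult_pos_neg) auto
    finally have "?F (x0 + s *\<^sub>R w) < 0" .
    then have "x0 + s *\<^sub>R w \<in> interior K" using int[of "x0 + s *\<^sub>R w"] s by (simp add: dist_norm)
    then obtain r where r: "r > 0" "ball (x0 + s *\<^sub>R w) r \<subseteq> K" by (auto simp: mem_interior)
    \<comment> \<open>The interior point \<open>x0 + s *\<^sub>R w\<close> lies on the supporting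
      hyperplane, so a small shift along \<open>G x0\<close> stays in \<open>K\<close> but crosses
      that hyperplane.\<close>
    define \<tau> where "\<tau> = r / (2 * norm (G x0))"
    have \<tau>: "\<tau> > 0" "norm (\<tau> *\<^sub>R G x0) < r" using r Gn[OF x0b] by (auto simp: \<tau>_def)
    have "x0 + s *\<^sub>R w + \<tau> *\<^sub>R G x0 \<in> K" using r \<tau> by (intro subsetD[OF r(2)]) (simp add: dist_norm)
    then have "G x0 \<bullet> (s *\<^sub>R w + \<tau> *\<^sub>R G x0) \<le> 0" using S[of "x0 + s *\<^sub>R w + \<tau> *\<^sub>R G x0"] by (simp add: add.assoc)
    moreover have "G x0 \<bullet> (s *\<^sub>R w + \<tau> *\<^sub>R G x0) > 0" using w \<tau> Gn[OF x0b] by (simp add: inner_add_right)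
    ultimately show False by simp
  qed
  obtain c W B where c: "c > 0" "c = det_wrt B W" and W: "(outer_unit_normal K has_derivative W) (at x0 within frontier K)"
    and B: "orthonormal_basis_of B {v. outer_unit_normal K x0 \<bullet> v = 0}"
    using K(2) x0 unfolding C2_plus_def has_gauss_curvature_def by blast
  define g where "g = G x0"
  have gn: "g \<noteq> 0" using Gn[OF x0b] by (simp add: g_def)
  have N0: "outer_unit_normal K x0 = sgn g" using supp(2)[OF x0b x0] by (simp add: g_def)
  text \<open>Along the boundary curve obtained by radially projecting \<open>x0 + s v\<close>, the normal is \<open>sgn (G x)\<close>,
    so the Weingarten map is \<open>H\<close> divided by \<open>norm g\<close>, up to normal components.\<close>
  have Wein: "W v = (H v - (sgn g \<bullet> H v) *\<^sub>R sgn g) /\<^sub>R norm g" if v: "g \<bullet> v = 0" for v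
  proof -
    define y where "y s = x0 + s *\<^sub>R v" for s
    define q where "q s = y s - ?F (y s) *\<^sub>R sgn (y s)" for s
    have x0n: "x0 \<noteq> 0" using ball0[OF x0b] .
    have dy: "(y has_derivative (\<lambda>t. t *\<^sub>R v)) (at 0)" unfolding y_def by (auto intro!: derivative_eq_intros)
    have y0: "y 0 = x0" by (simp add: y_def)
    have dF: "((\<lambda>s. ?F (y s)) has_derivative (\<lambda>t. G x0 \<bullet> (t *\<^sub>R v))) (at 0)"
      by (rule has_derivative_compose[OF dy]) (simp add: y0 G[OF x0b])
    have dS: "((\<lambda>s. sgn (y s)) has_derivative (\<lambda>t. (t *\<^sub>R v - (sgn x0 \<bullet> (t *\<^sub>R v)) *\<^sub>R sgn x0) /\<^sub>R norm x0)) (at 0)"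
      by (rule has_derivative_compose[OF dy]) (simp only: y0 has_derivative_sgn[OF x0n])
    from has_derivative_diff[OF dy has_derivative_scaleR[OF dF dS]]
    have dq: "(q has_derivative (\<lambda>t. t *\<^sub>R v)) (at 0)"
      using v F0 unfolding q_def by (simp add: y0 g_def)
    have q0: "q 0 = x0" by (simp add: q_def y0 F0)
    have "isCont q 0" using dq by (rule has_derivative_continuous)
    then have "(q \<longlongrightarrow> x0) (nhds 0)" unfolding isCont_def q0[symmetric] by (simp add: tendsto_at_iff_tendsto_nhds)
    then have e1: "\<forall>\<^sub>F s in nhds 0. q s \<in> ball x0 e" using near[OF x0b] eventually_compose_filterlim by blast
    have "isCont y 0" using dy by (rule has_derivative_continuous)
    then have yl: "(y \<longlongrightarrow> x0) (nhds 0)" unfolding isCont_def y0[symmetric] by (simp add: tendsto_at_iff_tendsto_nhds)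
    then have e2: "\<forall>\<^sub>F s in nhds 0. y s \<in> ball x0 e" using near[OF x0b] eventually_compose_filterlim by blast
    have "isCont (\<lambda>x. norm x - ?F x) x0" using cont[OF x0b] by (intro continuous_intros)
    then have "((\<lambda>x. norm x - ?F x) \<longlongrightarrow> norm x0) (nhds x0)"
      unfolding isCont_def using F0 tendsto_at_iff_tendsto_nhds[of "\<lambda>x. norm x - ?F x" x0] by simp
    then have "\<forall>\<^sub>F x in nhds x0. 0 < norm x - ?F x" using x0n by (intro order_tendstoD(1)) auto
    then have e3: "\<forall>\<^sub>F s in nhds 0. 0 < norm (y s) - ?F (y s)" using yl eventually_compose_filterlim by blast
    have "\<forall>\<^sub>F s in nhds 0. q s \<in> ball x0 e \<and> q s \<in> frontier K"
      using e1 e2 e3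
    proof eventually_elim
      case (elim s)
      have yn: "y s \<noteq> 0" using ball0 elim by blast
      have "q s = (norm (y s) - ?F (y s)) *\<^sub>R sgn (y s)" using yn
        by (simp add: q_def scaleR_diff_left) (simp add: sgn_div_norm)
      then have "?F (q s) = (norm (y s) - ?F (y s)) * norm (sgn (y s)) - radial_function K (sgn (sgn (y s)))"
        using radial_gap_scaleR[of "norm (y s) - ?F (y s)" K "sgn (y s)"] elim by simp
      also have "\<dots> = 0" using yn by (simp add: norm_sgn radial_gap_def) (simp add: sgn_div_norm)
      finally show ?case using elim fr by simp
    qed
    then obtain S where Sd: "open S" "0 \<in> S" "\<And>s. s \<in> S \<Longrightarrow> q s \<in> ball x0 e \<and> q s \<in> frontier K"
      by (auto simp: eventually_nhds)
    \<comment> \<open>\<open>W\<close> is a derivative within the frontier only. Since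
      \<open>q\<close> maps the open set \<open>S\<close> into the frontier, the composition is
      nevertheless differentiable at 0 in the full sense.\<close>
    have "((\<lambda>s. outer_unit_normal K (q s)) has_derivative (\<lambda>t. W (t *\<^sub>R v))) (at 0 within S)"
    proof (rule has_derivative_in_compose[where f = q and g = "outer_unit_normal K" and g' = W])
      show "(q has_derivative (\<lambda>t. t *\<^sub>R v)) (at 0 within S)" using dq by (rule has_derivative_at_withinI)
      show "(outer_unit_normal K has_derivative W) (at (q 0) within q ` S)"
        unfolding q0 using Sd(3) by (intro has_derivative_subset[OF W]) auto
    qed
    then have "((\<lambda>s. outer_unit_normal K (q s)) has_derivative (\<lambda>t. W (t *\<^sub>R v))) (at 0)"
      unfolding at_within_open[OF Sd(2,1)] .
    then have 1: "((\<lambda>s. sgn (G (q s))) has_derivative (\<lambda>t. W (t *\<^sub>R v))) (at 0)"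
    proof (rule has_derivative_transform_within_open[OF _ Sd(1,2)])
      fix s assume "s \<in> S"
      then show "outer_unit_normal K (q s) = sgn (G (q s))" using Sd(3)[of s] supp(2)[of "q s"] by simp
    qed
    have "((\<lambda>s. G (q s)) has_derivative (\<lambda>t. H (t *\<^sub>R v))) (at 0)"
      by (rule has_derivative_compose[OF dq]) (simp only: q0 H)
    then have "((\<lambda>s. sgn (G (q s))) has_derivative (\<lambda>t. (H (t *\<^sub>R v) - (sgn g \<bullet> H (t *\<^sub>R v)) *\<^sub>R sgn g) /\<^sub>R norm g)) (at 0)"
      by (rule has_derivative_compose) (simp only: q0 g_def[symmetric] has_derivative_sgn[OF gn])
    from has_derivative_unique[OF 1 this]
    have "W (1 *\<^sub>R v) = (H (1 *\<^sub>R v) - (sgn g \<bullet> H (1 *\<^sub>R v)) *\<^sub>R sgn g) /\<^sub>R norm g" by metis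
    then show ?thesis by simp
  qed
  have Wlin: "linear W" using W by (rule has_derivative_linear)
  have sB: "span B = {v. sgn g \<bullet> v = 0}" and oB: "pairwise orthogonal B" "\<And>b. b \<in> B \<Longrightarrow> norm b = 1"
    using B N0 by (auto simp: orthonormal_basis_of_def)
  have T: "sgn g \<bullet> v = 0 \<longleftrightarrow> g \<bullet> v = 0" for v using gn by (simp add: sgn_div_norm)
  have finB: "finite B"
  proof -
    have "0 \<notin> B" using oB(2) by force
    then show ?thesis using oB(1) pairwise_orthogonal_independent finiteI_independent by blast
  qed
  show "0 < H v \<bullet> v" if v: "v \<noteq> 0" "G x0 \<bullet> v = 0" for v
  proof (rule ccontr)
    assume "\<not> 0 < H v \<bullet> v"
    then have q0: "H v \<bullet> v = 0" using psd[OF v(2)] by simp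
    \<comment> \<open>The form is nonnegative along \<open>v + s *\<^sub>R w\<close> and vanishes at
      \<open>s = 0\<close>; symmetry of \<open>H\<close> merges the two mixed terms.\<close>
    have Hvw: "H v \<bullet> w = 0" if w: "g \<bullet> w = 0" for w
    proof (rule quadratic_nonneg_imp_linear_0)
      fix s :: real
      have "G x0 \<bullet> (v + s *\<^sub>R w) = 0" using v w by (simp add: inner_add_right g_def)
      then have "0 \<le> H (v + s *\<^sub>R w) \<bullet> (v + s *\<^sub>R w)" by (rule psd)
      also have "\<dots> = H v \<bullet> v + s * (H v \<bullet> w + H w \<bullet> v) + s\<^sup>2 * (H w \<bullet> w)"
        by (simp add: linear_add[OF lin] linear_scale[OF lin] inner_add_left inner_add_right power2_eq_square algebra_simps)
      also have "H w \<bullet> v = H v \<bullet> w" by (rule second_derivative_symmetric[OF G e(1) H])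
      finally show "0 \<le> 2 * s * (H v \<bullet> w) + s\<^sup>2 * (H w \<bullet> w)" using q0 by (simp add: algebra_simps)
    qed
    have vB: "v \<in> span B" using v(2) T[of v] by (simp add: sB g_def)
    have vexp: "(\<Sum>c\<in>B. (v \<bullet> c) *\<^sub>R c) = v"
      using orthonormal_basis_expand[OF oB(1) _ vB finB] oB(2) by simp
    obtain c0 where c0: "c0 \<in> B" "v \<bullet> c0 \<noteq> 0"
    proof -
      have "\<exists>c0\<in>B. v \<bullet> c0 \<noteq> 0"
      proof (rule ccontr)
        assume "\<not> (\<exists>c0\<in>B. v \<bullet> c0 \<noteq> 0)"
        then have "(\<Sum>c\<in>B. (v \<bullet> c) *\<^sub>R c) = 0" by (intro sum.neutral) auto
        then show False using vexp v(1) by simp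
      qed
      then show ?thesis using that by blast
    qed
    have "det_wrt B W = 0"
    proof (rule det_wrt_eq_0[where x = "\<lambda>c. v \<bullet> c", OF finB c0])
      fix b assume b: "b \<in> B"
      then have gb: "g \<bullet> b = 0" using span_base[OF b] by (simp add: sB T)
      have "(\<Sum>c\<in>B. (v \<bullet> c) * (b \<bullet> W c)) = b \<bullet> W (\<Sum>c\<in>B. (v \<bullet> c) *\<^sub>R c)"
        by (simp add: linear_sum[OF Wlin] linear_scale[OF Wlin] inner_sum_right)
      also have "\<dots> = b \<bullet> W v" unfolding vexp ..
      also have "\<dots> = (H v \<bullet> b - (sgn g \<bullet> H v) * (sgn g \<bullet> b)) / norm g"
        using Wein[of v] v(2) by (simp add: g_def inner_diff_right inner_diff_left inner_commute divide_inverse_commute)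
      also have "\<dots> = 0" using Hvw[OF gb] gb T by simp
      finally show "(\<Sum>c\<in>B. (v \<bullet> c) * (b \<bullet> W c)) = 0" .
    qed
    then show False using c by simp
  qed
qed

subsection \<open>Rescaled sections\<close>

text \<open>An ellipsoid in \<open>T\<close> if \<open>H\<close> is positive definite there and
  \<open>s > 0\<close>; the factor \<open>1/2\<close> is that of the Taylor expansion. For
  \<open>s < 0\<close> it is empty, so the lower bound at level \<open>h - \<eta>\<close> makes
  sense even for \<open>h = 0\<close>.\<close>

definition form_sublevel :: "'a::euclidean_space set \<Rightarrow> ('a \<Rightarrow> 'a) \<Rightarrow> real \<Rightarrow> 'a set" where
  "form_sublevel T H s = {v \<in> T. (H v \<bullet> v) / 2 \<le> s}"

lemma pos_def_lower_bound:
  fixes H :: "'a::euclidean_space \<Rightarrow> 'a"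
  assumes T: "subspace T" and H: "linear H" and pos: "\<And>v. v \<in> T \<Longrightarrow> v \<noteq> 0 \<Longrightarrow> 0 < H v \<bullet> v"
  obtains m where "0 < m" "\<And>v. v \<in> T \<Longrightarrow> m * (norm v)\<^sup>2 \<le> H v \<bullet> v"
proof (cases "T \<inter> sphere 0 1 = {}")
  case True
  have z: "v = 0" if "v \<in> T" for v
  proof (rule ccontr)
    assume "v \<noteq> 0"
    then have "v /\<^sub>R norm v \<in> T \<inter> sphere 0 1" using that T by (auto intro: subspace_scale)
    then show False using True by blast
  qed
  show ?thesis
  proof (rule that[of 1])
    fix v assume "v \<in> T"
    from z[OF this] show "1 * (norm v)\<^sup>2 \<le> H v \<bullet> v" by (simp add: linear_0[OF H])
  qed simp
next
  case False
  have cH: "continuous_on S H" for S using H by (simp add: linear_continuous_on linear_conv_bounded_linear)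
  have "compact (T \<inter> sphere 0 1)" using T by (intro closed_Int_compact closed_subspace) auto
  then obtain v0 where v0: "v0 \<in> T \<inter> sphere 0 1" "\<And>v. v \<in> T \<inter> sphere 0 1 \<Longrightarrow> H v0 \<bullet> v0 \<le> H v \<bullet> v"
    using continuous_attains_inf[of "T \<inter> sphere 0 1" "\<lambda>v. H v \<bullet> v"] False
      continuous_on_inner[OF cH continuous_on_id] by blast
  have "0 < H v0 \<bullet> v0" using v0(1) by (intro pos) auto
  moreover have "(H v0 \<bullet> v0) * (norm v)\<^sup>2 \<le> H v \<bullet> v" if v: "v \<in> T" for v
  proof (cases "v = 0")
    case False
    define u where "u = v /\<^sub>R norm v"
    have u: "u \<in> T \<inter> sphere 0 1" using False v T by (auto simp: u_def intro: subspace_scale)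
    have vu: "v = norm v *\<^sub>R u" using False by (simp add: u_def)
    have "H v \<bullet> v = (norm v)\<^sup>2 * (H u \<bullet> u)"
      by (subst (1 2) vu) (simp add: linear_scale[OF H] power2_eq_square)
    then show ?thesis using v0(2)[OF u] by (simp add: mult.commute[of _ "(norm v)\<^sup>2"] mult_left_mono)
  qed (use H in \<open>simp add: linear_0\<close>)
  ultimately show ?thesis by (rule that)
qed

lemma form_sublevel_bounded:
  assumes "0 < m" "\<And>v. v \<in> T \<Longrightarrow> m * (norm v)\<^sup>2 \<le> H v \<bullet> v" "v \<in> form_sublevel T H s"
  shows "norm v \<le> sqrt (2 * \<bar>s\<bar> / m)"
proof (rule real_le_rsqrt)
  have "m * (norm v)\<^sup>2 \<le> 2 * \<bar>s\<bar>" using assms by (force simp: form_sublevel_def)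
  then show "(norm v)\<^sup>2 \<le> 2 * \<bar>s\<bar> / m" using assms(1) by (simp add: field_simps)
qed

lemma compact_convex_form_sublevel:
  fixes H :: "'a::euclidean_space \<Rightarrow> 'a"
  assumes T: "subspace T" and H: "linear H" and pos: "\<And>v. v \<in> T \<Longrightarrow> v \<noteq> 0 \<Longrightarrow> 0 < H v \<bullet> v"
    and s: "0 \<le> s"
  shows "compact_convex (form_sublevel T H s)"
proof -
  obtain m where m: "0 < m" "\<And>v. v \<in> T \<Longrightarrow> m * (norm v)\<^sup>2 \<le> H v \<bullet> v"
    using pos_def_lower_bound[OF T H pos] by blast
  have bl: "bounded_linear H" using H by (simp add: linear_conv_bounded_linear)
  have "bounded (form_sublevel T H s)"
    using form_sublevel_bounded[OF m, where s = s] unfolding bounded_iff by blast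
  moreover have "form_sublevel T H s = T \<inter> {v. (H v \<bullet> v) / 2 \<le> s}" by (auto simp: form_sublevel_def)
  moreover have "closed {v. (H v \<bullet> v) / 2 \<le> s}"
    by (intro closed_Collect_le continuous_intros linear_continuous_on bl) auto
  ultimately have "compact (form_sublevel T H s)"
    using T by (simp add: compact_eq_bounded_closed closed_Int closed_subspace)
  moreover have "convex (form_sublevel T H s)"
  proof (rule convexI)
    fix v w and a b :: real
    assume vw: "v \<in> form_sublevel T H s" "w \<in> form_sublevel T H s" and ab: "0 \<le> a" "0 \<le> b" "a + b = 1"
    \<comment> \<open>\<open>H\<close> is not assumed symmetric, so the two mixed terms are kept as
      a sum and bounded by means of the form at \<open>v - w\<close>.\<close>
    have "0 \<le> H (v - w) \<bullet> (v - w)"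
      using pos[of "v - w"] vw T H by (cases "v = w") (auto simp: form_sublevel_def subspace_diff linear_0)
    then have c: "H v \<bullet> w + H w \<bullet> v \<le> H v \<bullet> v + H w \<bullet> w"
      by (simp add: linear_diff[OF H] inner_diff_left inner_diff_right)
    have "H (a *\<^sub>R v + b *\<^sub>R w) \<bullet> (a *\<^sub>R v + b *\<^sub>R w)
      = a * a * (H v \<bullet> v) + a * b * (H v \<bullet> w + H w \<bullet> v) + b * b * (H w \<bullet> w)"
      by (simp add: linear_add[OF H] linear_scale[OF H] inner_add_left inner_add_right algebra_simps)
    also have "\<dots> \<le> a * a * (H v \<bullet> v) + a * b * (H v \<bullet> v + H w \<bullet> w) + b * b * (H w \<bullet> w)"
      using mult_left_mono[OF c, of "a * b"] ab by simp
    also have "\<dots> = (a + b) * (a * (H v \<bullet> v) + b * (H w \<bullet> w))" by (simp add: algebra_simps)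
    also have "\<dots> = a * (H v \<bullet> v) + b * (H w \<bullet> w)" using ab by simp
    also have "\<dots> \<le> a * (2 * s) + b * (2 * s)"
      using vw ab by (intro add_mono mult_left_mono) (auto simp: form_sublevel_def)
    also have "\<dots> = (a + b) * (2 * s)" by (simp add: algebra_simps)
    finally have "(H (a *\<^sub>R v + b *\<^sub>R w) \<bullet> (a *\<^sub>R v + b *\<^sub>R w)) / 2 \<le> s" using ab by simp
    then show "a *\<^sub>R v + b *\<^sub>R w \<in> form_sublevel T H s"
      using vw T by (auto simp: form_sublevel_def intro!: subspace_add subspace_scale)
  qed
  moreover have "0 \<in> form_sublevel T H s" using T H s by (simp add: form_sublevel_def subspace_0 linear_0)
  ultimately show ?thesis by (auto simp: compact_convex_def)
qed

lemma intrinsic_volumes_form_sublevel: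
  fixes H :: "'a::euclidean_space \<Rightarrow> 'a"
  assumes T: "subspace T" and H: "linear H" and pos: "\<And>v. v \<in> T \<Longrightarrow> v \<noteq> 0 \<Longrightarrow> 0 < H v \<bullet> v"
    and s: "0 < s"
  shows "intrinsic_volumes (form_sublevel T H s) k = sqrt s ^ k * intrinsic_volumes (form_sublevel T H 1) k"
proof -
  define r where "r = sqrt s"
  have r: "0 < r" "r * r = s" using s by (auto simp: r_def)
  have "form_sublevel T H s = (*\<^sub>R) r ` form_sublevel T H 1"
  proof (intro equalityI subsetI)
    fix v assume v: "v \<in> form_sublevel T H s"
    have "H (v /\<^sub>R r) \<bullet> (v /\<^sub>R r) = (H v \<bullet> v) / (r * r)" by (simp add: linear_scale[OF H] divide_inverse)
    moreover have "(H v \<bullet> v) / s / 2 \<le> 1" using v s by (simp add: form_sublevel_def field_simps)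
    ultimately have "v /\<^sub>R r \<in> form_sublevel T H 1"
      using v T unfolding r(2) form_sublevel_def mem_Collect_eq by (auto intro: subspace_scale)
    then show "v \<in> (*\<^sub>R) r ` form_sublevel T H 1" using r by (intro image_eqI[of _ _ "v /\<^sub>R r"]) auto
  next
    fix v assume "v \<in> (*\<^sub>R) r ` form_sublevel T H 1"
    then obtain w where w: "v = r *\<^sub>R w" "w \<in> T" "(H w \<bullet> w) / 2 \<le> 1" by (auto simp: form_sublevel_def)
    have "H v \<bullet> v = s * (H w \<bullet> w)" using w by (simp add: linear_scale[OF H] r(2)[symmetric])
    then have "(H v \<bullet> v) / 2 \<le> s" using mult_left_mono[OF w(3), of s] s by simp
    then show "v \<in> form_sublevel T H s" using w T by (auto simp: form_sublevel_def intro!: subspace_scale)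
  qed
  then show ?thesis
    using intrinsic_volumes_scaleR[OF compact_convex_form_sublevel[OF T H pos, of 1] r(1)] by (simp add: r_def)
qed

lemma intrinsic_volumes_form_sublevel_pos:
  fixes H :: "'a::euclidean_space \<Rightarrow> 'a"
  assumes T: "subspace T" and H: "linear H" and pos: "\<And>v. v \<in> T \<Longrightarrow> v \<noteq> 0 \<Longrightarrow> 0 < H v \<bullet> v"
    and k: "k \<le> dim T"
  shows "0 < intrinsic_volumes (form_sublevel T H 1) k"
proof -
  obtain b where b: "b > 0" "\<And>v. norm (H v) \<le> b * norm v" using linear_bounded_pos[OF H] by blast
  define \<rho> where "\<rho> = min 1 (1 / b)"
  have \<rho>: "0 < \<rho>" "\<rho> \<le> 1" "b * \<rho> \<le> 1" using b(1) by (auto simp: \<rho>_def min_def field_simps)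
  have "T \<inter> cball 0 \<rho> \<subseteq> form_sublevel T H 1"
  proof
    fix v assume v: "v \<in> T \<inter> cball 0 \<rho>"
    have "H v \<bullet> v \<le> norm (H v) * norm v" by (rule norm_cauchy_schwarz)
    also have "\<dots> \<le> (b * norm v) * norm v" by (intro mult_right_mono b(2)) auto
    also have "\<dots> \<le> (b * \<rho>) * 1" using v b(1) \<rho> by (intro mult_mono) auto
    finally show "v \<in> form_sublevel T H 1" using \<rho> v by (auto simp: form_sublevel_def)
  qed
  then show ?thesis
    using intrinsic_volumes_pos[OF T k compact_convex_form_sublevel[OF T H pos] \<rho>(1)] by simp
qed

text \<open>Monotonicity transfers the sandwich to intrinsic volumes, and the bounds are
  \<open>sqrt (h - \<eta>) ^ k\<close> and \<open>sqrt (h + \<eta>) ^ k\<close> times one constant,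
  so only continuity of the square root remains.\<close>

lemma intrinsic_volumes_tendsto:
  fixes C :: "real \<Rightarrow> 'a::euclidean_space set"
  assumes T: "subspace T" and H: "linear H" and pos: "\<And>v. v \<in> T \<Longrightarrow> v \<noteq> 0 \<Longrightarrow> 0 < H v \<bullet> v"
    and k: "1 \<le> k" and h: "0 \<le> h"
    and C: "\<forall>\<^sub>F e in at_right 0. compact_convex (C e)"
    and sw: "\<And>\<eta>. 0 < \<eta> \<Longrightarrow> \<forall>\<^sub>F e in at_right 0. form_sublevel T H (h - \<eta>) \<subseteq> C e \<and> C e \<subseteq> form_sublevel T H (h + \<eta>)"
  shows "((\<lambda>e. intrinsic_volumes (C e) k) \<longlongrightarrow> sqrt h ^ k * intrinsic_volumes (form_sublevel T H 1) k) (at_right 0)"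
proof -
  define c where "c = intrinsic_volumes (form_sublevel T H 1) k"
  have cc: "compact_convex (form_sublevel T H s)" if "0 \<le> s" for s using compact_convex_form_sublevel[OF T H pos that] .
  have cont: "isCont (\<lambda>s. sqrt s ^ k * c) h" by (intro continuous_intros)
  have iv: "intrinsic_volumes (form_sublevel T H s) k = sqrt s ^ k * c" if "0 < s" for s
    using intrinsic_volumes_form_sublevel[OF T H pos that] by (simp add: c_def)
  have "((\<lambda>e. intrinsic_volumes (C e) k) \<longlongrightarrow> sqrt h ^ k * c) (at_right 0)"
  proof (rule order_tendstoI)
    fix a assume a: "a < sqrt h ^ k * c"
    show "\<forall>\<^sub>F e in at_right 0. a < intrinsic_volumes (C e) k"
    proof (cases "h = 0")
      \<comment> \<open>Here the lower set is empty and gives nothing. As \<open>k \<ge> 1\<close>,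
        the limit is 0 and nonnegativity suffices as lower bound.\<close>
      case True
      then have "a < 0" using a k by (simp add: power_0_left)
      show ?thesis using C by (rule eventually_mono) (rule less_le_trans[OF \<open>a < 0\<close> intrinsic_volumes_nonneg])
    next
      case False
      obtain d where d: "d > 0" "\<And>s. \<bar>s - h\<bar> < d \<Longrightarrow> \<bar>sqrt s ^ k * c - sqrt h ^ k * c\<bar> < sqrt h ^ k * c - a"
        using cont a unfolding continuous_at_eps_delta dist_real_def by (metis diff_gt_0_iff_gt)
      define \<eta> where "\<eta> = min d h / 2"
      have \<eta>: "0 < \<eta>" "\<eta> < d" "\<eta> < h" using d(1) False h by (auto simp: \<eta>_def min_def)
      have "a < sqrt (h - \<eta>) ^ k * c" using d(2)[of "h - \<eta>"] \<eta> by auto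
      then have lt: "a < intrinsic_volumes (form_sublevel T H (h - \<eta>)) k" using iv \<eta> by simp
      from C sw[OF \<eta>(1)] show ?thesis
      proof eventually_elim
        case (elim e)
        then show ?case using intrinsic_volumes_mono[of "form_sublevel T H (h - \<eta>)" "C e" k] cc[of "h - \<eta>"] \<eta> lt by auto
      qed
    qed
  next
    fix a assume a: "sqrt h ^ k * c < a"
    obtain d where d: "d > 0" "\<And>s. \<bar>s - h\<bar> < d \<Longrightarrow> \<bar>sqrt s ^ k * c - sqrt h ^ k * c\<bar> < a - sqrt h ^ k * c"
      using cont a unfolding continuous_at_eps_delta dist_real_def by (metis diff_gt_0_iff_gt)
    define \<eta> where "\<eta> = d / 2"
    have \<eta>: "0 < \<eta>" "\<eta> < d" using d(1) by (auto simp: \<eta>_def)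
    have "sqrt (h + \<eta>) ^ k * c < a" using d(2)[of "h + \<eta>"] \<eta> by auto
    then have lt: "intrinsic_volumes (form_sublevel T H (h + \<eta>)) k < a" using iv \<eta> h by simp
    from C sw[OF \<eta>(1)] show "\<forall>\<^sub>F e in at_right 0. intrinsic_volumes (C e) k < a"
    proof eventually_elim
      case (elim e)
      then show ?case using intrinsic_volumes_mono[of "C e" "form_sublevel T H (h + \<eta>)" k] cc[of "h + \<eta>"] \<eta> h lt by auto
    qed
  qed
  then show ?thesis by (simp add: c_def)
qed

section \<open>Radial functions and first-order behaviour of a deformation\<close>

lemma radial_function_pos:
  fixes K :: "'a::euclidean_space set"
  assumes K: "compact K" "convex K" "0 \<in> interior K" and u: "norm u = 1"
  shows "0 < radial_function K u"
proof -
  obtain r where r: "r > 0" "cball 0 r \<subseteq> K" using K(3) by (auto simp: mem_interior_cball)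
  have "r *\<^sub>R u \<in> K" using r u by (intro subsetD[OF r(2)]) simp
  then have "radial_gap K (r *\<^sub>R u) \<le> 0"
    using mem_iff_radial_gap[OF K(1,2), of "r *\<^sub>R u"] K(3) interior_subset r u by fastforce
  moreover have "sgn u = u" using u by (simp add: sgn_div_norm)
  ultimately show ?thesis using r u radial_gap_scaleR[of r K u] by simp
qed

lemma radial_gap_radial_function:
  assumes "norm u = 1" "0 < radial_function K u"
  shows "radial_gap K (radial_function K u *\<^sub>R u) = 0"
proof -
  have "sgn u = u" using assms by (simp add: sgn_div_norm)
  then show ?thesis using assms radial_gap_scaleR[of "radial_function K u" K u] by simp
qed

lemma radial_function_mono:
  fixes K :: "'a::euclidean_space set"
  assumes K: "compact K" "convex K" "0 \<in> interior K" and L: "compact L" "convex L" "K \<subseteq> L" and u: "norm u = 1"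
  shows "radial_function K u \<le> radial_function L u"
proof -
  let ?r = "radial_function K u"
  have r: "0 < ?r" by (rule radial_function_pos[OF K u])
  have K0: "0 \<in> K" using K(3) interior_subset by blast
  have n0: "?r *\<^sub>R u \<noteq> 0" using r u by auto
  have "?r *\<^sub>R u \<in> K" using mem_iff_radial_gap[OF K(1,2) K0 n0] radial_gap_radial_function[OF u r] by simp
  then have "?r *\<^sub>R u \<in> L" using L(3) by blast
  then have "radial_gap L (?r *\<^sub>R u) \<le> 0" using mem_iff_radial_gap[OF L(1,2) _ n0] L(3) K0 by blast
  moreover have "sgn u = u" using u by (simp add: sgn_div_norm)
  ultimately show ?thesis using r u radial_gap_scaleR[of ?r L u] by simp
qed

lemma admissible_deformation_C2:
  assumes "admissible_deformation K Kt" "norm u0 = 1"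
  obtains U g where "(0, u0) \<in> U" "C2_open U (g :: real \<times> 'a::euclidean_space \<Rightarrow> real)"
    "\<And>t u. 0 \<le> t \<Longrightarrow> t \<le> 1 \<Longrightarrow> norm u = 1 \<Longrightarrow> (t, u) \<in> U \<Longrightarrow> g (t, u) = radial_function (Kt t) u"
proof -
  have "C2_on ({0..1} \<times> sphere 0 1) (\<lambda>(t, u). radial_function (Kt t) u)"
    using assms(1) by (simp add: admissible_deformation_def)
  moreover have "(0::real, u0) \<in> {0..1} \<times> sphere 0 1" using assms(2) by simp
  ultimately obtain U g where "(0, u0) \<in> U" "C2_open U g"
    "\<forall>y\<in>({0..1} \<times> sphere 0 1) \<inter> U. g y = (\<lambda>(t, u). radial_function (Kt t) u) y"
    unfolding C2_on_def by blast
  then show ?thesis by (intro that[of U g]) auto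
qed

text \<open>Smoothness of the gap of \<open>K\<close> is taken from the deformation at time 0. The
  resulting \<open>n\<close> and \<open>H\<close> describe \<open>K\<close> alone, so the same pair
  can be used for another deformation of \<open>K\<close>.\<close>

lemma frontier_expansion:
  fixes K :: "'a::euclidean_space set"
  assumes K: "convex_body K" "C2_plus K" "0 \<in> interior K" and ad: "admissible_deformation K Kt"
    and x0: "x0 \<noteq> 0" "radial_gap K x0 = 0"
  obtains n H where "linear H" "0 < n \<bullet> x0" "\<And>y. y \<in> K \<Longrightarrow> n \<bullet> (y - x0) \<le> 0"
    "\<And>w. n \<bullet> w < 0 \<Longrightarrow> \<exists>s>0. x0 + s *\<^sub>R w \<in> interior K"
    "\<And>v. v \<noteq> 0 \<Longrightarrow> n \<bullet> v = 0 \<Longrightarrow> 0 < H v \<bullet> v"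
    "\<And>\<eta>. 0 < \<eta> \<Longrightarrow> \<exists>d>0. \<forall>w. norm w < d \<longrightarrow> \<bar>radial_gap K (x0 + w) - n \<bullet> w - (H w \<bullet> w) / 2\<bar> \<le> \<eta> * (norm w)\<^sup>2"
proof -
  have "norm (sgn x0) = 1" using x0 by (simp add: norm_sgn)
  then obtain U g where U: "(0, sgn x0) \<in> U" "C2_open U (g :: real \<times> 'a \<Rightarrow> real)"
    "\<And>t u. 0 \<le> t \<Longrightarrow> t \<le> 1 \<Longrightarrow> norm u = 1 \<Longrightarrow> (t, u) \<in> U \<Longrightarrow> g (t, u) = radial_function (Kt t) u"
    using admissible_deformation_C2[OF ad] by blast
  have Kt0: "Kt 0 = K" using ad by (simp add: admissible_deformation_def)
  obtain e G H where e: "0 < e" "0 \<notin> ball x0 e"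
    and G: "\<And>x. x \<in> ball x0 e \<Longrightarrow> (radial_gap K has_derivative (\<lambda>v. G x \<bullet> v)) (at x)"
    and H: "(G has_derivative H) (at x0)" and Gx: "\<And>x. x \<in> ball x0 e \<Longrightarrow> G x \<bullet> x = norm x"
    using radial_gap_gradient[OF U(2,1) x0(1), of K] U(3)[of 0] Kt0 by auto
  have xb: "x0 \<in> ball x0 e" using e by simp
  have "isCont (radial_gap K) x0" using G[OF xb] by (rule has_derivative_continuous)
  then have fr: "x0 \<in> frontier K"
    using frontier_iff_radial_gap(2)[of K x0] K x0 by (simp add: convex_body_def)
  note geo = C2_plus_frontier_geometry[OF K fr e G H Gx]
  show ?thesis
  proof (rule that[of H "G x0"])
    show "linear H" using H by (rule has_derivative_linear)
    show "0 < G x0 \<bullet> x0" using Gx[OF xb] x0 by simp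
    show "\<exists>d>0. \<forall>w. norm w < d \<longrightarrow> \<bar>radial_gap K (x0 + w) - G x0 \<bullet> w - (H w \<bullet> w) / 2\<bar> \<le> \<eta> * (norm w)\<^sup>2"
      if "0 < \<eta>" for \<eta> using second_order_taylor[OF G e(1) H that] x0(2) by simp
  qed (use geo in blast)+
qed

text \<open>The speed is nonnegative because \<open>K \<subseteq> Kt t\<close>: a negative
  \<open>h\<close>, with tolerance \<open>- h / 2\<close>, would make the radial function drop below
  that of \<open>K\<close>.\<close>

lemma deformation_speed:
  fixes K :: "'a::euclidean_space set"
  assumes K: "convex_body K" "0 \<in> interior K" and ad: "admissible_deformation K Kt" and u0: "norm u0 = 1"
  obtains h where "0 \<le> h" "((\<lambda>t. radial_function (Kt t) u0) has_real_derivative h) (at 0 within {0..1})"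
    "\<And>\<eta>. 0 < \<eta> \<Longrightarrow> \<exists>\<tau>>0. \<forall>t u. 0 \<le> t \<and> t < \<tau> \<and> norm u = 1 \<and> norm (u - u0) < \<tau> \<longrightarrow>
     \<bar>radial_function (Kt t) u - radial_function K u - t * h\<bar> \<le> \<eta> * t"
proof -
  have Kt: "\<And>t. 0 \<le> t \<Longrightarrow> t \<le> 1 \<Longrightarrow> convex_body (Kt t) \<and> K \<subseteq> Kt t" "Kt 0 = K"
    using ad by (auto simp: admissible_deformation_def)
  obtain U g where U: "(0, u0) \<in> U" "C2_open U (g :: real \<times> 'a \<Rightarrow> real)"
    "\<And>t u. 0 \<le> t \<Longrightarrow> t \<le> 1 \<Longrightarrow> norm u = 1 \<Longrightarrow> (t, u) \<in> U \<Longrightarrow> g (t, u) = radial_function (Kt t) u"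
    using admissible_deformation_C2[OF ad u0] by blast
  obtain h where h: "\<And>\<eta>. 0 < \<eta> \<Longrightarrow> \<exists>\<tau>>0. \<forall>t u. 0 \<le> t \<and> t < \<tau> \<and> norm u = 1 \<and> norm (u - u0) < \<tau> \<longrightarrow>
     \<bar>radial_function (Kt t) u - radial_function (Kt 0) u - t * h\<bar> \<le> \<eta> * t"
    using radial_time_derivative[OF U(2,1,3)] by blast
  have der: "((\<lambda>t. radial_function (Kt t) u0) has_real_derivative h) (at 0 within {0..1})"
    unfolding has_field_derivative_def has_derivative_within_alt
  proof (intro conjI allI impI)
    show "bounded_linear ((*) h)" by (rule bounded_linear_mult_right)
    fix \<eta> :: real assume "0 < \<eta>"
    then obtain \<tau> where \<tau>: "\<tau> > 0" "\<And>t u. 0 \<le> t \<and> t < \<tau> \<and> norm u = 1 \<and> norm (u - u0) < \<tau> \<Longrightarrow>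
     \<bar>radial_function (Kt t) u - radial_function (Kt 0) u - t * h\<bar> \<le> \<eta> * t" using h by blast
    have "norm (radial_function (Kt t) u0 - radial_function (Kt 0) u0 - h * (t - 0)) \<le> \<eta> * norm (t - 0)"
      if "t \<in> {0..1}" "norm (t - 0) < \<tau>" for t
      using \<tau>(2)[of t u0] that u0 \<tau>(1) by (simp add: mult.commute)
    then show "\<exists>d>0. \<forall>y\<in>{0..1}. norm (y - 0) < d \<longrightarrow>
        norm (radial_function (Kt y) u0 - radial_function (Kt 0) u0 - h * (y - 0)) \<le> \<eta> * norm (y - 0)"
      using \<tau>(1) by blast
  qed
  have "0 \<le> h"
  proof (rule ccontr)
    assume "\<not> 0 \<le> h"
    then have "0 < - h / 2" by simp
    then obtain \<tau> where \<tau>: "\<tau> > 0" "\<And>t u. 0 \<le> t \<and> t < \<tau> \<and> norm u = 1 \<and> norm (u - u0) < \<tau> \<Longrightarrow>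
     \<bar>radial_function (Kt t) u - radial_function (Kt 0) u - t * h\<bar> \<le> (- h / 2) * t" using h by blast
    define t where "t = min \<tau> 1 / 2"
    have t: "0 < t" "t < \<tau>" "t \<le> 1" using \<tau>(1) by (auto simp: t_def min_def)
    have "radial_function K u0 \<le> radial_function (Kt t) u0"
      using Kt(1)[of t] t K by (intro radial_function_mono u0) (auto simp: convex_body_def)
    moreover have "\<bar>radial_function (Kt t) u0 - radial_function K u0 - t * h\<bar> \<le> (- h / 2) * t"
      using \<tau>(2)[of t u0] t u0 \<tau>(1) Kt(2) by simp
    ultimately have "- (t * h) \<le> (- h / 2) * t" by linarith
    moreover have "t * h < 0" using t \<open>\<not> 0 \<le> h\<close> by (simp add: mult_pos_neg)
    ultimately show False by (simp add: mult.commute)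
  qed
  then show ?thesis using that der h Kt(2) by simp
qed

text \<open>At \<open>x0 + sqrt e *\<^sub>R v\<close> with \<open>n \<bullet> v = 0\<close> the gap
  of \<open>K\<close> is \<open>e * (H v \<bullet> v) / 2\<close> and the deformation subtracts
  \<open>e * h\<close>, both up to a small multiple of \<open>e\<close>. The tolerance is shared
  equally, and the bound \<open>R\<close> makes the estimate uniform in \<open>v\<close>.\<close>

lemma rescaled_gap_estimate:
  fixes K :: "'a::euclidean_space set"
  assumes x0: "x0 \<noteq> 0" and T: "\<And>v. v \<in> T \<Longrightarrow> n \<bullet> v = 0" and H: "linear H"
    and taylor: "\<And>\<eta>. 0 < \<eta> \<Longrightarrow> \<exists>d>0. \<forall>w. norm w < d \<longrightarrow> \<bar>radial_gap K (x0 + w) - n \<bullet> w - (H w \<bullet> w) / 2\<bar> \<le> \<eta> * (norm w)\<^sup>2"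
    and speed: "\<And>\<eta>. 0 < \<eta> \<Longrightarrow> \<exists>\<tau>>0. \<forall>t u. 0 \<le> t \<and> t < \<tau> \<and> norm u = 1 \<and> norm (u - sgn x0) < \<tau> \<longrightarrow>
     \<bar>radial_function (Kt t) u - radial_function K u - t * h\<bar> \<le> \<eta> * t"
    and \<eta>: "0 < \<eta>" and R: "0 < R"
  shows "\<forall>\<^sub>F e in at_right 0. \<forall>v. v \<in> T \<and> norm v \<le> R \<longrightarrow> x0 + sqrt e *\<^sub>R v \<noteq> 0 \<and>
    \<bar>radial_gap (Kt e) (x0 + sqrt e *\<^sub>R v) - e * ((H v \<bullet> v) / 2 - h)\<bar> \<le> \<eta> * e"
proof -
  define \<eta>1 where "\<eta>1 = \<eta> / (2 * R\<^sup>2)"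
  have \<eta>1: "0 < \<eta>1" "\<eta>1 * R\<^sup>2 = \<eta> / 2" using \<eta> R by (auto simp: \<eta>1_def)
  obtain d where d: "d > 0" "\<And>w. norm w < d \<Longrightarrow> \<bar>radial_gap K (x0 + w) - n \<bullet> w - (H w \<bullet> w) / 2\<bar> \<le> \<eta>1 * (norm w)\<^sup>2"
    using taylor[OF \<eta>1(1)] by blast
  have "0 < \<eta> / 2" using \<eta> by simp
  then obtain \<tau> where \<tau>: "\<tau> > 0" "\<And>t u. 0 \<le> t \<and> t < \<tau> \<and> norm u = 1 \<and> norm (u - sgn x0) < \<tau> \<Longrightarrow>
     \<bar>radial_function (Kt t) u - radial_function K u - t * h\<bar> \<le> \<eta> / 2 * t"
    using speed by blast
  have "isCont sgn x0" using has_derivative_sgn[OF x0] by (rule has_derivative_continuous)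
  then obtain d2 where d2: "d2 > 0" "\<And>x. dist x x0 < d2 \<Longrightarrow> dist (sgn x) (sgn x0) < \<tau>"
    using \<tau>(1) unfolding continuous_at_eps_delta by blast
  \<comment> \<open>Displacements below \<open>\<delta>\<close> admit the expansion, keep the
    direction close to that of \<open>x0\<close>, and stay away from the origin.\<close>
  define \<delta> where "\<delta> = min (min d d2) (norm x0)"
  have \<delta>: "0 < \<delta>" "\<delta> \<le> d" "\<delta> \<le> d2" "\<delta> \<le> norm x0" using d(1) d2(1) x0 by (auto simp: \<delta>_def)
  have "((\<lambda>e. sqrt e * R) \<longlongrightarrow> sqrt 0 * R) (at_right 0)" by (intro tendsto_intros)
  then have e1: "\<forall>\<^sub>F e in at_right 0. sqrt e * R < \<delta>" using \<delta>(1) by (intro order_tendstoD(2)) auto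
  have e2: "\<forall>\<^sub>F e::real in at_right 0. 0 < e \<and> e < \<tau>"
    using \<tau>(1) by (auto simp: eventually_at_right[of 0 1])
  from e1 e2 show ?thesis
  proof eventually_elim
    case (elim e)
    show ?case
    proof (intro allI impI)
      fix v assume v: "v \<in> T \<and> norm v \<le> R"
      define w where "w = sqrt e *\<^sub>R v"
      have "norm w \<le> sqrt e * R" using v elim by (simp add: w_def mult_left_mono)
      then have nw: "norm w < \<delta>" using elim by simp
      have "norm w < norm x0" using nw \<delta> by simp
      then have x: "x0 + w \<noteq> 0" by (metis add_eq_0_iff less_irrefl norm_minus_cancel)
      have Hw: "H w \<bullet> w = e * (H v \<bullet> v)" using elim by (simp add: w_def linear_scale[OF H])
      have "\<bar>radial_gap K (x0 + w) - e * ((H v \<bullet> v) / 2)\<bar> \<le> \<eta>1 * (norm w)\<^sup>2"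
        using d(2)[of w] nw \<delta> T[of v] v by (simp add: Hw) (simp add: w_def)
      also have "(norm w)\<^sup>2 = e * (norm v)\<^sup>2" using elim by (simp add: w_def power_mult_distrib)
      also have "\<eta>1 * (e * (norm v)\<^sup>2) \<le> \<eta>1 * (e * R\<^sup>2)"
        using v elim \<eta>1 by (intro mult_left_mono power_mono) auto
      also have "\<dots> = \<eta> / 2 * e" using \<eta>1(2) by (simp add: mult.commute mult.left_commute)
      finally have 1: "\<bar>radial_gap K (x0 + w) - e * ((H v \<bullet> v) / 2)\<bar> \<le> \<eta> / 2 * e" .
      have "norm (sgn (x0 + w) - sgn x0) < \<tau>" using d2(2)[of "x0 + w"] nw \<delta> by (simp add: dist_norm)
      then have 2: "\<bar>radial_function (Kt e) (sgn (x0 + w)) - radial_function K (sgn (x0 + w)) - e * h\<bar> \<le> \<eta> / 2 * e"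
        using \<tau>(2)[of e "sgn (x0 + w)"] elim x by (simp add: norm_sgn)
      have "radial_gap (Kt e) (x0 + w) - e * ((H v \<bullet> v) / 2 - h) =
        (radial_gap K (x0 + w) - e * ((H v \<bullet> v) / 2)) -
        (radial_function (Kt e) (sgn (x0 + w)) - radial_function K (sgn (x0 + w)) - e * h)"
        by (simp add: radial_gap_def algebra_simps)
      moreover have "\<eta> / 2 * e + \<eta> / 2 * e = \<eta> * e" by simp
      ultimately have "\<bar>radial_gap (Kt e) (x0 + w) - e * ((H v \<bullet> v) / 2 - h)\<bar> \<le> \<eta> * e"
        using 1 2 by linarith
      then show "x0 + sqrt e *\<^sub>R v \<noteq> 0 \<and>
        \<bar>radial_gap (Kt e) (x0 + sqrt e *\<^sub>R v) - e * ((H v \<bullet> v) / 2 - h)\<bar> \<le> \<eta> * e"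
        using x by (simp add: w_def)
    qed
  qed
qed

text \<open>The estimate reaches only as far as \<open>norm v \<le> R\<close>. For the outer
  inclusion a point of \<open>C e\<close> beyond the larger ellipsoid, however far away, is moved
  towards 0, that is towards \<open>x0\<close>, until it hits the boundary of that ellipsoid. By
  convexity it stays in \<open>C e\<close>, but there the gap is positive.\<close>

lemma rescaled_section_sandwich:
  fixes K :: "'a::euclidean_space set"
  assumes Kt: "\<And>t. 0 \<le> t \<Longrightarrow> t \<le> 1 \<Longrightarrow> convex_body (Kt t) \<and> K \<subseteq> Kt t" and K0: "0 \<in> K" "x0 \<in> K"
    and T: "subspace T" and H: "linear H" and pos: "\<And>v. v \<in> T \<Longrightarrow> v \<noteq> 0 \<Longrightarrow> 0 < H v \<bullet> v" and h: "0 \<le> h"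
    and est: "\<And>\<eta> R. 0 < \<eta> \<Longrightarrow> 0 < R \<Longrightarrow> \<forall>\<^sub>F e in at_right 0. \<forall>v. v \<in> T \<and> norm v \<le> R \<longrightarrow> x0 + sqrt e *\<^sub>R v \<noteq> 0 \<and>
    \<bar>radial_gap (Kt e) (x0 + sqrt e *\<^sub>R v) - e * ((H v \<bullet> v) / 2 - h)\<bar> \<le> \<eta> * e"
    and \<eta>: "0 < \<eta>"
  defines "C \<equiv> \<lambda>e. {v \<in> T. x0 + sqrt e *\<^sub>R v \<in> Kt e}"
  shows "\<forall>\<^sub>F e in at_right 0. form_sublevel T H (h - \<eta>) \<subseteq> C e \<and> C e \<subseteq> form_sublevel T H (h + \<eta>)"
proof -
  obtain m where m: "0 < m" "\<And>v. v \<in> T \<Longrightarrow> m * (norm v)\<^sup>2 \<le> H v \<bullet> v"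
    using pos_def_lower_bound[OF T H pos] by blast
  \<comment> \<open>Large enough for the whole ellipsoid of level \<open>h + \<eta>\<close>.\<close>
  define R where "R = sqrt (2 * \<bar>h + \<eta>\<bar> / m) + 1"
  have R: "0 < R" using m(1) by (simp add: R_def add_nonneg_pos)
  have bR: "norm v \<le> R" if "v \<in> form_sublevel T H (h + \<eta>)" for v
    using form_sublevel_bounded[OF m that] by (simp add: R_def)
  have e1: "\<forall>\<^sub>F e::real in at_right 0. 0 < e \<and> e \<le> 1" by (auto simp: eventually_at_right[of 0 1] intro!: exI[of _ 1])
  have "0 < \<eta> / 2" using \<eta> by simp
  from e1 est[OF this R] show ?thesis
  proof eventually_elim
    case (elim e)
    have cb: "compact (Kt e)" "convex (Kt e)" "K \<subseteq> Kt e" using Kt[of e] elim by (auto simp: convex_body_def)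
    have mem: "x0 + sqrt e *\<^sub>R v \<in> Kt e \<longleftrightarrow> radial_gap (Kt e) (x0 + sqrt e *\<^sub>R v) \<le> 0"
      and gap: "\<bar>radial_gap (Kt e) (x0 + sqrt e *\<^sub>R v) - e * ((H v \<bullet> v) / 2 - h)\<bar> \<le> \<eta> / 2 * e"
      if "v \<in> T" "norm v \<le> R" for v
    proof -
      have "x0 + sqrt e *\<^sub>R v \<noteq> 0" using elim that by blast
      then show "x0 + sqrt e *\<^sub>R v \<in> Kt e \<longleftrightarrow> radial_gap (Kt e) (x0 + sqrt e *\<^sub>R v) \<le> 0"
        using mem_iff_radial_gap[OF cb(1,2)] cb(3) K0(1) by blast
      show "\<bar>radial_gap (Kt e) (x0 + sqrt e *\<^sub>R v) - e * ((H v \<bullet> v) / 2 - h)\<bar> \<le> \<eta> / 2 * e"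
        using elim that by blast
    qed
    show ?case
    proof (intro conjI subsetI)
      fix v assume v: "v \<in> form_sublevel T H (h - \<eta>)"
      have vT: "v \<in> T" "(H v \<bullet> v) / 2 - h \<le> - \<eta>" using v by (auto simp: form_sublevel_def)
      have vR: "norm v \<le> R" using v \<eta> by (intro bR) (auto simp: form_sublevel_def)
      have "e * ((H v \<bullet> v) / 2 - h) \<le> e * (- \<eta>)" using vT elim by (intro mult_left_mono) auto
      also have "e * (- \<eta>) = - (\<eta> / 2 * e) - (\<eta> / 2 * e)" by simp
      finally have X: "e * ((H v \<bullet> v) / 2 - h) \<le> - (\<eta> / 2 * e) - (\<eta> / 2 * e)" .
      have M: "0 < \<eta> / 2 * e" using elim \<eta> by simp
      have "G \<le> 0" if "X \<le> - M - M" "0 < M" "\<bar>G - X\<bar> \<le> M" for G X M :: real using that by linarith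
      from this[OF X M gap[OF vT(1) vR]] have "radial_gap (Kt e) (x0 + sqrt e *\<^sub>R v) \<le> 0" .
      then show "v \<in> C e" using mem[OF vT(1) vR] vT by (simp add: C_def)
    next
      fix v assume v: "v \<in> C e"
      show "v \<in> form_sublevel T H (h + \<eta>)"
      proof (rule ccontr)
        assume nv: "v \<notin> form_sublevel T H (h + \<eta>)"
        have vT: "v \<in> T" "x0 + sqrt e *\<^sub>R v \<in> Kt e" using v by (auto simp: C_def)
        define q where "q = (H v \<bullet> v) / 2"
        have q: "q > h + \<eta>" using nv vT by (simp add: form_sublevel_def q_def)
        \<comment> \<open>The factor that brings the quadratic form from \<open>q\<close> down to
          the level \<open>h + \<eta>\<close>.\<close>
        define r where "r = sqrt ((h + \<eta>) / q)"
        have r: "0 \<le> r" "r \<le> 1" "r * r = (h + \<eta>) / q" using q h \<eta> by (auto simp: r_def)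
        define v' where "v' = r *\<^sub>R v"
        have q': "(H v' \<bullet> v') / 2 = h + \<eta>"
        proof -
          have "(H v' \<bullet> v') / 2 = (r * r) * q" by (simp add: v'_def q_def linear_scale[OF H])
          then show ?thesis using q h \<eta> by (simp add: r(3))
        qed
        have v'T: "v' \<in> T" unfolding v'_def using T vT by (simp add: subspace_scale)
        have v'R: "norm v' \<le> R" using v'T q' by (intro bR) (simp add: form_sublevel_def)
        have "(1 - r) *\<^sub>R x0 + r *\<^sub>R (x0 + sqrt e *\<^sub>R v) \<in> Kt e"
          using cb K0 vT r by (intro convexD) auto
        then have "x0 + sqrt e *\<^sub>R v' \<in> Kt e" by (simp add: v'_def algebra_simps)
        then have "radial_gap (Kt e) (x0 + sqrt e *\<^sub>R v') \<le> 0" using mem[OF v'T v'R] by simp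
        moreover have "\<bar>radial_gap (Kt e) (x0 + sqrt e *\<^sub>R v') - e * \<eta>\<bar> \<le> \<eta> / 2 * e"
          using gap[OF v'T v'R] q' by simp
        moreover have "e * \<eta> = (\<eta> / 2 * e) + (\<eta> / 2 * e)" "0 < \<eta> / 2 * e" using elim \<eta> by auto
        ultimately show False by linarith
      qed
    qed
  qed
qed

text \<open>The section is the image of \<open>C e\<close> under scaling by \<open>sqrt e\<close>
  and a translation, so homogeneity produces the factor \<open>e powr (k / 2)\<close>, exactly the
  normalization in \<open>section_ratio\<close>.\<close>

lemma section_ratio_tendsto:
  fixes K :: "'a::euclidean_space set"
  assumes K: "convex_body K" "0 \<in> interior K" and ad: "admissible_deformation K Kt"
    and x0: "x0 \<noteq> 0" "radial_gap K x0 = 0" and Y: "affine Y" "x0 \<in> Y"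
    and H: "linear H" and pos: "\<And>v. v \<noteq> 0 \<Longrightarrow> n \<bullet> v = 0 \<Longrightarrow> 0 < H v \<bullet> v"
    and nT: "\<And>y. y \<in> Y \<Longrightarrow> n \<bullet> (y - x0) = 0"
    and taylor: "\<And>\<eta>. 0 < \<eta> \<Longrightarrow> \<exists>d>0. \<forall>w. norm w < d \<longrightarrow> \<bar>radial_gap K (x0 + w) - n \<bullet> w - (H w \<bullet> w) / 2\<bar> \<le> \<eta> * (norm w)\<^sup>2"
    and h: "0 \<le> h"
    and speed: "\<And>\<eta>. 0 < \<eta> \<Longrightarrow> \<exists>\<tau>>0. \<forall>t u. 0 \<le> t \<and> t < \<tau> \<and> norm u = 1 \<and> norm (u - sgn x0) < \<tau> \<longrightarrow>
     \<bar>radial_function (Kt t) u - radial_function K u - t * h\<bar> \<le> \<eta> * t"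
    and k: "1 \<le> k"
  defines "T \<equiv> (\<lambda>y. y - x0) ` Y"
  shows "(section_ratio k Kt Y \<longlongrightarrow> sqrt h ^ k * intrinsic_volumes (form_sublevel T H 1) k) (at_right 0)"
proof -
  have Kt: "\<And>t. 0 \<le> t \<Longrightarrow> t \<le> 1 \<Longrightarrow> convex_body (Kt t) \<and> K \<subseteq> Kt t"
    using ad by (auto simp: admissible_deformation_def)
  have K0: "0 \<in> K" using K(2) interior_subset by blast
  have x0K: "x0 \<in> K" using mem_iff_radial_gap[of K x0] K x0 K0 by (simp add: convex_body_def)
  have T: "subspace T" unfolding T_def using Y by (rule affine_diffs_subspace_subtract)
  have nT': "n \<bullet> v = 0" if "v \<in> T" for v using that nT by (auto simp: T_def)
  have posT: "0 < H v \<bullet> v" if "v \<in> T" "v \<noteq> 0" for v using pos nT' that by blast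
  define C where "C e = {v \<in> T. x0 + sqrt e *\<^sub>R v \<in> Kt e}" for e
  have img: "Kt e \<inter> Y = (+) x0 ` ((*\<^sub>R) (sqrt e) ` C e)" if e: "0 < e" for e
  proof (intro equalityI subsetI)
    fix y assume y: "y \<in> Kt e \<inter> Y"
    then have "y - x0 \<in> T" by (auto simp: T_def)
    then have "(y - x0) /\<^sub>R sqrt e \<in> C e" using T y e by (auto simp: C_def subspace_scale)
    moreover have "y = x0 + sqrt e *\<^sub>R ((y - x0) /\<^sub>R sqrt e)" using e by simp
    ultimately show "y \<in> (+) x0 ` ((*\<^sub>R) (sqrt e) ` C e)" by blast
  next
    fix y assume "y \<in> (+) x0 ` ((*\<^sub>R) (sqrt e) ` C e)"
    then obtain v where v: "v \<in> T" "x0 + sqrt e *\<^sub>R v \<in> Kt e" "y = x0 + sqrt e *\<^sub>R v" by (auto simp: C_def)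
    have "sqrt e *\<^sub>R v \<in> T" using T v by (simp add: subspace_scale)
    then show "y \<in> Kt e \<inter> Y" using v by (auto simp: T_def)
  qed
  have cc: "compact_convex (C e)" if e: "0 < e" "e \<le> 1" for e
  proof -
    have kt: "compact (Kt e)" "convex (Kt e)" "K \<subseteq> Kt e" using Kt[of e] e by (auto simp: convex_body_def)
    have "x0 \<in> Kt e \<inter> Y" using kt(3) x0K Y(2) by blast
    then have "compact_convex (Kt e \<inter> Y)"
      using compact_Int_closed[OF kt(1) affine_closed[OF Y(1)]] convex_Int[OF kt(2) affine_imp_convex[OF Y(1)]]
      unfolding compact_convex_def by blast
    then have "compact_convex ((*\<^sub>R) (1 / sqrt e) ` ((+) (- x0) ` (Kt e \<inter> Y)))"
      by (intro compact_convex_scaleR compact_convex_translation)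
    moreover have "(*\<^sub>R) (1 / sqrt e) ` ((+) (- x0) ` (Kt e \<inter> Y)) = C e"
      unfolding img[OF e(1)] image_image using e by simp
    ultimately show ?thesis by simp
  qed
  have ev: "\<forall>\<^sub>F e::real in at_right 0. 0 < e \<and> e \<le> 1" by (auto simp: eventually_at_right[of 0 1] intro!: exI[of _ 1])
  have evc: "\<forall>\<^sub>F e in at_right 0. compact_convex (C e)" using ev by eventually_elim (use cc in blast)
  have sw: "\<forall>\<^sub>F e in at_right 0. form_sublevel T H (h - \<eta>) \<subseteq> C e \<and> C e \<subseteq> form_sublevel T H (h + \<eta>)"
    if "0 < \<eta>" for \<eta>
    unfolding C_def using that
    by (intro rescaled_section_sandwich[OF Kt K0 x0K T H posT h] rescaled_gap_estimate[OF x0(1) nT' H taylor speed]) auto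
  have "((\<lambda>e. intrinsic_volumes (C e) k) \<longlongrightarrow> sqrt h ^ k * intrinsic_volumes (form_sublevel T H 1) k) (at_right 0)"
    by (rule intrinsic_volumes_tendsto[OF T H posT k h evc sw])
  moreover have "\<forall>\<^sub>F e in at_right 0. intrinsic_volumes (C e) k = section_ratio k Kt Y e"
    using ev
  proof eventually_elim
    case (elim e)
    have c: "compact_convex (C e)" using cc elim by blast
    have "intrinsic_volumes (Kt e \<inter> Y) k = sqrt e ^ k * intrinsic_volumes (C e) k"
      using elim c by (simp add: img intrinsic_volumes_translation compact_convex_scaleR intrinsic_volumes_scaleR)
    moreover have "sqrt e ^ k = e powr (real k / 2)"
      using elim by (simp add: powr_half_sqrt[symmetric] powr_powr powr_realpow[symmetric] mult.commute)
    moreover have "e powr (real k / 2) \<noteq> 0" using elim by simp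
    ultimately show ?case by (simp add: section_ratio_def)
  qed
  ultimately show ?thesis by (rule Lim_transform_eventually)
qed

section \<open>Tangent planes and recovery of the speed\<close>

lemma interior_below_supporting_hyperplane:
  fixes K :: "'a::euclidean_space set"
  assumes "\<And>y. y \<in> K \<Longrightarrow> n \<bullet> (y - x0) \<le> 0" "n \<noteq> 0" "y \<in> interior K"
  shows "n \<bullet> (y - x0) < 0"
proof -
  obtain r where r: "r > 0" "cball y r \<subseteq> K" using assms(3) unfolding mem_interior_cball by blast
  define z where "z = y + (r / norm n) *\<^sub>R n"
  have "z \<in> K" using r assms(2) by (intro subsetD[OF r(2)]) (simp add: z_def dist_norm)
  then have "n \<bullet> (z - x0) \<le> 0" by (rule assms(1))
  moreover have "n \<bullet> (z - x0) = n \<bullet> (y - x0) + (r / norm n) * (n \<bullet> n)"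
    by (simp add: z_def inner_diff_right inner_add_right)
  moreover have "0 < (r / norm n) * (n \<bullet> n)" using r assms(2) by simp
  ultimately show ?thesis by simp
qed

theorem theorem1:
  fixes K :: "'a::euclidean_space set"
    and \<L> :: "'a set set"
    and Kt :: "real \<Rightarrow> 'a set"
    and k l :: nat
  assumes "DIM('a) \<ge> 2"
    and "1 \<le> k" and "k \<le> l" and "l \<le> DIM('a) - 1"
    and "convex_body K" and "C2_plus K" and "0 \<in> interior K"
    and "\<forall>L\<in>\<L>. subspace L \<and> dim L = l + 1"
    and "\<Union>\<L> = UNIV"
    and "admissible_deformation K Kt"
  shows "(\<forall>Y. tangent_plane l K Y \<longrightarrow>
            (section_ratio k Kt Y \<longlongrightarrow> section_limit k Kt Y) (at_right 0) \<and>
            0 \<le> section_limit k Kt Y) \<and>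
         (\<forall>Kt'. admissible_deformation K Kt' \<longrightarrow>
            (\<forall>Y. tangent_plane l K Y \<and> span Y \<in> \<L> \<longrightarrow>
                 section_limit k Kt Y = section_limit k Kt' Y) \<longrightarrow>
            (\<forall>u\<in>sphere 0 1. \<exists>D.
                 ((\<lambda>t. radial_function (Kt t) u) has_real_derivative D) (at 0 within {0..1}) \<and>
                 ((\<lambda>t. radial_function (Kt' t) u) has_real_derivative D) (at 0 within {0..1})))"
proof (intro conjI allI impI)
  note k = assms(2) and kl = assms(3) and K = assms(5,6,7) and ad = assms(10)
  have KK: "compact K" "convex K" using K(1) by (auto simp: convex_body_def)
  have K0: "0 \<in> K" using K(3) interior_subset by blast
  have limit: "section_limit k Kt Y = c" if "(section_ratio k Kt Y \<longlongrightarrow> c) (at_right 0)" for Kt Y c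
    unfolding section_limit_def using that by (intro tendsto_Lim) auto
  {
    fix Y assume Y: "tangent_plane l K Y"
    then obtain x0 where x0: "x0 \<in> Y" "x0 \<in> K" and disj: "Y \<inter> interior K = {}" and aY: "affine Y" "aff_dim Y = int l"
      by (auto simp: tangent_plane_def)
    have x0n: "x0 \<noteq> 0" using x0 disj K(3) by auto
    \<comment> \<open>A negative gap would put \<open>x0\<close> strictly between the interior point
      0 and the point \<open>x1 \<in> K\<close> on the same ray, hence into the interior.\<close>
    have x0F: "radial_gap K x0 = 0"
    proof (rule ccontr)
      assume ne: "radial_gap K x0 \<noteq> 0"
      then have neg: "radial_gap K x0 < 0" using mem_iff_radial_gap[OF KK K0 x0n] x0 by simp
      define x1 where "x1 = radial_function K (sgn x0) *\<^sub>R sgn x0"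
      have sn: "norm (sgn x0) = 1" using x0n by (simp add: norm_sgn)
      have rp: "0 < radial_function K (sgn x0)" by (rule radial_function_pos[OF KK K(3) sn])
      have x1n: "x1 \<noteq> 0" using rp sn by (auto simp: x1_def)
      have "x1 \<in> K" using mem_iff_radial_gap[OF KK K0 x1n] radial_gap_radial_function[OF sn rp] by (simp add: x1_def)
      then have "x1 \<in> closure K" using closure_subset by blast
      then have "x1 - (1 - norm x0 / radial_function K (sgn x0)) *\<^sub>R (x1 - 0) \<in> interior K"
        using neg rp x0n by (intro mem_interior_closure_convex_shrink[OF KK(2) K(3)]) (auto simp: radial_gap_def field_simps)
      moreover have "x1 - (1 - norm x0 / radial_function K (sgn x0)) *\<^sub>R (x1 - 0) = x0"
      proof -
        have "x1 - (1 - norm x0 / radial_function K (sgn x0)) *\<^sub>R (x1 - 0)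
          = (norm x0 / radial_function K (sgn x0)) *\<^sub>R x1" by (simp add: scaleR_diff_left)
        also have "\<dots> = norm x0 *\<^sub>R sgn x0" using rp by (simp add: x1_def)
        also have "\<dots> = x0" using x0n by (simp add: sgn_div_norm)
        finally show ?thesis .
      qed
      ultimately show False using x0 disj by auto
    qed
    obtain n H where nH: "linear H" "0 < n \<bullet> x0" "\<And>y. y \<in> K \<Longrightarrow> n \<bullet> (y - x0) \<le> 0"
      "\<And>w. n \<bullet> w < 0 \<Longrightarrow> \<exists>s>0. x0 + s *\<^sub>R w \<in> interior K"
      "\<And>v. v \<noteq> 0 \<Longrightarrow> n \<bullet> v = 0 \<Longrightarrow> 0 < H v \<bullet> v"
      "\<And>\<eta>. 0 < \<eta> \<Longrightarrow> \<exists>d>0. \<forall>w. norm w < d \<longrightarrow> \<bar>radial_gap K (x0 + w) - n \<bullet> w - (H w \<bullet> w) / 2\<bar> \<le> \<eta> * (norm w)\<^sup>2"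
      by (rule frontier_expansion[OF K ad x0n x0F]) (rule that)
    have sn: "norm (sgn x0) = 1" using x0n by (simp add: norm_sgn)
    obtain h where h: "0 \<le> h"
      "((\<lambda>t. radial_function (Kt t) (sgn x0)) has_real_derivative h) (at 0 within {0..1})"
      "\<And>\<eta>. 0 < \<eta> \<Longrightarrow> \<exists>\<tau>>0. \<forall>t u. 0 \<le> t \<and> t < \<tau> \<and> norm u = 1 \<and> norm (u - sgn x0) < \<tau> \<longrightarrow>
       \<bar>radial_function (Kt t) u - radial_function K u - t * h\<bar> \<le> \<eta> * t"
      by (rule deformation_speed[OF K(1,3) ad sn]) (rule that)
    define T where "T = (\<lambda>y. y - x0) ` Y"
    have T: "subspace T" unfolding T_def using aY(1) x0(1) by (rule affine_diffs_subspace_subtract)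
    \<comment> \<open>A direction of \<open>Y\<close> with negative product would lead into the
      interior of \<open>K\<close>. Since \<open>T\<close> is closed under negation,
      \<open>n\<close> vanishes on it, so \<open>Y\<close> lies in the supporting
      hyperplane.\<close>
    have ge: "0 \<le> n \<bullet> v" if "v \<in> T" for v
    proof (rule ccontr)
      assume "\<not> 0 \<le> n \<bullet> v"
      then obtain s where s: "s > 0" "x0 + s *\<^sub>R v \<in> interior K" using nH(4)[of v] by auto
      have "s *\<^sub>R v \<in> T" using T that by (simp add: subspace_scale)
      then have "x0 + s *\<^sub>R v \<in> Y" by (auto simp: T_def)
      then show False using s disj by blast
    qed
    have nT: "n \<bullet> v = 0" if "v \<in> T" for v
      using ge[OF that] ge[of "- v"] that T by (simp add: subspace_neg)
    have nY: "n \<bullet> (y - x0) = 0" if "y \<in> Y" for y using nT[of "y - x0"] that by (auto simp: T_def)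
    have lim: "(section_ratio k Kt Y \<longlongrightarrow> sqrt h ^ k * intrinsic_volumes (form_sublevel T H 1) k) (at_right 0)"
      unfolding T_def by (rule section_ratio_tendsto[OF K(1,3) ad x0n x0F aY(1) x0(1) nH(1,5) nY nH(6) h(1,3) k])
    then show "(section_ratio k Kt Y \<longlongrightarrow> section_limit k Kt Y) (at_right 0)" using limit[OF lim] by simp
    have "0 \<le> intrinsic_volumes (form_sublevel T H 1) k"
      using nH(5) nT by (intro intrinsic_volumes_nonneg compact_convex_form_sublevel T nH(1)) auto
    then show "0 \<le> section_limit k Kt Y" using limit[OF lim] h(1) by simp
  }
  fix Kt' assume ad': "admissible_deformation K Kt'"
    and eq: "\<forall>Y. tangent_plane l K Y \<and> span Y \<in> \<L> \<longrightarrow> section_limit k Kt Y = section_limit k Kt' Y"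
  show "\<forall>u\<in>sphere 0 1. \<exists>D.
     ((\<lambda>t. radial_function (Kt t) u) has_real_derivative D) (at 0 within {0..1}) \<and>
     ((\<lambda>t. radial_function (Kt' t) u) has_real_derivative D) (at 0 within {0..1})"
  proof
    fix u :: 'a assume "u \<in> sphere 0 1"
    then have u: "norm u = 1" by simp
    have su: "sgn u = u" using u by (simp add: sgn_div_norm)
    define x0 where "x0 = radial_function K u *\<^sub>R u"
    have rp: "0 < radial_function K u" by (rule radial_function_pos[OF KK K(3) u])
    have x0n: "x0 \<noteq> 0" using rp u by (auto simp: x0_def)
    have x0F: "radial_gap K x0 = 0" using radial_gap_radial_function[OF u rp] by (simp add: x0_def)
    have sx0: "sgn x0 = u" using rp su by (simp add: x0_def sgn_scaleR)
    have x0K: "x0 \<in> K" using mem_iff_radial_gap[OF KK K0 x0n] x0F by simp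
    obtain n H where nH: "linear H" "0 < n \<bullet> x0" "\<And>y. y \<in> K \<Longrightarrow> n \<bullet> (y - x0) \<le> 0"
      "\<And>w. n \<bullet> w < 0 \<Longrightarrow> \<exists>s>0. x0 + s *\<^sub>R w \<in> interior K"
      "\<And>v. v \<noteq> 0 \<Longrightarrow> n \<bullet> v = 0 \<Longrightarrow> 0 < H v \<bullet> v"
      "\<And>\<eta>. 0 < \<eta> \<Longrightarrow> \<exists>d>0. \<forall>w. norm w < d \<longrightarrow> \<bar>radial_gap K (x0 + w) - n \<bullet> w - (H w \<bullet> w) / 2\<bar> \<le> \<eta> * (norm w)\<^sup>2"
      by (rule frontier_expansion[OF K ad x0n x0F]) (rule that)
    obtain h where h: "0 \<le> h" "((\<lambda>t. radial_function (Kt t) u) has_real_derivative h) (at 0 within {0..1})"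
      "\<And>\<eta>. 0 < \<eta> \<Longrightarrow> \<exists>\<tau>>0. \<forall>t v. 0 \<le> t \<and> t < \<tau> \<and> norm v = 1 \<and> norm (v - u) < \<tau> \<longrightarrow>
       \<bar>radial_function (Kt t) v - radial_function K v - t * h\<bar> \<le> \<eta> * t"
      by (rule deformation_speed[OF K(1,3) ad u]) (rule that)
    obtain h' where h': "0 \<le> h'" "((\<lambda>t. radial_function (Kt' t) u) has_real_derivative h') (at 0 within {0..1})"
      "\<And>\<eta>. 0 < \<eta> \<Longrightarrow> \<exists>\<tau>>0. \<forall>t v. 0 \<le> t \<and> t < \<tau> \<and> norm v = 1 \<and> norm (v - u) < \<tau> \<longrightarrow>
       \<bar>radial_function (Kt' t) v - radial_function K v - t * h'\<bar> \<le> \<eta> * t"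
      by (rule deformation_speed[OF K(1,3) ad' u]) (rule that)
    obtain L where L: "L \<in> \<L>" "x0 \<in> L" using assms(9) by blast
    then have sL: "subspace L" "dim L = l + 1" using assms(8) by auto
    define Y where "Y = L \<inter> {y. n \<bullet> y = n \<bullet> x0}"
    have x0Y: "x0 \<in> Y" using L by (simp add: Y_def)
    have aY: "affine Y" unfolding Y_def using sL(1) by (intro affine_Int subspace_imp_affine affine_hyperplane)
    have dY: "aff_dim Y = int l"
    proof -
      \<comment> \<open>The hyperplane misses the origin, as \<open>n \<bullet> x0 > 0\<close>, so
        intersecting \<open>L\<close> with it lowers the dimension by exactly one.\<close>
      have "\<not> L \<subseteq> {y. n \<bullet> y = n \<bullet> x0}" using subspace_0[OF sL(1)] nH(2) by force
      moreover have "L \<inter> {y. n \<bullet> y = n \<bullet> x0} \<noteq> {}" using x0Y unfolding Y_def by blast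
      ultimately have "aff_dim Y = aff_dim L - 1"
        unfolding Y_def using aff_dim_affine_Int_hyperplane[OF subspace_imp_affine[OF sL(1)], of n "n \<bullet> x0"] by simp
      then show ?thesis using aff_dim_subspace[OF sL(1)] sL(2) by simp
    qed
    have "n \<noteq> 0" using nH(2) by auto
    then have "n \<bullet> (y - x0) < 0" if "y \<in> interior K" for y
      using interior_below_supporting_hyperplane[OF nH(3) _ that] by blast
    then have "Y \<inter> interior K = {}" by (force simp: Y_def inner_diff_right)
    then have tY: "tangent_plane l K Y" using aY dY x0Y x0K by (auto simp: tangent_plane_def)
    have "span Y = L"
    proof
      show "span Y \<subseteq> L" using sL(1) by (intro span_minimal) (auto simp: Y_def)
      show "L \<subseteq> span Y"
      proof
        fix v assume v: "v \<in> L"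
        \<comment> \<open>Subtracting this multiple of \<open>x0\<close> makes \<open>v\<close>
          parallel to the hyperplane, so \<open>v\<close> is a difference of two points of
          \<open>Y\<close> plus a multiple of \<open>x0\<close>.\<close>
        define c where "c = (n \<bullet> v) / (n \<bullet> x0)"
        have "x0 + (v - c *\<^sub>R x0) \<in> Y" using v L sL(1) nH(2)
          by (auto simp: Y_def c_def inner_add_right inner_diff_right intro!: subspace_add subspace_diff subspace_scale)
        then have "(x0 + (v - c *\<^sub>R x0)) - x0 + c *\<^sub>R x0 \<in> span Y"
          using x0Y by (intro span_add span_diff span_scale span_base)
        then show "v \<in> span Y" by simp
      qed
    qed
    then have eqY: "section_limit k Kt Y = section_limit k Kt' Y" using eq tY L by blast
    define T where "T = (\<lambda>y. y - x0) ` Y"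
    have T: "subspace T" unfolding T_def using aY x0Y by (rule affine_diffs_subspace_subtract)
    have dT: "dim T = l" using aff_dim_dim_affine_diffs[OF aY x0Y] dY by (simp add: T_def)
    have nY: "n \<bullet> (y - x0) = 0" if "y \<in> Y" for y using that by (simp add: Y_def inner_diff_right)
    define c where "c = intrinsic_volumes (form_sublevel T H 1) k"
    \<comment> \<open>Positivity needs \<open>k \<le> l = dim T\<close>; without it the limit could
      vanish for every speed.\<close>
    have c: "0 < c" unfolding c_def using nH(5) nY kl dT
      by (intro intrinsic_volumes_form_sublevel_pos T nH(1)) (auto simp: T_def)
    \<comment> \<open>Both limits carry the same constant \<open>c\<close>, since \<open>T\<close>
      and \<open>H\<close> are common to the two deformations. As \<open>c > 0\<close> and
      \<open>k \<ge> 1\<close>, equal limits force equal speeds.\<close>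
    have "section_limit k Kt Y = sqrt h ^ k * c" unfolding c_def T_def
      by (rule limit, rule section_ratio_tendsto[OF K(1,3) ad x0n x0F aY x0Y nH(1,5) nY nH(6) h(1) h(3)[folded sx0] k])
    moreover have "section_limit k Kt' Y = sqrt h' ^ k * c" unfolding c_def T_def
      by (rule limit, rule section_ratio_tendsto[OF K(1,3) ad' x0n x0F aY x0Y nH(1,5) nY nH(6) h'(1) h'(3)[folded sx0] k])
    ultimately have "sqrt h ^ k = sqrt h' ^ k" using eqY c by simp
    then have "sqrt h = sqrt h'" using k h(1) h'(1) by (intro power_eq_imp_eq_base[of "sqrt h" k "sqrt h'"]) auto
    then have "h = h'" by simp
    then show "\<exists>D. ((\<lambda>t. radial_function (Kt t) u) has_real_derivative D) (at 0 within {0..1}) \<and>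
     ((\<lambda>t. radial_function (Kt' t) u) has_real_derivative D) (at 0 within {0..1})"
      using h(2) h'(2) by blast
  qed
qed

end
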